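(* (1) For even $k$ with $2\le k\le n$, the homomorphism $\mathrm{Tr}_{[1^k]}\circ\tau_k:\mathrm{gr}^k(\mathcal{A}_n)\to\Lambda^kH_{\mathbf{Q}}$ satisfies $$0\ne\mathrm{tg}(\mathrm{Tr}_{[1^k]}\circ\tau_k)\in H^2(T_{n,k},\Lambda^kH_{\mathbf{Q}}),$$ where $\mathrm{tg}$ is the transgression map of the group extension $0\to\mathrm{gr}^k(\mathcal{A}_n)\to T_{n,k+1}\to T_{n,k}\to1$. (2) For $k\ge3$ and $n\ge k$, the homomorphism $\mathrm{Tr}_{[1^k]}:\mathrm{Hom}_{\mathbf{Z}}(H,\mathcal{L}_n(k+1))\to\Lambda^kH_{\mathbf{Q}}$ satisfies $$0\ne\mathrm{tg}(\mathrm{Tr}_{[1^k]})\in H^2(\mathrm{Aut}\,N_{n,k},\Lambda^kH_{\mathbf{Q}}),$$ where $\mathrm{tg}$ is the transgression map of the group extension $0\to\mathrm{Hom}_{\mathbf{Z}}(H,\mathcal{L}_n(k+1))\to\mathrm{Aut}\,N_{n,k+1}\to\mathrm{Aut}\,N_{n,k}\to1$.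
   Context: $F_n$ is the free group on $x_1,\ldots,x_n$, $\Gamma_n(1)=F_n\supset\Gamma_n(2)\supset\cdots$ its lower central series, $H=F_n^{\mathrm{ab}}$, $H_{\mathbf{Q}}=H\otimes_{\mathbf{Z}}\mathbf{Q}$, $\mathcal{L}_n(k)=\Gamma_n(k)/\Gamma_n(k+1)$; $\mathcal{L}_n=\bigoplus_k\mathcal{L}_n(k)$ is the free Lie algebra over $\mathbf{Z}$ generated by $H$. $N_{n,k}=F_n/\Gamma_n(k+1)$ is the free nilpotent group of class $k$, and $T_{n,k}$ is the image of the natural homomorphism $\mathrm{Aut}\,F_n\to\mathrm{Aut}\,N_{n,k}$. $\mathcal{A}_n(k)$ is the kernel of $\mathrm{Aut}\,F_n\to\mathrm{Aut}\,N_{n,k}$ and $\mathrm{gr}^k(\mathcal{A}_n)=\mathcal{A}_n(k)/\mathcal{A}_n(k+1)$, which is the kernel of $T_{n,k+1}\to T_{n,k}$. The Johnson homomorphism $\tau_k:\mathrm{gr}^k(\mathcal{A}_n)\to\mathrm{Hom}_{\mathbf{Z}}(H,\mathcal{L}_n(k+1))=H^*\otimes_{\mathbf{Z}}\mathcal{L}_n(k+1)$ is induced by $\sigma\mapsto(x\mapsto x^{-1}x^\sigma)$, with $x^\sigma$ the image of $x$ under $\sigma$. In the second extension, $f\in\mathrm{Hom}_{\mathbf{Z}}(H,\mathcal{L}_n(k+1))$ corresponds to the automorphism $x\mapsto f([x])\,x$ of $N_{n,k+1}$, where $[x]$ is the class of $x$ in $H$ and $\mathcal{L}_n(k+1)$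 is viewed as the central subgroup $\Gamma_n(k+1)/\Gamma_n(k+2)$ of $N_{n,k+1}$. Trace map: let $\iota_{k+1}:\mathcal{L}_n(k+1)\hookrightarrow H^{\otimes(k+1)}$ be the embedding determined by $[X,Y]\mapsto X\otimes Y-Y\otimes X$; let $\varphi^k:H^*\otimes H^{\otimes(k+1)}\to H^{\otimes k}$, $x_i^*\otimes x_{j_1}\otimes\cdots\otimes x_{j_{k+1}}\mapsto x_i^*(x_{j_1})\,x_{j_2}\otimes\cdots\otimes x_{j_{k+1}}$; let $f_{[1^k]}:H^{\otimes k}\to\Lambda^kH$ be the natural projection. Then $\mathrm{Tr}_{[1^k]}=f_{[1^k]}\circ\varphi^k\circ(\mathrm{id}_{H^*}\otimes\iota_{k+1}):H^*\otimes_{\mathbf{Z}}\mathcal{L}_n(k+1)\to\Lambda^kH$, here composed with $\Lambda^kH\to\Lambda^kH_{\mathbf{Q}}$. $T_{n,k}$ and $\mathrm{Aut}\,N_{n,k}$ act on $\Lambda^kH_{\mathbf{Q}}$ through their natural action on $H$, i.e. through $\mathrm{GL}(n,\mathbf{Z})=\mathrm{Aut}\,H$. For a group extension $1\to K\to G\to Q\to1$ and a $Q$-module $M$, the transgression is the map $\mathrm{tg}:H^1(K,M)^Q=\mathrm{Hom}(K,M)^Q\to H^2(Q,M)$ in the five-term exact sequence $0\to H^1(Q,M)\to H^1(G,M)\to H^1(K,M)^Q\to H^2(Q,M)\to H^2(G,M)$; the maps $\mathrm{Tr}_{[1^k]}\circ\tau_k$ and $\mathrm{Tr}_{[1^k]}$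 are $\mathrm{GL}(n,\mathbf{Z})$-equivariant and so lie in $H^1(K,\Lambda^kH_{\mathbf{Q}})^{Q}$ for the respective extension. *)

theory Defs
  imports "HOL-Algebra.Bij" "HOL-Algebra.Generated_Groups" "HOL-Algebra.Product_Groups"
begin

section \<open>Second group cohomology and transgression\<close>

text \<open>
  Groups are HOL-Algebra structures. A module over a group \<open>Q\<close> is a commutative group \<open>M\<close>,
  written multiplicatively, with a left action \<open>act\<close> of \<open>Q\<close> by automorphisms of \<open>M\<close>.
  Cohomology is computed by inhomogeneous cochains, not assumed to be normalized.
\<close>

definition cochains1 :: "('q, 'x) monoid_scheme \<Rightarrow> ('m, 'y) monoid_scheme \<Rightarrow> ('q \<Rightarrow> 'm) monoid" where
  "cochains1 Q M = product_group (carrier Q) (\<lambda>_. M)"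

definition cochains2 ::
  "('q, 'x) monoid_scheme \<Rightarrow> ('m, 'y) monoid_scheme \<Rightarrow> ('q \<times> 'q \<Rightarrow> 'm) monoid" where
  "cochains2 Q M = product_group (carrier Q \<times> carrier Q) (\<lambda>_. M)"

definition cocycles2 ::
  "('q, 'x) monoid_scheme \<Rightarrow> ('m, 'y) monoid_scheme \<Rightarrow> ('q \<Rightarrow> 'm \<Rightarrow> 'm) \<Rightarrow> ('q \<times> 'q \<Rightarrow> 'm) set" where
  "cocycles2 Q M act = {z \<in> carrier (cochains2 Q M).
     \<forall>p\<in>carrier Q. \<forall>q\<in>carrier Q. \<forall>r\<in>carrier Q.
       act p (z (q, r)) \<otimes>\<^bsub>M\<^esub> z (p, q \<otimes>\<^bsub>Q\<^esub> r) = z (p \<otimes>\<^bsub>Q\<^esub> q, r) \<otimes>\<^bsub>M\<^esub> z (p, q)}"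

definition coboundary1 ::
  "('q, 'x) monoid_scheme \<Rightarrow> ('m, 'y) monoid_scheme \<Rightarrow> ('q \<Rightarrow> 'm \<Rightarrow> 'm) \<Rightarrow>
   ('q \<Rightarrow> 'm) \<Rightarrow> 'q \<times> 'q \<Rightarrow> 'm" where
  "coboundary1 Q M act c = (\<lambda>(q, r)\<in>carrier Q \<times> carrier Q.
     act q (c r) \<otimes>\<^bsub>M\<^esub> inv\<^bsub>M\<^esub> (c (q \<otimes>\<^bsub>Q\<^esub> r)) \<otimes>\<^bsub>M\<^esub> c q)"

definition coboundaries2 ::
  "('q, 'x) monoid_scheme \<Rightarrow> ('m, 'y) monoid_scheme \<Rightarrow> ('q \<Rightarrow> 'm \<Rightarrow> 'm) \<Rightarrow> ('q \<times> 'q \<Rightarrow> 'm) set" where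
  "coboundaries2 Q M act = coboundary1 Q M act ` carrier (cochains1 Q M)"

definition cohomology2 ::
  "('q, 'x) monoid_scheme \<Rightarrow> ('m, 'y) monoid_scheme \<Rightarrow> ('q \<Rightarrow> 'm \<Rightarrow> 'm) \<Rightarrow> ('q \<times> 'q \<Rightarrow> 'm) set monoid" where
  "cohomology2 Q M act =
     (cochains2 Q M)\<lparr>carrier := cocycles2 Q M act\<rparr> Mod coboundaries2 Q M act"

text \<open>
  For an extension of \<open>Q\<close> by \<open>K\<close> with inclusion \<open>i : K \<rightarrow> G\<close> and projection \<open>p : G \<rightarrow> Q\<close>, the
  following is \<open>H^1(K, M)^Q = Hom(K, M)^Q\<close> (\<open>K\<close> acts trivially on \<open>M\<close>). An element \<open>q\<close> of \<open>Q\<close>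
  acts on \<open>K\<close> through conjugation by a lift of \<open>q\<close> to \<open>G\<close>, so that invariance of \<open>f\<close> is equivariance.
\<close>

definition invariant_homs ::
  "('k, 'u) monoid_scheme \<Rightarrow> ('k \<Rightarrow> 'g) \<Rightarrow> ('g, 'v) monoid_scheme \<Rightarrow> ('g \<Rightarrow> 'q) \<Rightarrow>
   ('m, 'y) monoid_scheme \<Rightarrow> ('q \<Rightarrow> 'm \<Rightarrow> 'm) \<Rightarrow> ('k \<Rightarrow> 'm) set" where
  "invariant_homs K i G p M act = {f \<in> hom K M.
     \<forall>g\<in>carrier G. \<forall>x\<in>carrier K.
       f (inv_into (carrier K) i (g \<otimes>\<^bsub>G\<^esub> i x \<otimes>\<^bsub>G\<^esub> inv\<^bsub>G\<^esub> g)) = act (p g) (f x)}"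

text \<open>
  The transgression sends \<open>f\<close> to the push-forward along \<open>f\<close> of the extension class: with \<open>s\<close> a
  set-theoretic section of \<open>p\<close>, the class of \<open>(q, r) \<mapsto> f (s q * s r * (s (q r))^-1)\<close>. The class
  does not depend on \<open>s\<close>. Some authors use the opposite sign.
\<close>

definition transgression ::
  "('k, 'u) monoid_scheme \<Rightarrow> ('k \<Rightarrow> 'g) \<Rightarrow> ('g, 'v) monoid_scheme \<Rightarrow> ('g \<Rightarrow> 'q) \<Rightarrow> ('q, 'x) monoid_scheme \<Rightarrow>
   ('m, 'y) monoid_scheme \<Rightarrow> ('q \<Rightarrow> 'm \<Rightarrow> 'm) \<Rightarrow> ('k \<Rightarrow> 'm) \<Rightarrow> ('q \<times> 'q \<Rightarrow> 'm) set" where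
  "transgression K i G p Q M act = (\<lambda>f\<in>invariant_homs K i G p M act.
     let s = inv_into (carrier G) p in
       coboundaries2 Q M act #>\<^bsub>cochains2 Q M\<^esub>
         (\<lambda>(q, r)\<in>carrier Q \<times> carrier Q.
            f (inv_into (carrier K) i (s q \<otimes>\<^bsub>G\<^esub> s r \<otimes>\<^bsub>G\<^esub> inv\<^bsub>G\<^esub> (s (q \<otimes>\<^bsub>Q\<^esub> r))))))"


section \<open>Free groups and their nilpotent quotients\<close>

text \<open>
  The letter \<open>(i, True)\<close> is the generator \<open>x_i\<close> and \<open>(i, False)\<close> is its inverse; generators are
  indexed by \<open>i < n\<close>. The free group consists of the reduced words, and multiplication pushes
  the letters of the left factor one by one onto the right factor, cancelling where possible.
\<close>

definition inv_letter :: "nat \<times> bool \<Rightarrow> nat \<times> bool" where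
  "inv_letter a = (fst a, \<not> snd a)"

fun push :: "nat \<times> bool \<Rightarrow> (nat \<times> bool) list \<Rightarrow> (nat \<times> bool) list" where
  "push a [] = [a]"
| "push a (b # w) = (if b = inv_letter a then w else a # b # w)"

definition free_group :: "nat \<Rightarrow> (nat \<times> bool) list monoid" where
  "free_group n =
     \<lparr>carrier = {w. fst ` set w \<subseteq> {..<n} \<and> successively (\<lambda>a b. b \<noteq> inv_letter a) w},
      monoid.mult = (\<lambda>u v. foldr push u v),
      one = []\<rparr>"

definition gen :: "nat \<Rightarrow> (nat \<times> bool) list" where
  "gen i = [(i, True)]"

definition commutator :: "('a, 'b) monoid_scheme \<Rightarrow> 'a \<Rightarrow> 'a \<Rightarrow> 'a" where
  "commutator G x y = x \<otimes>\<^bsub>G\<^esub> y \<otimes>\<^bsub>G\<^esub> inv\<^bsub>G\<^esub> x \<otimes>\<^bsub>G\<^esub> inv\<^bsub>G\<^esub> y"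

text \<open>The numbering starts with \<open>\<Gamma>(1) = G\<close>; the value at \<open>0\<close> is not used.\<close>

fun lower_central :: "('a, 'b) monoid_scheme \<Rightarrow> nat \<Rightarrow> 'a set" where
  "lower_central G 0 = carrier G"
| "lower_central G (Suc 0) = carrier G"
| "lower_central G (Suc (Suc k)) =
     generate G {commutator G x y |x y. x \<in> lower_central G (Suc k) \<and> y \<in> carrier G}"

abbreviation \<Gamma> :: "nat \<Rightarrow> nat \<Rightarrow> (nat \<times> bool) list set" where
  "\<Gamma> n k \<equiv> lower_central (free_group n) k"

definition abelianization :: "nat \<Rightarrow> (nat \<times> bool) list set monoid" where
  "abelianization n = free_group n Mod \<Gamma> n 2"

definition lie :: "nat \<Rightarrow> nat \<Rightarrow> (nat \<times> bool) list set monoid" where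
  "lie n k = (free_group n)\<lparr>carrier := \<Gamma> n k\<rparr> Mod \<Gamma> n (k + 1)"

definition nilp :: "nat \<Rightarrow> nat \<Rightarrow> (nat \<times> bool) list set monoid" where
  "nilp n k = free_group n Mod \<Gamma> n (k + 1)"

text \<open>
  All these quotients consist of cosets in the free group. Hence \<open>lie n (k + 1)\<close> is literally
  the subgroup \<open>\<Gamma>(k+1)/\<Gamma>(k+2)\<close> of \<open>nilp n (k + 1)\<close>, \<open>nilp n 1\<close> is \<open>abelianization n\<close>, and for
  \<open>j \<le> k\<close> the projection \<open>nilp n k \<rightarrow> nilp n j\<close> maps a coset to the larger coset containing it.
\<close>


section \<open>Automorphism groups and the Johnson homomorphism\<close>

text \<open>The natural maps \<open>Aut F_n \<rightarrow> Aut N_{n,k}\<close> and, for \<open>j \<le> k\<close>, \<open>Aut N_{n,k} \<rightarrow> Aut N_{n,j}\<close>.\<close>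

definition aut_reduce ::
  "nat \<Rightarrow> nat \<Rightarrow> ((nat \<times> bool) list \<Rightarrow> (nat \<times> bool) list) \<Rightarrow>
   (nat \<times> bool) list set \<Rightarrow> (nat \<times> bool) list set" where
  "aut_reduce n k \<sigma> = (\<lambda>C\<in>carrier (nilp n k). \<sigma> ` C)"

definition aut_descend ::
  "nat \<Rightarrow> nat \<Rightarrow> nat \<Rightarrow> ((nat \<times> bool) list set \<Rightarrow> (nat \<times> bool) list set) \<Rightarrow>
   (nat \<times> bool) list set \<Rightarrow> (nat \<times> bool) list set" where
  "aut_descend n k j \<alpha> = (\<lambda>C\<in>carrier (nilp n j). \<Union>D\<in>{D \<in> carrier (nilp n k). D \<subseteq> C}. \<alpha> D)"

definition tame :: "nat \<Rightarrow> nat \<Rightarrow> ((nat \<times> bool) list set \<Rightarrow> (nat \<times> bool) list set) monoid" where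
  "tame n k = (AutoGroup (nilp n k))\<lparr>carrier := aut_reduce n k ` carrier (AutoGroup (free_group n))\<rparr>"

definition johnson_filtration :: "nat \<Rightarrow> nat \<Rightarrow> ((nat \<times> bool) list \<Rightarrow> (nat \<times> bool) list) set" where
  "johnson_filtration n k = kernel (AutoGroup (free_group n)) (AutoGroup (nilp n k)) (aut_reduce n k)"

definition gr_johnson :: "nat \<Rightarrow> nat \<Rightarrow> ((nat \<times> bool) list \<Rightarrow> (nat \<times> bool) list) set monoid" where
  "gr_johnson n k =
     (AutoGroup (free_group n))\<lparr>carrier := johnson_filtration n k\<rparr> Mod johnson_filtration n (k + 1)"

definition gr_incl ::
  "nat \<Rightarrow> nat \<Rightarrow> ((nat \<times> bool) list \<Rightarrow> (nat \<times> bool) list) set \<Rightarrow>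
   (nat \<times> bool) list set \<Rightarrow> (nat \<times> bool) list set" where
  "gr_incl n k S = the_elem (aut_reduce n (k + 1) ` S)"

definition hom_group ::
  "('a, 'x) monoid_scheme \<Rightarrow> ('b, 'y) monoid_scheme \<Rightarrow> ('a \<Rightarrow> 'b) monoid" where
  "hom_group A B =
     (product_group (carrier A) (\<lambda>_. B))\<lparr>carrier := hom A B \<inter> extensional (carrier A)\<rparr>"

text \<open>
  In the next definition the unions run over representatives \<open>\<sigma>\<close> of \<open>S\<close> and \<open>x\<close> of \<open>h\<close>; all of
  them give the same coset. The same device is used for maps on quotients below.
\<close>

definition johnson_hom ::
  "nat \<Rightarrow> nat \<Rightarrow> ((nat \<times> bool) list \<Rightarrow> (nat \<times> bool) list) set \<Rightarrow>
   (nat \<times> bool) list set \<Rightarrow> (nat \<times> bool) list set" where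
  "johnson_hom n k S = (\<lambda>h\<in>carrier (abelianization n).
     \<Union>\<sigma>\<in>S. \<Union>x\<in>h. \<Gamma> n (k + 2) #>\<^bsub>free_group n\<^esub> (inv\<^bsub>free_group n\<^esub> x \<otimes>\<^bsub>free_group n\<^esub> \<sigma> x))"

text \<open>
  The automorphism \<open>x \<mapsto> f([x]) x\<close> of \<open>N_{n,k+1}\<close> given by \<open>f : H \<rightarrow> L_n(k+1)\<close>;
  the class in \<open>H\<close> of a coset \<open>C\<close> of \<open>\<Gamma>(k+2)\<close> is \<open>\<Gamma>(2) C\<close>.
\<close>

definition hom_incl ::
  "nat \<Rightarrow> nat \<Rightarrow> ((nat \<times> bool) list set \<Rightarrow> (nat \<times> bool) list set) \<Rightarrow>
   (nat \<times> bool) list set \<Rightarrow> (nat \<times> bool) list set" where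
  "hom_incl n k f = (\<lambda>C\<in>carrier (nilp n (k + 1)).
     f (\<Gamma> n 2 <#>\<^bsub>free_group n\<^esub> C) \<otimes>\<^bsub>nilp n (k + 1)\<^esub> C)"


section \<open>Tensor and exterior powers\<close>

text \<open>
  Let \<open>R\<close> be the coefficient ring. Since \<open>H\<close> is free on the classes of the generators, the tensor
  power \<open>(H \<otimes> R)^{\<otimes>k}\<close> is free on the tensors \<open>x_{j_1} \<otimes> ... \<otimes> x_{j_k}\<close>. An element is
  represented by its coefficient function on the lists \<open>[j_1, ..., j_k]\<close>.
\<close>

definition index_words :: "nat \<Rightarrow> nat \<Rightarrow> nat list set" where
  "index_words n k = {w. length w = k \<and> set w \<subseteq> {..<n}}"

definition tensor_power :: "nat \<Rightarrow> nat \<Rightarrow> (nat list \<Rightarrow> 'r::comm_ring_1) monoid" where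
  "tensor_power n k =
     \<lparr>carrier = {t. \<forall>w. w \<notin> index_words n k \<longrightarrow> t w = 0},
      monoid.mult = (\<lambda>s t w. s w + t w),
      one = (\<lambda>w. 0)\<rparr>"

definition tensor_mult ::
  "nat \<Rightarrow> (nat list \<Rightarrow> 'r::comm_ring_1) \<Rightarrow> (nat list \<Rightarrow> 'r) \<Rightarrow> nat list \<Rightarrow> 'r" where
  "tensor_mult i s t = (\<lambda>w. s (take i w) * t (drop i w))"
  \<comment> \<open>\<open>s \<otimes> t\<close> for \<open>s\<close> of degree \<open>i\<close>\<close>

text \<open>
  \<open>pure_tensor n k v\<close> is \<open>v_0 \<otimes> ... \<otimes> v_{k-1}\<close>, where \<open>v l\<close> is the coordinate vector of the
  \<open>l\<close>-th factor. The exterior power is the quotient by the submodule spanned by the pure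
  tensors having two equal factors.
\<close>

definition pure_tensor :: "nat \<Rightarrow> nat \<Rightarrow> (nat \<Rightarrow> nat \<Rightarrow> 'r::comm_ring_1) \<Rightarrow> nat list \<Rightarrow> 'r" where
  "pure_tensor n k v = (\<lambda>w. if w \<in> index_words n k then \<Prod>l<k. v l (w ! l) else 0)"

definition alt_relations :: "nat \<Rightarrow> nat \<Rightarrow> (nat list \<Rightarrow> 'r::comm_ring_1) set" where
  "alt_relations n k = generate (tensor_power n k)
     {(\<lambda>w. c * pure_tensor n k v w) |c v. \<exists>i j. i < j \<and> j < k \<and> v i = v j}"

definition ext_power :: "nat \<Rightarrow> nat \<Rightarrow> (nat list \<Rightarrow> 'r::comm_ring_1) set monoid" where
  "ext_power n k = tensor_power n k Mod alt_relations n k"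

definition ext_proj :: "nat \<Rightarrow> nat \<Rightarrow> (nat list \<Rightarrow> 'r::comm_ring_1) \<Rightarrow> (nat list \<Rightarrow> 'r) set" where
  "ext_proj n k t = alt_relations n k #>\<^bsub>tensor_power n k\<^esub> t"

text \<open>\<open>\<Lambda>^k H_Q\<close> is the \<open>k\<close>-th exterior power of the rational vector space \<open>H_Q\<close>.\<close>

abbreviation ext_power_rat :: "nat \<Rightarrow> nat \<Rightarrow> (nat list \<Rightarrow> rat) set monoid" where
  "ext_power_rat n k \<equiv> ext_power n k"

definition ext_int_to_rat :: "nat \<Rightarrow> nat \<Rightarrow> (nat list \<Rightarrow> int) set \<Rightarrow> (nat list \<Rightarrow> rat) set" where
  "ext_int_to_rat n k C = (\<Union>t\<in>C. ext_proj n k (\<lambda>w. of_int (t w)))"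

text \<open>
  The coordinates of a class in \<open>H\<close> are the exponent sums of its representatives. The matrix of
  an automorphism \<open>\<beta>\<close> of \<open>H\<close> has as entry \<open>(j, i)\<close> the coefficient of \<open>x_j\<close> in \<open>\<beta>(x_i)\<close>.
\<close>

definition exponent_sum :: "nat \<Rightarrow> (nat \<times> bool) list \<Rightarrow> int" where
  "exponent_sum j w = int (count_list w (j, True)) - int (count_list w (j, False))"

definition H_coord :: "(nat \<times> bool) list set \<Rightarrow> nat \<Rightarrow> int" where
  "H_coord h j = the_elem (exponent_sum j ` h)"

definition H_matrix ::
  "nat \<Rightarrow> ((nat \<times> bool) list set \<Rightarrow> (nat \<times> bool) list set) \<Rightarrow> nat \<Rightarrow> nat \<Rightarrow> int" where
  "H_matrix n \<beta> j i = H_coord (\<beta> (\<Gamma> n 2 #>\<^bsub>free_group n\<^esub> gen i)) j"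

definition tensor_act ::
  "nat \<Rightarrow> nat \<Rightarrow> (nat \<Rightarrow> nat \<Rightarrow> int) \<Rightarrow> (nat list \<Rightarrow> 'r::comm_ring_1) \<Rightarrow> nat list \<Rightarrow> 'r" where
  "tensor_act n k A t = (\<lambda>w. if w \<in> index_words n k
     then \<Sum>v\<in>index_words n k. (\<Prod>l<k. of_int (A (w ! l) (v ! l))) * t v else 0)"

definition ext_act ::
  "nat \<Rightarrow> nat \<Rightarrow> ((nat \<times> bool) list set \<Rightarrow> (nat \<times> bool) list set) \<Rightarrow>
   (nat list \<Rightarrow> rat) set \<Rightarrow> (nat list \<Rightarrow> rat) set" where
  "ext_act n k \<alpha> C = (\<Union>t\<in>C. ext_proj n k (tensor_act n k (H_matrix n (aut_descend n k 1 \<alpha>)) t))"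
  \<comment> \<open>action of an automorphism \<open>\<alpha>\<close> of \<open>N_{n,k}\<close> on \<open>\<Lambda>^k H_Q\<close>\<close>


section \<open>The trace map\<close>

text \<open>
  A family \<open>\<iota> k : L_n(k) \<rightarrow> H^{\<otimes>k}\<close>, \<open>k \<ge> 1\<close>, with the following properties exists and is unique
  on the groups \<open>L_n(k)\<close>, because the Lie ring \<open>L_n\<close> is free on the classes of the generators;
  the bracket of \<open>L_n\<close> is induced by group commutators.
\<close>

definition is_lie_embedding ::
  "nat \<Rightarrow> (nat \<Rightarrow> (nat \<times> bool) list set \<Rightarrow> nat list \<Rightarrow> int) \<Rightarrow> bool" where
  "is_lie_embedding n \<iota> \<longleftrightarrow>
     (\<forall>k\<ge>1. \<iota> k \<in> hom (lie n k) (tensor_power n k)) \<and>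
     (\<forall>i<n. \<iota> 1 (\<Gamma> n 2 #>\<^bsub>free_group n\<^esub> gen i) = (\<lambda>w. of_bool (w = [i]))) \<and>
     (\<forall>i\<ge>1. \<forall>j\<ge>1. \<forall>x\<in>\<Gamma> n i. \<forall>y\<in>\<Gamma> n j.
        let X = \<iota> i (\<Gamma> n (i + 1) #>\<^bsub>free_group n\<^esub> x);
            Y = \<iota> j (\<Gamma> n (j + 1) #>\<^bsub>free_group n\<^esub> y)
        in \<iota> (i + j) (\<Gamma> n (i + j + 1) #>\<^bsub>free_group n\<^esub> commutator (free_group n) x y)
             = (\<lambda>w. tensor_mult i X Y w - tensor_mult j Y X w))"

definition lie_embedding :: "nat \<Rightarrow> nat \<Rightarrow> (nat \<times> bool) list set \<Rightarrow> nat list \<Rightarrow> int" where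
  "lie_embedding n = (SOME \<iota>. is_lie_embedding n \<iota>)"

text \<open>
  An element of \<open>H^* \<otimes> V\<close> is represented by the function sending \<open>i < n\<close> to its coefficient in
  \<open>V\<close> at \<open>x_i^*\<close>. Under \<open>Hom(H, L_n(k+1)) = H^* \<otimes> L_n(k+1)\<close>, the coefficient of \<open>f\<close> at \<open>x_i^*\<close>
  is \<open>f(x_i)\<close>.
\<close>

definition dual_lie_embedding ::
  "nat \<Rightarrow> nat \<Rightarrow> ((nat \<times> bool) list set \<Rightarrow> (nat \<times> bool) list set) \<Rightarrow> nat \<Rightarrow> nat list \<Rightarrow> int" where
  "dual_lie_embedding n k f =
     (\<lambda>i. lie_embedding n (k + 1) (f (\<Gamma> n 2 #>\<^bsub>free_group n\<^esub> gen i)))"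

definition contraction :: "nat \<Rightarrow> nat \<Rightarrow> (nat \<Rightarrow> nat list \<Rightarrow> int) \<Rightarrow> nat list \<Rightarrow> int" where
  "contraction n k T = (\<lambda>w. if w \<in> index_words n k then \<Sum>i<n. T i (i # w) else 0)"

definition trace_alt ::
  "nat \<Rightarrow> nat \<Rightarrow> ((nat \<times> bool) list set \<Rightarrow> (nat \<times> bool) list set) \<Rightarrow> (nat list \<Rightarrow> rat) set" where
  "trace_alt n k f = ext_int_to_rat n k (ext_proj n k (contraction n k (dual_lie_embedding n k f)))"

end

theory Submission
  imports Defs
begin

text \<open>
  If the transgression of an invariant homomorphism \<open>f\<close> vanishes, then \<open>f\<close> extends to a crossed
  homomorphism on the middle group of the extension. On elements acting trivially on the module a
  crossed homomorphism is an ordinary homomorphism to an abelian group, so \<open>f\<close> vanishes at every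
  commutator of two such elements that lies in the kernel of the extension. Hence it suffices to
  find automorphisms \<open>a\<close>, \<open>b\<close> inducing the identity on \<open>H\<close> whose commutator lies in the kernel
  and has nonzero trace.

  With the generators numbered from 0, let \<open>b\<close> send \<open>x_1\<close> to \<open>x_0 x_1 x_0^-1\<close> and let \<open>a\<close> send
  \<open>x_0\<close> to \<open>c x_0\<close>, where \<open>c\<close> is a left-normed commutator of weight \<open>k\<close>; both fix the other
  generators. For \<open>Aut N\<close> take \<open>c = [x_1, x_0, x_2, ..., x_(k-1)]\<close>. In the tame case take
  \<open>c = [u, x_0]\<close> with \<open>u = [x_1, x_2, ..., x_(k-1)]\<close>, so that \<open>a\<close> sends \<open>x_0\<close> to \<open>u x_0 u^-1\<close>
  and is an automorphism of the free group. A determinant form on the exterior power takes the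
  value \<open>3 + (-1)^k\<close> at the trace in the first case, and for even \<open>k\<close> the value \<open>2\<close> (or \<open>6\<close> if
  \<open>k = 2\<close>) in the second.

  The embedding of the free Lie ring into the tensor ring takes an element of \<open>\<Gamma>(k)\<close> to the leading
  term of its Magnus expansion.
\<close>

section \<open>Non-vanishing of the transgression\<close>

text \<open>The pair is found by degree: \<open>a\<close> is trivial modulo \<Gamma>(k) and
  \<open>b\<close> modulo \<Gamma>(2), so their commutator is trivial modulo \<Gamma>(k+1), and only
  its coefficients at the duals of x_0 and x_1 can be nonzero. On nilpotent quotients an
  endomorphism inducing the identity on H is automatically invertible, which leaves \<open>c\<close>
  free. A tame automorphism needs an inverse on the free group itself; this restricts
  \<open>c\<close>, and with the chosen one the trace survives only for even k. Two features of the
  definitions shape the rest. Automorphisms of quotients are functions on cosets, so they are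
  represented by endomorphisms of the free group with an inverse modulo \<Gamma>(k+1). The Lie
  embedding comes from a choice operator, so its values must be forced by its characterisation:
  existence comes from the Magnus expansion, uniqueness from generation of \<Gamma>(k) by
  commutators. The exterior power is never given a basis. One alternating form detects the trace,
  and it is evaluated by transposition: it is pulled back through the contraction and through one
  bracket at a time, without expanding brackets into monomials.\<close>

lemma (in group) inv_mult_cancel [simp]:
  assumes "x \<in> carrier G" "y \<in> carrier G"
  shows "inv x \<otimes> (x \<otimes> y) = y" "x \<otimes> (inv x \<otimes> y) = y"
  using assms by (simp_all flip: m_assoc)

lemma (in comm_group) mult_comm_inv_cancel:
  assumes "x \<in> carrier G" "y \<in> carrier G"
  shows "x \<otimes> (y \<otimes> inv x) = y"
  using assms by (simp add: m_comm[of y])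

text \<open>Both extensions of the theorem are instances, so the cohomological argument is made
  once. The kernel is a separate group with an injection \<open>i\<close>, because neither
  \<open>gr_johnson\<close> nor the group of homomorphisms is literally a subgroup of the middle
  group.\<close>

locale module_extension = K: group K + G: group G + Q: group Q + M: comm_group M
  for K :: "('k, 'u) monoid_scheme" and G :: "('g, 'v) monoid_scheme"
    and Q :: "('q, 'x) monoid_scheme" and M :: "('m, 'y) monoid_scheme" +
  fixes i :: "'k \<Rightarrow> 'g" and p :: "'g \<Rightarrow> 'q" and act :: "'q \<Rightarrow> 'm \<Rightarrow> 'm"
  assumes i_hom: "i \<in> hom K G"
    and i_inj: "inj_on i (carrier K)"
    and p_hom: "p \<in> hom G Q"
    and p_surj: "p ` carrier G = carrier Q"
    and exact: "g \<in> carrier G \<Longrightarrow> p g = \<one>\<^bsub>Q\<^esub> \<longleftrightarrow> g \<in> i ` carrier K"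
    and act_hom: "q \<in> carrier Q \<Longrightarrow> act q \<in> hom M M"
    and act_mult: "\<lbrakk>q \<in> carrier Q; r \<in> carrier Q; m \<in> carrier M\<rbrakk> \<Longrightarrow>
       act (q \<otimes>\<^bsub>Q\<^esub> r) m = act q (act r m)"
    and act_one: "m \<in> carrier M \<Longrightarrow> act \<one>\<^bsub>Q\<^esub> m = m"
begin

definition unincl :: "'g \<Rightarrow> 'k" where
  "unincl = inv_into (carrier K) i"

definition sect :: "'q \<Rightarrow> 'g" where
  "sect = inv_into (carrier G) p"

lemma i_closed [simp]: "x \<in> carrier K \<Longrightarrow> i x \<in> carrier G"
  using i_hom by (auto simp: hom_def)

lemma p_closed [simp]: "g \<in> carrier G \<Longrightarrow> p g \<in> carrier Q"
  using p_hom by (auto simp: hom_def)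

lemma p_mult [simp]: "\<lbrakk>g \<in> carrier G; h \<in> carrier G\<rbrakk> \<Longrightarrow> p (g \<otimes>\<^bsub>G\<^esub> h) = p g \<otimes>\<^bsub>Q\<^esub> p h"
  using p_hom by (simp add: hom_def)

lemma p_inv [simp]: "g \<in> carrier G \<Longrightarrow> p (inv\<^bsub>G\<^esub> g) = inv\<^bsub>Q\<^esub> (p g)"
  by (rule group_hom.hom_inv) (unfold_locales, rule p_hom)

lemma i_mult: "\<lbrakk>x \<in> carrier K; y \<in> carrier K\<rbrakk> \<Longrightarrow> i (x \<otimes>\<^bsub>K\<^esub> y) = i x \<otimes>\<^bsub>G\<^esub> i y"
  using i_hom by (simp add: hom_def)

lemma act_closed [simp]: "\<lbrakk>q \<in> carrier Q; m \<in> carrier M\<rbrakk> \<Longrightarrow> act q m \<in> carrier M"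
  using act_hom by (auto simp: hom_def)

lemma act_dist: "\<lbrakk>q \<in> carrier Q; m \<in> carrier M; m' \<in> carrier M\<rbrakk> \<Longrightarrow>
    act q (m \<otimes>\<^bsub>M\<^esub> m') = act q m \<otimes>\<^bsub>M\<^esub> act q m'"
  using act_hom by (auto simp: hom_def)

lemma act_M_one: "q \<in> carrier Q \<Longrightarrow> act q \<one>\<^bsub>M\<^esub> = \<one>\<^bsub>M\<^esub>"
  by (rule group_hom.hom_one[of M M "act q"]) (unfold_locales, simp_all add: act_hom)

lemma unincl_i [simp]: "x \<in> carrier K \<Longrightarrow> unincl (i x) = x"
  unfolding unincl_def by (simp add: i_inj)

lemma unincl_props:
  assumes "g \<in> carrier G" "p g = \<one>\<^bsub>Q\<^esub>"
  shows "unincl g \<in> carrier K" "i (unincl g) = g"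
  using exact[OF assms(1)] assms(2) by auto

lemma sect_props:
  assumes "q \<in> carrier Q"
  shows "sect q \<in> carrier G" "p (sect q) = q"
  using assms p_surj unfolding sect_def by (metis f_inv_into_f inv_into_into)+

lemma unincl_mult:
  assumes "g \<in> carrier G" "p g = \<one>\<^bsub>Q\<^esub>" "h \<in> carrier G" "p h = \<one>\<^bsub>Q\<^esub>"
  shows "unincl (g \<otimes>\<^bsub>G\<^esub> h) = unincl g \<otimes>\<^bsub>K\<^esub> unincl h"
  by (metis assms K.m_closed i_mult unincl_i unincl_props)

lemma p_i: "x \<in> carrier K \<Longrightarrow> p (i x) = \<one>\<^bsub>Q\<^esub>"
  using exact i_closed by blast

context
  fixes f :: "'k \<Rightarrow> 'm"
  assumes f: "f \<in> invariant_homs K i G p M act"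
begin

text \<open>Reads \<open>f\<close> inside \<open>G\<close>, so that identities between kernel
  elements can be calculated there. It is meaningful only where \<open>p g\<close> is
  trivial.\<close>

definition kernel_value :: "'g \<Rightarrow> 'm" where
  "kernel_value g = f (unincl g)"

lemma f_closed: "x \<in> carrier K \<Longrightarrow> f x \<in> carrier M"
  using f by (auto simp: invariant_homs_def hom_def)

lemma kernel_value_closed: "\<lbrakk>g \<in> carrier G; p g = \<one>\<^bsub>Q\<^esub>\<rbrakk> \<Longrightarrow> kernel_value g \<in> carrier M"
  by (simp add: kernel_value_def f_closed unincl_props)

lemma kernel_value_mult:
  assumes "g \<in> carrier G" "p g = \<one>\<^bsub>Q\<^esub>" "h \<in> carrier G" "p h = \<one>\<^bsub>Q\<^esub>"
  shows "kernel_value (g \<otimes>\<^bsub>G\<^esub> h) = kernel_value g \<otimes>\<^bsub>M\<^esub> kernel_value h"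
proof -
  have "f \<in> hom K M" using f by (simp add: invariant_homs_def)
  then show ?thesis
    using assms by (simp add: kernel_value_def unincl_mult hom_mult unincl_props)
qed

lemma kernel_value_conj:
  assumes g: "g \<in> carrier G" and h: "h \<in> carrier G" "p h = \<one>\<^bsub>Q\<^esub>"
  shows "kernel_value (g \<otimes>\<^bsub>G\<^esub> h \<otimes>\<^bsub>G\<^esub> inv\<^bsub>G\<^esub> g) = act (p g) (kernel_value h)"
proof -
  have "f (inv_into (carrier K) i (g \<otimes>\<^bsub>G\<^esub> i (unincl h) \<otimes>\<^bsub>G\<^esub> inv\<^bsub>G\<^esub> g)) = act (p g) (f (unincl h))"
    using f g unincl_props(1)[OF h] unfolding invariant_homs_def by blast
  then show ?thesis using unincl_props(2)[OF h] by (simp add: kernel_value_def unincl_def)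
qed

definition ext_cocycle :: "'q \<times> 'q \<Rightarrow> 'm" where
  "ext_cocycle = (\<lambda>(q, r)\<in>carrier Q \<times> carrier Q.
     kernel_value (sect q \<otimes>\<^bsub>G\<^esub> sect r \<otimes>\<^bsub>G\<^esub> inv\<^bsub>G\<^esub> (sect (q \<otimes>\<^bsub>Q\<^esub> r))))"

lemma transgression_eq:
  "transgression K i G p Q M act f = coboundaries2 Q M act #>\<^bsub>cochains2 Q M\<^esub> ext_cocycle"
  using f by (simp add: transgression_def ext_cocycle_def kernel_value_def unincl_def sect_def Let_def)

lemma ext_cocycle_closed:
  assumes "q \<in> carrier Q" "r \<in> carrier Q"
  shows "ext_cocycle (q, r) \<in> carrier M"
  using assms by (auto simp: ext_cocycle_def sect_props intro!: kernel_value_closed)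

text \<open>With \<open>g = u (s q)\<close> and \<open>h = v (s r)\<close> for \<open>u\<close>, \<open>v\<close> in the kernel,
  \<open>g h (s (q r))^-1\<close> is \<open>u ((s q) v (s q)^-1) ((s q) (s r) (s (q r))^-1)\<close>.\<close>

lemma kernel_value_product:
  assumes g: "g \<in> carrier G" and h: "h \<in> carrier G"
  shows "kernel_value (g \<otimes>\<^bsub>G\<^esub> h \<otimes>\<^bsub>G\<^esub> inv\<^bsub>G\<^esub> (sect (p (g \<otimes>\<^bsub>G\<^esub> h)))) =
    kernel_value (g \<otimes>\<^bsub>G\<^esub> inv\<^bsub>G\<^esub> (sect (p g))) \<otimes>\<^bsub>M\<^esub>
    (act (p g) (kernel_value (h \<otimes>\<^bsub>G\<^esub> inv\<^bsub>G\<^esub> (sect (p h)))) \<otimes>\<^bsub>M\<^esub> ext_cocycle (p g, p h))"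
proof -
  define s where "s = sect (p g)"
  define t where "t = sect (p h)"
  define v where "v = sect (p (g \<otimes>\<^bsub>G\<^esub> h))"
  have car: "s \<in> carrier G" "t \<in> carrier G" "v \<in> carrier G"
    and im: "p s = p g" "p t = p h" "p v = p g \<otimes>\<^bsub>Q\<^esub> p h"
    using g h by (simp_all add: s_def t_def v_def sect_props)
  have eq: "g \<otimes>\<^bsub>G\<^esub> h \<otimes>\<^bsub>G\<^esub> inv\<^bsub>G\<^esub> v =
     (g \<otimes>\<^bsub>G\<^esub> inv\<^bsub>G\<^esub> s) \<otimes>\<^bsub>G\<^esub> ((s \<otimes>\<^bsub>G\<^esub> (h \<otimes>\<^bsub>G\<^esub> inv\<^bsub>G\<^esub> t) \<otimes>\<^bsub>G\<^esub> inv\<^bsub>G\<^esub> s) \<otimes>\<^bsub>G\<^esub> (s \<otimes>\<^bsub>G\<^esub> t \<otimes>\<^bsub>G\<^esub> inv\<^bsub>G\<^esub> v))"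
    using car g h by (simp add: G.m_assoc)
  have c: "kernel_value (s \<otimes>\<^bsub>G\<^esub> (h \<otimes>\<^bsub>G\<^esub> inv\<^bsub>G\<^esub> t) \<otimes>\<^bsub>G\<^esub> inv\<^bsub>G\<^esub> s) = act (p s) (kernel_value (h \<otimes>\<^bsub>G\<^esub> inv\<^bsub>G\<^esub> t))"
    using car h im by (intro kernel_value_conj) auto
  have "ext_cocycle (p g, p h) = kernel_value (s \<otimes>\<^bsub>G\<^esub> t \<otimes>\<^bsub>G\<^esub> inv\<^bsub>G\<^esub> v)"
    using g h by (simp add: ext_cocycle_def s_def t_def v_def)
  moreover have "kernel_value (g \<otimes>\<^bsub>G\<^esub> h \<otimes>\<^bsub>G\<^esub> inv\<^bsub>G\<^esub> v) = kernel_value (g \<otimes>\<^bsub>G\<^esub> inv\<^bsub>G\<^esub> s) \<otimes>\<^bsub>M\<^esub>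
     (act (p s) (kernel_value (h \<otimes>\<^bsub>G\<^esub> inv\<^bsub>G\<^esub> t)) \<otimes>\<^bsub>M\<^esub> kernel_value (s \<otimes>\<^bsub>G\<^esub> t \<otimes>\<^bsub>G\<^esub> inv\<^bsub>G\<^esub> v))"
  proof -
    let ?A = "g \<otimes>\<^bsub>G\<^esub> inv\<^bsub>G\<^esub> s" and ?B = "s \<otimes>\<^bsub>G\<^esub> (h \<otimes>\<^bsub>G\<^esub> inv\<^bsub>G\<^esub> t) \<otimes>\<^bsub>G\<^esub> inv\<^bsub>G\<^esub> s"
      and ?C = "s \<otimes>\<^bsub>G\<^esub> t \<otimes>\<^bsub>G\<^esub> inv\<^bsub>G\<^esub> v"
    have "?A \<in> carrier G" "?B \<in> carrier G" "?C \<in> carrier G"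
      "p ?A = \<one>\<^bsub>Q\<^esub>" "p ?B = \<one>\<^bsub>Q\<^esub>" "p ?C = \<one>\<^bsub>Q\<^esub>"
      using car g h im by auto
    then show ?thesis unfolding eq c[symmetric] by (simp add: kernel_value_mult del: p_inv)
  qed
  ultimately show ?thesis using im by (simp add: s_def t_def v_def)
qed

text \<open>After pulling back to \<open>G\<close>, the cocycle measures how far \<kappa> is from a
  crossed homomorphism. Evaluating \<kappa> at the product of three section values with both
  bracketings gives the cocycle identity.\<close>

lemma ext_cocycle_in_cocycles: "ext_cocycle \<in> cocycles2 Q M act"
proof -
  have "act q (ext_cocycle (r, t)) \<otimes>\<^bsub>M\<^esub> ext_cocycle (q, r \<otimes>\<^bsub>Q\<^esub> t) =
      ext_cocycle (q \<otimes>\<^bsub>Q\<^esub> r, t) \<otimes>\<^bsub>M\<^esub> ext_cocycle (q, r)"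
    if car: "q \<in> carrier Q" "r \<in> carrier Q" "t \<in> carrier Q" for q r t
  proof -
    define \<kappa> where "\<kappa> g = kernel_value (g \<otimes>\<^bsub>G\<^esub> inv\<^bsub>G\<^esub> (sect (p g)))" for g
    note s = sect_props[OF car(1)] sect_props[OF car(2)] sect_props[OF car(3)]
    have prod: "\<kappa> (g \<otimes>\<^bsub>G\<^esub> h) = \<kappa> g \<otimes>\<^bsub>M\<^esub> (act (p g) (\<kappa> h) \<otimes>\<^bsub>M\<^esub> ext_cocycle (p g, p h))"
      if "g \<in> carrier G" "h \<in> carrier G" for g h
      using kernel_value_product[OF that] by (simp add: \<kappa>_def)
    \<comment> \<open>The section need not send the identity to the identity, but \<kappa> is
      normalised at every section value, because it compares an element with the section value over
      its image.\<close>
    have \<kappa>s: "\<kappa> (sect x) = \<one>\<^bsub>M\<^esub>" if "x \<in> carrier Q" for x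
    proof -
      have "\<kappa> (sect x) = kernel_value \<one>\<^bsub>G\<^esub>" using sect_props[OF that] by (simp add: \<kappa>_def)
      also have "\<dots> = \<one>\<^bsub>M\<^esub>"
        using kernel_value_mult[of "\<one>\<^bsub>G\<^esub>" "\<one>\<^bsub>G\<^esub>"] kernel_value_closed[of "\<one>\<^bsub>G\<^esub>"]
          group_hom.hom_one[of G Q p] p_hom G.is_group Q.is_group
        by (metis G.l_one G.one_closed M.l_cancel_one' group_hom.intro group_hom_axioms.intro)
      finally show ?thesis .
    qed
    have qr: "\<kappa> (sect q \<otimes>\<^bsub>G\<^esub> sect r) = ext_cocycle (q, r)"
      using s car by (simp add: prod \<kappa>s act_M_one ext_cocycle_closed)
    have rt: "\<kappa> (sect r \<otimes>\<^bsub>G\<^esub> sect t) = ext_cocycle (r, t)"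
      using s car by (simp add: prod \<kappa>s act_M_one ext_cocycle_closed)
    have "\<kappa> (sect q \<otimes>\<^bsub>G\<^esub> sect r \<otimes>\<^bsub>G\<^esub> sect t) = ext_cocycle (q, r) \<otimes>\<^bsub>M\<^esub> ext_cocycle (q \<otimes>\<^bsub>Q\<^esub> r, t)"
      using s car prod[of "sect q \<otimes>\<^bsub>G\<^esub> sect r" "sect t"] qr by (simp add: \<kappa>s act_M_one ext_cocycle_closed)
    moreover have "\<kappa> (sect q \<otimes>\<^bsub>G\<^esub> (sect r \<otimes>\<^bsub>G\<^esub> sect t)) =
        act q (ext_cocycle (r, t)) \<otimes>\<^bsub>M\<^esub> ext_cocycle (q, r \<otimes>\<^bsub>Q\<^esub> t)"
      using s car prod[of "sect q" "sect r \<otimes>\<^bsub>G\<^esub> sect t"] rt by (simp add: \<kappa>s act_M_one ext_cocycle_closed)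
    ultimately show ?thesis using s car by (simp add: G.m_assoc M.m_comm ext_cocycle_closed)
  qed
  moreover have "ext_cocycle \<in> carrier (cochains2 Q M)"
    using ext_cocycle_closed unfolding cochains2_def by (auto simp: ext_cocycle_def)
  ultimately show ?thesis by (simp add: cocycles2_def)
qed

lemma ext_cocycle_not_coboundary:
  assumes ab: "a \<in> carrier G" "b \<in> carrier G" "x \<in> carrier K"
    and comm: "a \<otimes>\<^bsub>G\<^esub> b = i x \<otimes>\<^bsub>G\<^esub> (b \<otimes>\<^bsub>G\<^esub> a)"
    and triv: "\<And>m. m \<in> carrier M \<Longrightarrow> act (p a) m = m" "\<And>m. m \<in> carrier M \<Longrightarrow> act (p b) m = m"
    and fx: "f x \<noteq> \<one>\<^bsub>M\<^esub>"
  shows "ext_cocycle \<notin> coboundaries2 Q M act"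
proof
  assume "ext_cocycle \<in> coboundaries2 Q M act"
  then obtain c where c: "c \<in> carrier (cochains1 Q M)" and eq: "ext_cocycle = coboundary1 Q M act c"
    by (auto simp: coboundaries2_def)
  have c_closed: "c q \<in> carrier M" if "q \<in> carrier Q" for q
    using c that by (auto simp: cochains1_def)
  define \<kappa> where "\<kappa> g = kernel_value (g \<otimes>\<^bsub>G\<^esub> inv\<^bsub>G\<^esub> (sect (p g)))" for g
  \<comment> \<open>By \<open>kernel_value_product\<close>, \<kappa> fails to be a crossed
    homomorphism by the pulled-back cocycle, and \<open>c\<close> composed with \<open>p\<close>
    fails by the inverse of the same factor. Their product is therefore a crossed
    homomorphism.\<close>
  define D where "D g = \<kappa> g \<otimes>\<^bsub>M\<^esub> c (p g)" for g
  have cl: "\<kappa> g \<in> carrier M" if "g \<in> carrier G" for g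
    using that by (auto simp: \<kappa>_def sect_props intro!: kernel_value_closed)
  have D_closed: "D g \<in> carrier M" if "g \<in> carrier G" for g
    using that by (simp add: D_def cl c_closed)
  have coc: "ext_cocycle (q, r) = act q (c r) \<otimes>\<^bsub>M\<^esub> inv\<^bsub>M\<^esub> (c (q \<otimes>\<^bsub>Q\<^esub> r)) \<otimes>\<^bsub>M\<^esub> c q"
    if "q \<in> carrier Q" "r \<in> carrier Q" for q r
    using that by (simp add: eq coboundary1_def)
  have D_mult: "D (g \<otimes>\<^bsub>G\<^esub> h) = D g \<otimes>\<^bsub>M\<^esub> act (p g) (D h)" if gh: "g \<in> carrier G" "h \<in> carrier G" for g h
  proof -
    have "\<kappa> (g \<otimes>\<^bsub>G\<^esub> h) = \<kappa> g \<otimes>\<^bsub>M\<^esub> (act (p g) (\<kappa> h) \<otimes>\<^bsub>M\<^esub> ext_cocycle (p g, p h))"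
      using kernel_value_product[OF gh] by (simp add: \<kappa>_def)
    moreover have "act (p g) (\<kappa> h \<otimes>\<^bsub>M\<^esub> c (p h)) = act (p g) (\<kappa> h) \<otimes>\<^bsub>M\<^esub> act (p g) (c (p h))"
      using gh by (simp add: act_dist cl c_closed)
    moreover have "\<And>a b d e u. \<lbrakk>a \<in> carrier M; b \<in> carrier M; d \<in> carrier M; e \<in> carrier M; u \<in> carrier M\<rbrakk> \<Longrightarrow>
        a \<otimes>\<^bsub>M\<^esub> (b \<otimes>\<^bsub>M\<^esub> (d \<otimes>\<^bsub>M\<^esub> inv\<^bsub>M\<^esub> e \<otimes>\<^bsub>M\<^esub> u)) \<otimes>\<^bsub>M\<^esub> e = a \<otimes>\<^bsub>M\<^esub> u \<otimes>\<^bsub>M\<^esub> (b \<otimes>\<^bsub>M\<^esub> d)"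
      by (simp add: M.m_ac M.mult_comm_inv_cancel)
    ultimately show ?thesis
      using gh by (simp add: D_def cl c_closed coc)
  qed
  have D_i: "D (i y) = f y" if y: "y \<in> carrier K" for y
  proof -
    have 1: "sect \<one>\<^bsub>Q\<^esub> \<in> carrier G" "p (sect \<one>\<^bsub>Q\<^esub>) = \<one>\<^bsub>Q\<^esub>" using sect_props by auto
    \<comment> \<open>Cochains are not normalised, so \<open>c\<close> at the identity is the
      possibly nontrivial value of \<open>f\<close> at the section of the identity. It cancels the
      same correction inside \<kappa>.\<close>
    have "c \<one>\<^bsub>Q\<^esub> = ext_cocycle (\<one>\<^bsub>Q\<^esub>, \<one>\<^bsub>Q\<^esub>)"
      using c_closed[of "\<one>\<^bsub>Q\<^esub>"] by (simp add: coc act_one)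
    also have "\<dots> = kernel_value (sect \<one>\<^bsub>Q\<^esub>)"
      using 1 by (simp add: ext_cocycle_def G.m_assoc)
    finally have "D (i y) = kernel_value (i y \<otimes>\<^bsub>G\<^esub> inv\<^bsub>G\<^esub> (sect \<one>\<^bsub>Q\<^esub>)) \<otimes>\<^bsub>M\<^esub> kernel_value (sect \<one>\<^bsub>Q\<^esub>)"
      using y by (simp add: D_def \<kappa>_def p_i)
    also have "\<dots> = kernel_value (i y \<otimes>\<^bsub>G\<^esub> inv\<^bsub>G\<^esub> (sect \<one>\<^bsub>Q\<^esub>) \<otimes>\<^bsub>G\<^esub> sect \<one>\<^bsub>Q\<^esub>)"
      using 1 y by (simp add: kernel_value_mult p_i)
    also have "\<dots> = f y"
      using 1 y by (simp add: G.m_assoc kernel_value_def)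
    finally show ?thesis .
  qed
  have "D (a \<otimes>\<^bsub>G\<^esub> b) = D (b \<otimes>\<^bsub>G\<^esub> a)"
    using ab by (simp add: D_mult triv D_closed M.m_comm)
  moreover have "D (a \<otimes>\<^bsub>G\<^esub> b) = f x \<otimes>\<^bsub>M\<^esub> D (b \<otimes>\<^bsub>G\<^esub> a)"
    using ab D_closed[of "b \<otimes>\<^bsub>G\<^esub> a"] by (simp add: comm D_mult[of "i x"] D_i p_i act_one)
  ultimately show False
    using fx ab D_closed[of "b \<otimes>\<^bsub>G\<^esub> a"] f_closed[OF ab(3)]
    by (metis G.m_closed M.r_cancel_one)
qed

end

lemma comm_group_cochains2: "comm_group (cochains2 Q M)"
proof (rule group.group_comm_groupI)
  show "group (cochains2 Q M)" by (simp add: cochains2_def)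
qed (auto simp: cochains2_def M.m_comm PiE_iff intro!: restrict_ext)

lemma coboundary1_mult:
  assumes "c \<in> carrier (cochains1 Q M)" "d \<in> carrier (cochains1 Q M)"
  shows "coboundary1 Q M act (c \<otimes>\<^bsub>cochains1 Q M\<^esub> d) =
    coboundary1 Q M act c \<otimes>\<^bsub>cochains2 Q M\<^esub> coboundary1 Q M act d"
proof -
  have *: "\<And>q. q \<in> carrier Q \<Longrightarrow> c q \<in> carrier M" "\<And>q. q \<in> carrier Q \<Longrightarrow> d q \<in> carrier M"
    using assms by (auto simp: cochains1_def)
  show ?thesis
    by (auto simp: coboundary1_def cochains1_def cochains2_def fun_eq_iff restrict_def * act_dist
        M.inv_mult M.m_ac)
qed

lemma coboundary1_closed:
  assumes "c \<in> carrier (cochains1 Q M)"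
  shows "coboundary1 Q M act c \<in> carrier (cochains2 Q M)"
proof -
  have *: "\<And>q. q \<in> carrier Q \<Longrightarrow> c q \<in> carrier M"
    using assms by (auto simp: cochains1_def)
  show ?thesis by (auto simp: coboundary1_def cochains2_def *)
qed

lemma subgroup_coboundaries2: "subgroup (coboundaries2 Q M act) (cochains2 Q M)"
proof -
  interpret C1: group "cochains1 Q M" by (simp add: cochains1_def)
  interpret C2: comm_group "cochains2 Q M" by (rule comm_group_cochains2)
  interpret group_hom "cochains1 Q M" "cochains2 Q M" "coboundary1 Q M act"
    by unfold_locales (auto simp: hom_def coboundary1_mult coboundary1_closed)
  show ?thesis unfolding coboundaries2_def by (rule img_is_subgroup)
qed

text \<open>The relation is assumed in the form a b = i(x) (b a), so that it can be verified for
  concrete automorphisms without computing their inverses.\<close>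

proposition transgression_nontrivial:
  assumes f: "f \<in> invariant_homs K i G p M act"
    and "a \<in> carrier G" "b \<in> carrier G" "x \<in> carrier K"
    and "a \<otimes>\<^bsub>G\<^esub> b = i x \<otimes>\<^bsub>G\<^esub> (b \<otimes>\<^bsub>G\<^esub> a)"
    and "\<And>m. m \<in> carrier M \<Longrightarrow> act (p a) m = m" "\<And>m. m \<in> carrier M \<Longrightarrow> act (p b) m = m"
    and "f x \<noteq> \<one>\<^bsub>M\<^esub>"
  shows "transgression K i G p Q M act f \<in>
    carrier (cohomology2 Q M act) - {\<one>\<^bsub>cohomology2 Q M act\<^esub>}"
proof -
  interpret C2: comm_group "cochains2 Q M" by (rule comm_group_cochains2)
  have coc: "ext_cocycle f \<in> cocycles2 Q M act" by (rule ext_cocycle_in_cocycles[OF f])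
  then have car: "ext_cocycle f \<in> carrier (cochains2 Q M)" by (simp add: cocycles2_def)
  have "coboundaries2 Q M act #>\<^bsub>cochains2 Q M\<^esub> ext_cocycle f \<noteq> coboundaries2 Q M act"
    using C2.coset_join1[OF _ car subgroup_coboundaries2] ext_cocycle_not_coboundary[OF f assms(2-)]
    by blast
  moreover have "coboundaries2 Q M act #>\<^bsub>cochains2 Q M\<^esub> ext_cocycle f \<in> carrier (cohomology2 Q M act)"
    using coc by (auto simp: cohomology2_def carrier_FactGroup)
  ultimately show ?thesis
    by (simp add: transgression_eq[OF f] cohomology2_def)
qed

end

section \<open>Free groups\<close>

abbreviation reduced :: "(nat \<times> bool) list \<Rightarrow> bool" where
  "reduced \<equiv> successively (\<lambda>a b. b \<noteq> inv_letter a)"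

lemma inv_letter_inv_letter [simp]: "inv_letter (inv_letter a) = a"
  by (simp add: inv_letter_def)

lemma fst_inv_letter [simp]: "fst (inv_letter a) = fst a"
  by (simp add: inv_letter_def)

lemma inv_letter_neq [simp]: "inv_letter a \<noteq> a" "a \<noteq> inv_letter a"
  by (auto simp: inv_letter_def prod_eq_iff)

lemma reduced_push: "reduced w \<Longrightarrow> reduced (push a w)"
  by (cases w) (auto simp: successively_Cons)

text \<open>If \<open>a\<close> cancels the head of \<open>w\<close>, pushing the inverse letter
  must put that head back. This could fail only if the next letter of \<open>w\<close> were
  \<open>a\<close>, which reducedness excludes.\<close>

lemma push_inv_letter_push: "reduced w \<Longrightarrow> push (inv_letter a) (push a w) = w"
proof (cases w)
  case (Cons b v)
  assume "reduced w"
  with Cons show ?thesis by (cases v) auto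
qed simp

lemma set_push: "fst ` set (push a w) \<subseteq> insert (fst a) (fst ` set w)"
  by (cases w) auto

lemma reduced_foldr_push: "reduced w \<Longrightarrow> reduced (foldr push u w)"
  by (induction u) (auto simp: reduced_push)

lemma set_foldr_push: "fst ` set (foldr push u w) \<subseteq> fst ` set u \<union> fst ` set w"
proof (induction u)
  case (Cons a u)
  have "fst ` set (push a (foldr push u w)) \<subseteq> insert (fst a) (fst ` set (foldr push u w))"
    by (rule set_push)
  also have "\<dots> \<subseteq> insert (fst a) (fst ` set u \<union> fst ` set w)" using Cons by blast
  finally show ?case by simp
qed simp

text \<open>Van der Waerden's trick: each letter acts on reduced words by an invertible push, so a
  cancellation inside the left factor does not change how that factor acts. Associativity of the
  product follows.\<close>

lemma foldr_push_push: "reduced w \<Longrightarrow> foldr push (push a v) w = push a (foldr push v w)"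
proof (cases v)
  case (Cons b u)
  assume w: "reduced w"
  show ?thesis
  proof (cases "b = inv_letter a")
    case True
    have "push a (push (inv_letter a) (foldr push u w)) = foldr push u w"
      using push_inv_letter_push[of "foldr push u w" "inv_letter a"] reduced_foldr_push[OF w] by simp
    then show ?thesis using Cons True by simp
  qed (simp add: Cons)
qed simp

lemma foldr_push_assoc:
  "reduced w \<Longrightarrow> foldr push (foldr push u v) w = foldr push u (foldr push v w)"
  by (induction u) (simp_all add: foldr_push_push)

lemma foldr_push_Nil: "reduced u \<Longrightarrow> foldr push u [] = u"
proof (induction u)
  case (Cons a u)
  then show ?case by (cases u) auto
qed simp

lemma foldr_push_inverse: "reduced w \<Longrightarrow> foldr push (rev (map inv_letter u)) (foldr push u w) = w"
  by (induction u) (auto simp: push_inv_letter_push reduced_foldr_push)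

lemma group_free_group: "group (free_group n)"
proof (rule groupI)
  fix u v assume "u \<in> carrier (free_group n)" "v \<in> carrier (free_group n)"
  then show "u \<otimes>\<^bsub>free_group n\<^esub> v \<in> carrier (free_group n)"
    using subset_trans[OF set_foldr_push[of u v], of "{..<n}"] reduced_foldr_push[of v u]
    by (simp add: free_group_def)
next
  fix u assume "u \<in> carrier (free_group n)"
  then have u: "reduced u" "fst ` set u \<subseteq> {..<n}" by (auto simp: free_group_def)
  \<comment> \<open>The formal inverse word is pushed onto the empty word below, which yields a
    reduced word without an argument about reversal.\<close>
  let ?v = "rev (map inv_letter u)"
  have "foldr push (foldr push ?v []) u = []"
    using foldr_push_inverse[of "[]" u] u by (simp add: foldr_push_assoc foldr_push_Nil)
  moreover have "fst ` set (foldr push ?v []) \<subseteq> {..<n}"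
    using set_foldr_push[of ?v "[]"] u by (auto simp: image_image)
  ultimately show "\<exists>v\<in>carrier (free_group n). v \<otimes>\<^bsub>free_group n\<^esub> u = \<one>\<^bsub>free_group n\<^esub>"
    using reduced_foldr_push[of "[]" ?v] u(1)
    by (intro bexI[of _ "foldr push ?v []"]) (auto simp: free_group_def)
qed (auto simp: free_group_def foldr_push_assoc)

interpretation F: group "free_group n" for n
  by (rule group_free_group)

lemma one_free_group: "\<one>\<^bsub>free_group n\<^esub> = []"
  by (simp add: free_group_def)

lemma gen_closed [simp]: "i < n \<Longrightarrow> gen i \<in> carrier (free_group n)"
  by (simp add: free_group_def gen_def)

lemma inv_gen: "i < n \<Longrightarrow> inv\<^bsub>free_group n\<^esub> gen i = [(i, False)]"
  by (rule F.inv_equality) (auto simp: free_group_def gen_def inv_letter_def)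

lemma free_group_ConsD:
  assumes "a # w \<in> carrier (free_group n)"
  shows "a # w = [a] \<otimes>\<^bsub>free_group n\<^esub> w" "w \<in> carrier (free_group n)" "fst a < n"
    "[a] = (if snd a then gen (fst a) else inv\<^bsub>free_group n\<^esub> gen (fst a))"
proof -
  show "fst a < n" using assms by (simp add: free_group_def)
  then show "[a] = (if snd a then gen (fst a) else inv\<^bsub>free_group n\<^esub> gen (fst a))"
    by (cases a) (auto simp: inv_gen, simp add: gen_def)
  show "a # w = [a] \<otimes>\<^bsub>free_group n\<^esub> w" "w \<in> carrier (free_group n)"
    using assms by (cases w; auto simp: free_group_def)+
qed

lemma free_group_induct [consumes 1, case_names one gen inv_gen]:
  assumes "x \<in> carrier (free_group n)"
    and "P \<one>\<^bsub>free_group n\<^esub>"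
    and "\<And>i x. \<lbrakk>i < n; x \<in> carrier (free_group n); P x\<rbrakk> \<Longrightarrow> P (gen i \<otimes>\<^bsub>free_group n\<^esub> x)"
    and "\<And>i x. \<lbrakk>i < n; x \<in> carrier (free_group n); P x\<rbrakk> \<Longrightarrow> P (inv\<^bsub>free_group n\<^esub> gen i \<otimes>\<^bsub>free_group n\<^esub> x)"
  shows "P x"
  using assms(1)
proof (induction x)
  case Nil
  then show ?case using assms(2) by (simp add: one_free_group)
next
  case (Cons a w)
  note D = free_group_ConsD[OF Cons.prems]
  show ?case
    unfolding D(1) D(4) using assms(3,4)[OF D(3,2) Cons.IH[OF D(2)]] by simp
qed

text \<open>A target that is only a monoid is allowed, because the Magnus expansion takes values in
  the multiplicative monoid of all power series.\<close>

definition word_eval :: "('a, 'b) monoid_scheme \<Rightarrow> (nat \<times> bool \<Rightarrow> 'a) \<Rightarrow> (nat \<times> bool) list \<Rightarrow> 'a" where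
  "word_eval M l w = foldr (\<lambda>a x. l a \<otimes>\<^bsub>M\<^esub> x) w \<one>\<^bsub>M\<^esub>"

lemma word_eval_hom:
  assumes M: "monoid M"
    and l: "\<And>a. fst a < n \<Longrightarrow> l a \<in> carrier M"
    and inv: "\<And>a. fst a < n \<Longrightarrow> l a \<otimes>\<^bsub>M\<^esub> l (inv_letter a) = \<one>\<^bsub>M\<^esub>"
  shows "word_eval M l \<in> hom (free_group n) M"
proof (rule homI)
  interpret M: monoid M by fact
  have closed: "word_eval M l w \<in> carrier M" if "fst ` set w \<subseteq> {..<n}" for w
    using that by (induction w) (auto simp: word_eval_def l)
  have push: "word_eval M l (push a w) = l a \<otimes>\<^bsub>M\<^esub> word_eval M l w"
    if "fst a < n" "fst ` set w \<subseteq> {..<n}" for a w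
  proof (cases w)
    case (Cons b v)
    have "l a \<otimes>\<^bsub>M\<^esub> (l (inv_letter a) \<otimes>\<^bsub>M\<^esub> word_eval M l v) = word_eval M l v"
      using that Cons closed[of v] by (simp add: l inv flip: M.m_assoc)
    then show ?thesis using Cons that by (simp add: word_eval_def)
  qed (simp add: word_eval_def)
  fix u v assume uv: "u \<in> carrier (free_group n)" "v \<in> carrier (free_group n)"
  show "word_eval M l u \<in> carrier M" using uv by (intro closed) (auto simp: free_group_def)
  have v: "fst ` set v \<subseteq> {..<n}" and u: "fst ` set u \<subseteq> {..<n}" using uv by (auto simp: free_group_def)
  from u have "word_eval M l (foldr push u v) = word_eval M l u \<otimes>\<^bsub>M\<^esub> word_eval M l v"
  proof (induction u)
    case Nil
    then show ?case using closed[OF v] by (simp add: word_eval_def)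
  next
    case (Cons a u)
    have r: "fst ` set (foldr push u v) \<subseteq> {..<n}"
      using v Cons.prems by (intro subset_trans[OF set_foldr_push[of u v]]) auto
    have "word_eval M l (foldr push (a # u) v) = l a \<otimes>\<^bsub>M\<^esub> word_eval M l (foldr push u v)"
      using Cons.prems r by (simp add: push)
    also have "\<dots> = l a \<otimes>\<^bsub>M\<^esub> word_eval M l u \<otimes>\<^bsub>M\<^esub> word_eval M l v"
      using Cons closed[OF v] closed[of u] l[of a] by (simp add: M.m_assoc)
    finally show ?case by (simp add: word_eval_def)
  qed
  then show "word_eval M l (u \<otimes>\<^bsub>free_group n\<^esub> v) = word_eval M l u \<otimes>\<^bsub>M\<^esub> word_eval M l v"
    by (simp add: free_group_def)
qed

lemma free_group_universal:
  assumes "group G" and g: "\<And>i. i < n \<Longrightarrow> g i \<in> carrier G"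
  obtains h where "h \<in> hom (free_group n) G" "\<And>i. i < n \<Longrightarrow> h (gen i) = g i"
proof -
  interpret G: group G by fact
  let ?l = "\<lambda>a. if snd a then g (fst a) else inv\<^bsub>G\<^esub> (g (fst a))"
  show ?thesis
  proof (rule that[of "word_eval G ?l"])
    show "word_eval G ?l \<in> hom (free_group n) G"
      by (rule word_eval_hom) (auto simp: g inv_letter_def)
  qed (simp add: word_eval_def gen_def g)
qed

lemma exists_endo:
  assumes "\<And>i. i < n \<Longrightarrow> g i \<in> carrier (free_group n)"
  shows "\<exists>\<phi>\<in>hom (free_group n) (free_group n). \<forall>i<n. \<phi> (gen i) = g i"
  by (rule free_group_universal[OF F.is_group[of n] assms]) blast+

lemma free_group_hom_eq:
  assumes "group G" "h \<in> hom (free_group n) G" "h' \<in> hom (free_group n) G"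
    and "\<And>i. i < n \<Longrightarrow> h (gen i) = h' (gen i)" "x \<in> carrier (free_group n)"
  shows "h x = h' x"
proof -
  interpret G: group G by fact
  interpret h: group_hom "free_group n" G h by unfold_locales (rule assms)
  interpret h': group_hom "free_group n" G h' by unfold_locales (rule assms)
  show ?thesis using assms(5) by (induction rule: free_group_induct) (auto simp: assms(4))
qed

section \<open>The lower central series\<close>

context group
begin

lemma commutator_closed [simp]:
  "\<lbrakk>x \<in> carrier G; y \<in> carrier G\<rbrakk> \<Longrightarrow> commutator G x y \<in> carrier G"
  by (simp add: commutator_def)

lemma commutator_mult_swap:
  "\<lbrakk>x \<in> carrier G; y \<in> carrier G\<rbrakk> \<Longrightarrow> x \<otimes> y = commutator G x y \<otimes> (y \<otimes> x)"
  by (simp add: commutator_def m_assoc)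

text \<open>A conjugate of a commutator is the commutator of the conjugates, so the generating set
  at each stage is stable under conjugation.\<close>

lemma lower_central_normal: "lower_central G k \<lhd> G"
proof (induction k rule: less_induct)
  case (less k)
  consider "k = 0" | "k = 1" | j where "k = Suc (Suc j)" by (metis One_nat_def not0_implies_Suc)
  then show ?case
  proof cases
    case 3
    have j: "lower_central G (Suc j) \<lhd> G" using 3 less by simp
    then interpret N: normal "lower_central G (Suc j)" G .
    have "generate G {commutator G x y |x y. x \<in> lower_central G (Suc j) \<and> y \<in> carrier G} \<lhd> G"
    proof (rule normal_generateI)
      fix h g assume h: "h \<in> {commutator G x y |x y. x \<in> lower_central G (Suc j) \<and> y \<in> carrier G}"
        and g: "g \<in> carrier G"
      then obtain x y where xy: "x \<in> lower_central G (Suc j)" "y \<in> carrier G" "h = commutator G x y" by auto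
      have x: "x \<in> carrier G" using xy by auto
      have "g \<otimes> h \<otimes> inv g = commutator G (g \<otimes> x \<otimes> inv g) (g \<otimes> y \<otimes> inv g)"
        using x xy(2) g by (simp add: commutator_def m_assoc inv_mult_group xy(3))
      moreover have "g \<otimes> x \<otimes> inv g \<in> lower_central G (Suc j)"
        using xy(1) g by (rule N.inv_op_closed2[rotated])
      ultimately show "g \<otimes> h \<otimes> inv g \<in> {commutator G x y |x y. x \<in> lower_central G (Suc j) \<and> y \<in> carrier G}"
        using xy(2) g by blast
    qed auto
    then show ?thesis using 3 by simp
  qed (simp_all add: normal_self)
qed

lemma lower_central_subgroup: "subgroup (lower_central G k) G"
  using lower_central_normal by (rule normal_imp_subgroup)

lemma lower_central_closed: "x \<in> lower_central G k \<Longrightarrow> x \<in> carrier G"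
  by (rule subgroup.mem_carrier[OF lower_central_subgroup])

lemma commutator_in_lower_central:
  assumes "x \<in> lower_central G k" "y \<in> carrier G" "1 \<le> k"
  shows "commutator G x y \<in> lower_central G (Suc k)"
proof -
  obtain j where "k = Suc j" using assms(3) by (metis Suc_le_D One_nat_def)
  then show ?thesis using assms by (auto intro!: generate.incl)
qed

lemma lower_central_Suc_subset: "lower_central G (Suc k) \<subseteq> lower_central G k"
proof (cases k)
  case (Suc j)
  interpret N: normal "lower_central G (Suc j)" G by (rule lower_central_normal)
  have "commutator G x y \<in> lower_central G (Suc j)"
    if "x \<in> lower_central G (Suc j)" "y \<in> carrier G" for x y
  proof -
    have "x \<otimes> (y \<otimes> inv x \<otimes> inv y) \<in> lower_central G (Suc j)"
      using that by (intro N.m_closed N.inv_op_closed2) auto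
    then show ?thesis using that by (simp add: commutator_def m_assoc)
  qed
  then have "generate G {commutator G x y |x y. x \<in> lower_central G (Suc j) \<and> y \<in> carrier G}
      \<subseteq> lower_central G (Suc j)"
    by (intro generate_subgroup_incl N.subgroup_axioms) auto
  then show ?thesis using Suc by simp
qed simp

lemma lower_central_antimono: "j \<le> k \<Longrightarrow> lower_central G k \<subseteq> lower_central G j"
  by (induction k rule: dec_induct) (use lower_central_Suc_subset in blast)+

end

lemma hom_commutator:
  assumes "group G" "group H" "h \<in> hom G H" "x \<in> carrier G" "y \<in> carrier G"
  shows "h (commutator G x y) = commutator H (h x) (h y)"
proof -
  interpret group_hom G H h using assms by (simp add: group_hom_def group_hom_axioms_def)
  show ?thesis using assms(4,5) by (simp add: commutator_def)
qed

lemma hom_lower_central: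
  assumes "group G" "group H" "h \<in> hom G H"
  shows "x \<in> lower_central G k \<Longrightarrow> h x \<in> lower_central H k"
proof (induction k arbitrary: x rule: less_induct)
  case (less k)
  interpret G: group G by fact
  interpret H: group H by fact
  interpret group_hom G H h by unfold_locales fact
  consider "k = 0" | "k = 1" | j where "k = Suc (Suc j)" by (metis One_nat_def not0_implies_Suc)
  then show ?case
  proof cases
    case 3
    interpret N: subgroup "lower_central H k" H by (rule H.lower_central_subgroup)
    have "x \<in> generate G {commutator G x y |x y. x \<in> lower_central G (Suc j) \<and> y \<in> carrier G}"
      using less.prems 3 by simp
    then show ?thesis
    proof (induction rule: generate.induct)
      case (incl g)
      then obtain x y where xy: "x \<in> lower_central G (Suc j)" "y \<in> carrier G" "g = commutator G x y" by auto
      then show ?case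
        using less.IH[OF _ xy(1)] G.lower_central_closed[OF xy(1)] 3
          H.commutator_in_lower_central[of "h x" "Suc j" "h y"]
        by (simp add: hom_commutator[OF assms])
    next
      case (inv g)
      then obtain x y where xy: "x \<in> lower_central G (Suc j)" "y \<in> carrier G" "g = commutator G x y" by auto
      have "h g \<in> lower_central H k"
        using xy less.IH[OF _ xy(1)] G.lower_central_closed[OF xy(1)] 3
          H.commutator_in_lower_central[of "h x" "Suc j" "h y"]
        by (simp add: hom_commutator[OF assms])
      then show ?case using xy G.lower_central_closed[OF xy(1)] by simp
    next
      case (eng g g')
      have "g \<in> carrier G" "g' \<in> carrier G"
        by (rule G.generate_in_carrier[rotated, OF eng(1)] G.generate_in_carrier[rotated, OF eng(2)];
            auto dest: G.lower_central_closed)+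
      then show ?case using eng by simp
    qed simp
  qed (use less.prems in auto)
qed

section \<open>Cosets of the lower central series of a free group\<close>

lemma (in normal) rcos_eq_iff:
  assumes "x \<in> carrier G" "y \<in> carrier G"
  shows "H #> x = H #> y \<longleftrightarrow> x \<otimes> inv y \<in> H"
  by (metis assms is_group normal_imp_subgroup normal_axioms rcos_module rcos_self repr_independence)

interpretation \<Gamma>: normal "\<Gamma> n k" "free_group n" for n k
  by (rule F.lower_central_normal)

abbreviation cl :: "nat \<Rightarrow> nat \<Rightarrow> (nat \<times> bool) list \<Rightarrow> (nat \<times> bool) list set" where
  "cl n k x \<equiv> \<Gamma> n k #>\<^bsub>free_group n\<^esub> x"

lemma endo_closed [simp]: "\<lbrakk>\<phi> \<in> hom (free_group n) (free_group n); x \<in> carrier (free_group n)\<rbrakk>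
    \<Longrightarrow> \<phi> x \<in> carrier (free_group n)"
  by (rule hom_in_carrier)

lemma cl_eq_mono: 
  assumes "cl n k x = cl n k y" "j \<le> k" "x \<in> carrier (free_group n)" "y \<in> carrier (free_group n)"
  shows "cl n j x = cl n j y"
  using assms F.lower_central_antimono[OF assms(2)] by (auto simp: \<Gamma>.rcos_eq_iff)

lemma endo_cl_eq:
  assumes \<phi>: "\<phi> \<in> hom (free_group n) (free_group n)"
    and "cl n k x = cl n k y" "x \<in> carrier (free_group n)" "y \<in> carrier (free_group n)"
  shows "cl n k (\<phi> x) = cl n k (\<phi> y)"
proof -
  interpret \<phi>: group_hom "free_group n" "free_group n" \<phi> by unfold_locales fact
  have "\<phi> (x \<otimes>\<^bsub>free_group n\<^esub> inv\<^bsub>free_group n\<^esub> y) \<in> \<Gamma> n k"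
    using assms by (intro hom_lower_central[OF F.is_group F.is_group \<phi>]) (simp add: \<Gamma>.rcos_eq_iff)
  then show ?thesis using assms by (simp add: \<Gamma>.rcos_eq_iff)
qed

lemma cl_mult:
  "\<lbrakk>x \<in> carrier (free_group n); y \<in> carrier (free_group n)\<rbrakk> \<Longrightarrow>
    cl n k x <#>\<^bsub>free_group n\<^esub> cl n k y = cl n k (x \<otimes>\<^bsub>free_group n\<^esub> y)"
  by (rule \<Gamma>.rcos_sum)

lemma cl_cancel:
  "\<lbrakk>x \<in> \<Gamma> n k; y \<in> carrier (free_group n)\<rbrakk> \<Longrightarrow> cl n k (x \<otimes>\<^bsub>free_group n\<^esub> y) = cl n k y"
  by (simp add: \<Gamma>.rcos_eq_iff F.m_assoc)

lemma cl_trivial: "x \<in> \<Gamma> n k \<Longrightarrow> cl n k x = \<Gamma> n k"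
  by (simp add: F.coset_join2 \<Gamma>.subgroup_axioms)

lemma cl_commute:
  assumes "x \<in> \<Gamma> n k" "y \<in> carrier (free_group n)" "1 \<le> k"
  shows "cl n (Suc k) (x \<otimes>\<^bsub>free_group n\<^esub> y) = cl n (Suc k) (y \<otimes>\<^bsub>free_group n\<^esub> x)"
  using F.commutator_in_lower_central[OF assms] F.commutator_mult_swap[of x n y] assms
  by (simp add: cl_cancel)

section \<open>The Magnus expansion\<close>

text \<open>A formal power series with integer coefficients in noncommuting variables is given by its
  coefficient function on words. The product is defined by recursion on the word.\<close>

fun conv :: "(nat list \<Rightarrow> int) \<Rightarrow> (nat list \<Rightarrow> int) \<Rightarrow> nat list \<Rightarrow> int" where
  "conv s t [] = s [] * t []"
| "conv s t (a # w) = s [] * t (a # w) + conv (\<lambda>v. s (a # v)) t w"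

definition series_monoid :: "(nat list \<Rightarrow> int) monoid" where
  "series_monoid = \<lparr>carrier = UNIV, monoid.mult = conv, one = (\<lambda>w. of_bool (w = []))\<rparr>"

text \<open>The Magnus substitution: x_i becomes 1 + X_i, and its inverse becomes the geometric
  series 1 - X_i + X_i X_i - ...\<close>

fun letter_series :: "nat \<times> bool \<Rightarrow> nat list \<Rightarrow> int" where
  "letter_series (i, True) w = of_bool (w = []) + of_bool (w = [i])"
| "letter_series (i, False) w = (if set w \<subseteq> {i} then (- 1) ^ length w else 0)"

definition magnus :: "(nat \<times> bool) list \<Rightarrow> nat list \<Rightarrow> int" where
  "magnus = word_eval series_monoid letter_series"

lemma conv_add_left: "conv (\<lambda>w. s w + s' w) t w = conv s t w + conv s' t w"
  by (induction w arbitrary: s s') (simp_all add: algebra_simps)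

lemma conv_scale_left: "conv (\<lambda>w. c * s w) t w = c * conv s t w"
  by (induction w arbitrary: s) (simp_all add: algebra_simps)

lemma conv_zero_left: "conv (\<lambda>w. 0) t w = 0"
  using conv_scale_left[of 0 "\<lambda>w. 0" t w] by simp

lemma conv_one_left: "conv (\<lambda>w. of_bool (w = [])) t w = t w"
  by (cases w) (simp_all add: conv_zero_left)

lemma conv_one_right: "conv s (\<lambda>w. of_bool (w = [])) w = s w"
  by (induction w arbitrary: s) simp_all

lemma conv_assoc: "conv (conv s t) u w = conv s (conv t u) w"
proof (induction w arbitrary: s)
  case (Cons a w)
  have "conv (\<lambda>v. conv s t (a # v)) u w =
      s [] * conv (\<lambda>v. t (a # v)) u w + conv (\<lambda>v. s (a # v)) (conv t u) w"
    using Cons[of "\<lambda>v. s (a # v)"] by (simp add: conv_add_left conv_scale_left)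
  then show ?case by (simp add: algebra_simps)
qed simp

text \<open>The recursive form of the product suits associativity; this Cauchy form is the one used
  to compare degrees.\<close>

lemma conv_sum: "conv s t w = (\<Sum>i\<le>length w. s (take i w) * t (drop i w))"
  by (induction w arbitrary: s) (simp_all add: sum.atMost_Suc_shift del: sum.atMost_Suc)

lemma monoid_series_monoid: "monoid series_monoid"
  by (rule monoidI) (auto simp: series_monoid_def conv_assoc conv_one_left conv_one_right)

lemma letter_series_inverse:
  "conv (letter_series a) (letter_series (inv_letter a)) = (\<lambda>w. of_bool (w = []))"
proof -
  obtain i b where a: "a = (i, b)" by (cases a)
  show ?thesis
  proof (cases b)
    case True
    have "(\<lambda>v. letter_series (i, True) (x # v)) = (\<lambda>v. of_bool (x = i) * of_bool (v = []))" for x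
      by auto
    then have "conv (letter_series (i, True)) t (x # w) = t (x # w) + of_bool (x = i) * t w" for t x w
      by (simp add: conv_scale_left conv_one_left)
    then show ?thesis using True a
      by (intro ext, case_tac w) (auto simp: inv_letter_def)
  next
    case False
    \<comment> \<open>Stripping a leading letter reproduces the geometric series up to the factor
      -1, or 0 for a foreign letter, so the recursive call of \<open>conv\<close> falls under the
      induction hypothesis.\<close>
    have shift: "(\<lambda>v. letter_series (i, False) (x # v)) =
        (\<lambda>v. (- of_bool (x = i)) * letter_series (i, False) v)" for x
      by auto
    have "conv (letter_series (i, False)) (letter_series (i, True)) w = of_bool (w = [])" for w
    proof (induction w)
      case (Cons x w)
      have "conv (letter_series (i, False)) (letter_series (i, True)) (x # w) =
          letter_series (i, True) (x # w) - of_bool (x = i) * of_bool (w = [])"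
        unfolding conv.simps shift conv_scale_left Cons.IH by simp
      also have "\<dots> = of_bool (x # w = [])" by auto
      finally show ?case .
    qed simp
    then show ?thesis using False a by (auto simp: inv_letter_def fun_eq_iff)
  qed
qed

lemma magnus_mult:
  assumes "x \<in> carrier (free_group n)" "y \<in> carrier (free_group n)"
  shows "magnus (x \<otimes>\<^bsub>free_group n\<^esub> y) = conv (magnus x) (magnus y)"
proof -
  have "magnus \<in> hom (free_group n) series_monoid"
    unfolding magnus_def
    by (rule word_eval_hom[OF monoid_series_monoid])
      (auto simp: series_monoid_def letter_series_inverse)
  then show ?thesis using assms by (simp add: hom_def series_monoid_def)
qed

lemma magnus_Nil: "magnus [] = (\<lambda>w. of_bool (w = []))"
  by (simp add: magnus_def word_eval_def series_monoid_def)

lemma magnus_gen: "magnus (gen i) = (\<lambda>w. of_bool (w = []) + of_bool (w = [i]))"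
  by (simp add: magnus_def word_eval_def series_monoid_def gen_def fun_eq_iff conv_one_right)

lemma magnus_constant: "magnus x [] = 1"
proof (induction x)
  case (Cons a x)
  then show ?case by (cases a, cases "snd a") (auto simp: magnus_def word_eval_def series_monoid_def)
qed (simp add: magnus_Nil)

text \<open>Congruence to 1 modulo terms of degree at least \<open>k\<close>. For \<open>k\<close>
  at most 1 only the constant term is constrained.\<close>

definition trivial_below :: "nat \<Rightarrow> (nat list \<Rightarrow> int) \<Rightarrow> bool" where
  "trivial_below k s \<longleftrightarrow> s [] = 1 \<and> (\<forall>w. 0 < length w \<and> length w < k \<longrightarrow> s w = 0)"

lemma trivial_belowD: "\<lbrakk>trivial_below k s; w \<noteq> []; length w < k\<rbrakk> \<Longrightarrow> s w = 0"
  by (simp add: trivial_below_def)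

text \<open>With s = 1 + S and t = 1 + T the product is 1 + S + T + ST. Since S starts in degree i
  and T in degree j, ST starts in degree i + j, and there only the split after i letters
  contributes.\<close>

lemma conv_low_degree:
  assumes s: "trivial_below i s" and t: "trivial_below j t" and w: "w \<noteq> []" "length w \<le> i + j"
    and ij: "1 \<le> i" "1 \<le> j"
  shows "conv s t w = s w + t w + of_bool (length w = i + j) * (s (take i w) * t (drop i w))"
proof -
  define m where "m = length w"
  let ?f = "\<lambda>p. s (take p w) * t (drop p w)"
  have m: "m > 0" using w by (simp add: m_def)
  have st: "s [] = 1" "t [] = 1" using s t by (simp_all add: trivial_below_def)
  have "{..m} = insert 0 (insert m {0<..<m})" by auto
  then have "conv s t w = s w + t w + sum ?f {0<..<m}"
    using m st unfolding conv_sum m_def by simp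
  moreover have "sum ?f {0<..<m} = (\<Sum>p\<in>{0<..<m}. if p = i then of_bool (m = i + j) * ?f i else 0)"
  proof (rule sum.cong)
    fix p assume p: "p \<in> {0<..<m}"
    have "?f p = 0" if "p \<noteq> i \<or> m \<noteq> i + j"
    proof -
      have "p < i \<or> m - p < j" using that w(2) p by (auto simp: m_def)
      moreover have "s (take p w) = 0" if "p < i"
        using that p w by (intro trivial_belowD[OF s]) (auto simp: m_def)
      moreover have "t (drop p w) = 0" if "m - p < j"
        using that p w by (intro trivial_belowD[OF t]) (auto simp: m_def)
      ultimately show ?thesis by auto
    qed
    then show "?f p = (if p = i then of_bool (m = i + j) * ?f i else 0)" by auto
  qed simp
  moreover have "\<dots> = of_bool (m = i + j) * ?f i" using ij by (auto simp: sum.delta)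
  ultimately show ?thesis by (simp add: m_def)
qed

text \<open>The case j = 1 of \<open>conv_low_degree\<close>: the mixed term starts only in degree k
  + 1.\<close>

lemma conv_add_low_degree:
  assumes s: "trivial_below k s" and t: "t [] = 1" and w: "w \<noteq> []" "length w \<le> k"
  shows "conv s t w = s w + t w"
proof -
  have "trivial_below 1 t" using t by (auto simp: trivial_below_def)
  from conv_low_degree[OF s this w(1)] w show ?thesis by (cases "k = 0") auto
qed

text \<open>Compares coefficients in [x, y] (y x) = x y. By induction on the length of
  \<open>w\<close> the commutator has no terms of smaller positive degree, so in degree
  \<open>length w\<close> the left-hand product is just a sum.\<close>

lemma magnus_commutator:
  assumes x: "x \<in> carrier (free_group n)" "trivial_below i (magnus x)"
    and y: "y \<in> carrier (free_group n)" "trivial_below j (magnus y)"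
    and ij: "1 \<le> i" "1 \<le> j" and w: "w \<noteq> []" "length w \<le> i + j"
  shows "magnus (commutator (free_group n) x y) w =
    of_bool (length w = i + j) *
      (tensor_mult i (magnus x) (magnus y) w - tensor_mult j (magnus y) (magnus x) w)"
  using w
proof (induction "length w" arbitrary: w rule: less_induct)
  case less
  let ?c = "commutator (free_group n) x y"
  have "trivial_below (length w) (magnus ?c)"
    using less.hyps less.prems unfolding trivial_below_def by (simp add: magnus_constant)
  then have "conv (magnus ?c) (magnus (y \<otimes>\<^bsub>free_group n\<^esub> x)) w = magnus ?c w + magnus (y \<otimes>\<^bsub>free_group n\<^esub> x) w"
    using less.prems by (intro conv_add_low_degree[of "length w"]) (auto simp: magnus_constant)
  moreover have "conv (magnus ?c) (magnus (y \<otimes>\<^bsub>free_group n\<^esub> x)) = magnus (x \<otimes>\<^bsub>free_group n\<^esub> y)"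
    using x y F.commutator_mult_swap[of x n y] by (simp add: magnus_mult)
  ultimately have "magnus ?c w = magnus (x \<otimes>\<^bsub>free_group n\<^esub> y) w - magnus (y \<otimes>\<^bsub>free_group n\<^esub> x) w" by simp
  also have "\<dots> = conv (magnus x) (magnus y) w - conv (magnus y) (magnus x) w"
    using x y by (simp add: magnus_mult)
  also have "\<dots> = of_bool (length w = i + j) *
      (tensor_mult i (magnus x) (magnus y) w - tensor_mult j (magnus y) (magnus x) w)"
    using conv_low_degree[OF x(2) y(2) less.prems ij] conv_low_degree[OF y(2) x(2) less.prems(1) _ ij(2,1)]
      less.prems
    by (simp add: tensor_mult_def algebra_simps)
  finally show ?case .
qed

lemma magnus_inv:
  assumes x: "x \<in> carrier (free_group n)" "trivial_below k (magnus x)" and w: "w \<noteq> []" "length w \<le> k"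
  shows "magnus (inv\<^bsub>free_group n\<^esub> x) w = - magnus x w"
proof -
  have "conv (magnus x) (magnus (inv\<^bsub>free_group n\<^esub> x)) w = magnus [] w"
    using x by (simp add: one_free_group flip: magnus_mult)
  then show ?thesis
    using conv_add_low_degree[OF x(2) _ w, of "magnus (inv\<^bsub>free_group n\<^esub> x)"] magnus_constant w by (simp add: magnus_Nil)
qed

lemma subgroup_trivial_below:
  "subgroup {x \<in> carrier (free_group n). trivial_below k (magnus x)} (free_group n)"
proof (rule F.subgroupI)
  show "{x \<in> carrier (free_group n). trivial_below k (magnus x)} \<noteq> {}"
    by (auto simp: trivial_below_def one_free_group magnus_Nil intro!: exI[of _ "\<one>\<^bsub>free_group n\<^esub>"])
next
  fix x assume "x \<in> {x \<in> carrier (free_group n). trivial_below k (magnus x)}"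
  then show "inv\<^bsub>free_group n\<^esub> x \<in> {x \<in> carrier (free_group n). trivial_below k (magnus x)}"
    using magnus_inv[of x n k] by (auto simp: trivial_below_def magnus_constant)
next
  fix x y assume "x \<in> {x \<in> carrier (free_group n). trivial_below k (magnus x)}"
    "y \<in> {x \<in> carrier (free_group n). trivial_below k (magnus x)}"
  then show "x \<otimes>\<^bsub>free_group n\<^esub> y \<in> {x \<in> carrier (free_group n). trivial_below k (magnus x)}"
    using conv_add_low_degree[of k "magnus x" "magnus y"]
    by (auto simp: trivial_below_def magnus_constant magnus_mult)
qed auto

text \<open>The easy half of Magnus' theorem: by \<open>magnus_commutator\<close> with second degree
  1, each further commutator raises the order of the series by one.\<close>

lemma trivial_below_lower_central:
  assumes "x \<in> \<Gamma> n k"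
  shows "trivial_below k (magnus x)"
  using assms
proof (induction k arbitrary: x rule: less_induct)
  case (less k)
  consider "k \<le> 1" | j where "k = Suc (Suc j)" by (metis One_nat_def less_Suc0 not_less not0_implies_Suc less_Suc_eq_le Suc_le_mono le0)
  then show ?case
  proof cases
    case 2
    have one: "trivial_below 1 (magnus y)" for y by (auto simp: trivial_below_def magnus_constant)
    have "{commutator (free_group n) x y |x y. x \<in> \<Gamma> n (Suc j) \<and> y \<in> carrier (free_group n)}
       \<subseteq> {x \<in> carrier (free_group n). trivial_below k (magnus x)}"
      using magnus_commutator[OF _ less.IH _ one, of _ n "Suc j"] F.lower_central_closed 2
      by (auto simp: trivial_below_def magnus_constant)
    from F.generate_subgroup_incl[OF this subgroup_trivial_below] show ?thesis
      using less.prems 2 by auto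
  next
    case 1
    then show ?thesis unfolding trivial_below_def magnus_constant
      by (metis less_one linorder_not_le order_less_trans order_less_le_trans less_irrefl_nat)
  qed
qed

section \<open>The embedding of the free Lie ring into the tensor ring\<close>

text \<open>Cutting off at \<open>index_words\<close> makes the value a tensor of degree
  \<open>k\<close> for every \<open>x\<close>; it is a genuine leading term when \<open>x\<close>
  lies in \<Gamma>(k).\<close>

definition lead :: "nat \<Rightarrow> nat \<Rightarrow> (nat \<times> bool) list \<Rightarrow> nat list \<Rightarrow> int" where
  "lead n k x = (\<lambda>w. if w \<in> index_words n k then magnus x w else 0)"

lemma lead_mult:
  assumes "x \<in> \<Gamma> n k" "y \<in> \<Gamma> n k" "1 \<le> k"
  shows "lead n k (x \<otimes>\<^bsub>free_group n\<^esub> y) = (\<lambda>w. lead n k x w + lead n k y w)"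
proof
  fix w
  show "lead n k (x \<otimes>\<^bsub>free_group n\<^esub> y) w = lead n k x w + lead n k y w"
    using conv_add_low_degree[OF trivial_below_lower_central[OF assms(1)], of "magnus y" w] assms
    by (auto simp: lead_def magnus_constant magnus_mult index_words_def Suc_le_eq dest: F.lower_central_closed)
qed

lemma lead_one: "1 \<le> k \<Longrightarrow> lead n k \<one>\<^bsub>free_group n\<^esub> = (\<lambda>w. 0)"
  by (auto simp: lead_def one_free_group magnus_Nil index_words_def fun_eq_iff)

lemma lead_inv:
  assumes "x \<in> \<Gamma> n k" "1 \<le> k"
  shows "lead n k (inv\<^bsub>free_group n\<^esub> x) = (\<lambda>w. - lead n k x w)"
proof
  fix w
  show "lead n k (inv\<^bsub>free_group n\<^esub> x) w = - lead n k x w"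
    using magnus_inv[OF F.lower_central_closed[OF assms(1)] trivial_below_lower_central[OF assms(1)], of w] assms(2)
    by (auto simp: lead_def index_words_def Suc_le_eq)
qed

lemma lead_zero:
  assumes "x \<in> \<Gamma> n (Suc k)" "1 \<le> k"
  shows "lead n k x = (\<lambda>w. 0)"
  using trivial_below_lower_central[OF assms(1)] assms(2)
  by (auto simp: lead_def trivial_below_def index_words_def fun_eq_iff Suc_le_eq)

lemma lead_gen: "i < n \<Longrightarrow> lead n 1 (gen i) = (\<lambda>w. of_bool (w = [i]))"
  by (auto simp: lead_def magnus_gen index_words_def length_Suc_conv fun_eq_iff)

lemma index_words_append_iff:
  "w \<in> index_words n (i + j) \<longleftrightarrow> take i w \<in> index_words n i \<and> drop i w \<in> index_words n j"
proof -
  have "set w = set (take i w) \<union> set (drop i w)" by (metis append_take_drop_id set_append)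
  then show ?thesis by (auto simp: index_words_def)
qed

lemma lead_commutator:
  assumes "x \<in> \<Gamma> n i" "y \<in> \<Gamma> n j" "1 \<le> i" "1 \<le> j"
  shows "lead n (i + j) (commutator (free_group n) x y) =
    (\<lambda>w. tensor_mult i (lead n i x) (lead n j y) w - tensor_mult j (lead n j y) (lead n i x) w)"
proof
  fix w
  note * = magnus_commutator[OF F.lower_central_closed[OF assms(1)] trivial_below_lower_central[OF assms(1)]
     F.lower_central_closed[OF assms(2)] trivial_below_lower_central[OF assms(2)] assms(3,4), of w]
  show "lead n (i + j) (commutator (free_group n) x y) w =
    tensor_mult i (lead n i x) (lead n j y) w - tensor_mult j (lead n j y) (lead n i x) w"
  proof (cases "w \<in> index_words n (i + j)")
    case True
    then have "length w = i + j" "w \<noteq> []" using assms(3) by (auto simp: index_words_def)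
    then show ?thesis
      using * True index_words_append_iff[of w n i j] index_words_append_iff[of w n j i]
      by (simp add: lead_def tensor_mult_def add.commute)
  next
    case False
    then show ?thesis
      using index_words_append_iff[of w n i j] index_words_append_iff[of w n j i]
      by (auto simp: lead_def tensor_mult_def add.commute)
  qed
qed

lemma lead_conj:
  assumes "x \<in> \<Gamma> n k" "g \<in> carrier (free_group n)" "1 \<le> k"
  shows "lead n k (g \<otimes>\<^bsub>free_group n\<^esub> x \<otimes>\<^bsub>free_group n\<^esub> inv\<^bsub>free_group n\<^esub> g) = lead n k x"
proof -
  let ?c = "commutator (free_group n) x g"
  have x: "x \<in> carrier (free_group n)" using assms(1) by (rule F.lower_central_closed)
  have c: "?c \<in> \<Gamma> n (Suc k)" using assms by (rule F.commutator_in_lower_central)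
  then have ck: "?c \<in> \<Gamma> n k" using F.lower_central_Suc_subset by blast
  have "g \<otimes>\<^bsub>free_group n\<^esub> x \<otimes>\<^bsub>free_group n\<^esub> inv\<^bsub>free_group n\<^esub> g = inv\<^bsub>free_group n\<^esub> ?c \<otimes>\<^bsub>free_group n\<^esub> x"
    using x assms(2) by (simp add: commutator_def F.m_assoc F.inv_mult_group)
  then show ?thesis
    using assms lead_zero[OF c assms(3)] ck by (simp add: lead_mult lead_inv)
qed

lemma lead_in_tensor_power: "lead n k x \<in> carrier (tensor_power n k)"
  by (simp add: lead_def tensor_power_def)

text \<open>A factor from \<Gamma>(k+1) is 1 plus terms of degree above k and leaves all
  coefficients up to degree k unchanged. Hence no membership in \<Gamma>(k) has to be assumed, and
  the same fact serves for classes in H and for \<open>lie n k\<close>.\<close>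

lemma lead_cong:
  assumes "cl n (Suc k) x = cl n (Suc k) y" "x \<in> carrier (free_group n)" "y \<in> carrier (free_group n)"
    "1 \<le> k"
  shows "lead n k x = lead n k y"
proof
  fix w
  let ?d = "x \<otimes>\<^bsub>free_group n\<^esub> inv\<^bsub>free_group n\<^esub> y"
  have d: "?d \<in> \<Gamma> n (Suc k)" using assms by (simp add: \<Gamma>.rcos_eq_iff)
  have "magnus x = conv (magnus ?d) (magnus y)"
    using assms(2,3) magnus_mult[of ?d n y] by (simp add: F.m_assoc)
  then show "lead n k x w = lead n k y w"
    using conv_add_low_degree[OF trivial_below_lower_central[OF d], of "magnus y" w] assms(4)
      trivial_below_lower_central[OF d]
    by (auto simp: lead_def index_words_def magnus_constant trivial_below_def Suc_le_eq)
qed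

lemma lie_carrier: "carrier (lie n k) = cl n (Suc k) ` \<Gamma> n k"
  by (simp add: lie_def carrier_FactGroup)

lemma lie_mult: "monoid.mult (lie n k) = (<#>\<^bsub>free_group n\<^esub>)"
  by (simp add: lie_def set_mult_def fun_eq_iff)

lemma lie_one: "\<one>\<^bsub>lie n k\<^esub> = \<Gamma> n (Suc k)"
  by (simp add: lie_def)

text \<open>Leading terms do not depend on the representative, are additive on \<Gamma>(k), and turn
  group commutators into tensor commutators. This makes the choice in \<open>lie_embedding\<close>
  meaningful.\<close>

lemma exists_lie_embedding: "\<exists>\<iota>. is_lie_embedding n \<iota>"
proof -
  define \<iota> where "\<iota> k C = lead n k (SOME x. x \<in> C)" for k C
  have \<iota>: "\<iota> k (cl n (Suc k) x) = lead n k x" if x: "x \<in> carrier (free_group n)" "1 \<le> k" for k x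
  proof -
    let ?y = "SOME y. y \<in> cl n (Suc k) x"
    have y: "?y \<in> cl n (Suc k) x"
      by (rule someI[of _ x]) (simp add: that F.rcos_self \<Gamma>.subgroup_axioms)
    then have "cl n (Suc k) ?y = cl n (Suc k) x"
      by (metis F.repr_independence x(1) \<Gamma>.subgroup_axioms)
    moreover have "?y \<in> carrier (free_group n)"
      using y x(1) \<Gamma>.elemrcos_carrier F.is_group by blast
    ultimately show ?thesis using that lead_cong[of n k ?y x] by (simp add: \<iota>_def)
  qed
  have "\<iota> k \<in> hom (lie n k) (tensor_power n k)" if "1 \<le> k" for k
  proof (rule homI)
    fix C D assume "C \<in> carrier (lie n k)" "D \<in> carrier (lie n k)"
    then obtain x y where xy: "C = cl n (Suc k) x" "x \<in> \<Gamma> n k" "D = cl n (Suc k) y" "y \<in> \<Gamma> n k"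
      by (auto simp: lie_carrier)
    then show "\<iota> k (C \<otimes>\<^bsub>lie n k\<^esub> D) = \<iota> k C \<otimes>\<^bsub>tensor_power n k\<^esub> \<iota> k D"
      using that F.lower_central_closed[OF xy(2)] F.lower_central_closed[OF xy(4)]
      by (simp add: lie_mult cl_mult \<iota> lead_mult tensor_power_def)
  qed (use that in \<open>auto simp: lie_carrier \<iota> lead_in_tensor_power F.lower_central_closed\<close>)
  moreover have "\<iota> 1 (cl n 2 (gen i)) = (\<lambda>w. of_bool (w = [i]))" if "i < n" for i
    using that \<iota>[of "gen i" 1] lead_gen[OF that] by (simp add: numeral_2_eq_2)
  moreover have "\<iota> (i + j) (cl n (i + j + 1) (commutator (free_group n) x y)) =
     (\<lambda>w. tensor_mult i (\<iota> i (cl n (i + 1) x)) (\<iota> j (cl n (j + 1) y)) w -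
          tensor_mult j (\<iota> j (cl n (j + 1) y)) (\<iota> i (cl n (i + 1) x)) w)"
    if "1 \<le> i" "1 \<le> j" "x \<in> \<Gamma> n i" "y \<in> \<Gamma> n j" for i j x y
    using that F.lower_central_closed[OF that(3)] F.lower_central_closed[OF that(4)]
    by (simp add: \<iota> lead_commutator)
  ultimately have "is_lie_embedding n \<iota>" unfolding is_lie_embedding_def Let_def by blast
  then show ?thesis by blast
qed

lemma generators_generate:
  assumes "subgroup S (free_group n)" "\<And>i. i < n \<Longrightarrow> gen i \<in> S"
  shows "carrier (free_group n) \<subseteq> S"
proof
  interpret S: subgroup S "free_group n" by fact
  fix x assume "x \<in> carrier (free_group n)"
  then show "x \<in> S" by (induction rule: free_group_induct) (auto simp: assms(2))
qed

text \<open>\<Gamma>(k) is generated by commutators of \<Gamma>(k-1) with the whole group, so the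
  values in degree k are forced by those in degrees k - 1 and 1. Thus the chosen embedding can be
  computed by Magnus coefficients.\<close>

lemma is_lie_embedding_unique:
  assumes \<iota>: "is_lie_embedding n \<iota>" and "1 \<le> k" "x \<in> \<Gamma> n k"
  shows "\<iota> k (cl n (Suc k) x) = lead n k x"
  using assms(2,3)
proof (induction k arbitrary: x rule: less_induct)
  case (less k)
  define S where "S = {y \<in> \<Gamma> n k. \<iota> k (cl n (Suc k) y) = lead n k y}"
  have hom: "\<iota> k \<in> hom (lie n k) (tensor_power n k)"
    using \<iota> less.prems by (simp add: is_lie_embedding_def)
  have mult: "\<iota> k (cl n (Suc k) (y \<otimes>\<^bsub>free_group n\<^esub> z)) = (\<lambda>w. \<iota> k (cl n (Suc k) y) w + \<iota> k (cl n (Suc k) z) w)"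
    if "y \<in> \<Gamma> n k" "z \<in> \<Gamma> n k" for y z
    using hom_mult[OF hom, of "cl n (Suc k) y" "cl n (Suc k) z"] that
    by (simp add: lie_carrier lie_mult cl_mult F.lower_central_closed) (simp add: tensor_power_def)
  have one: "\<iota> k (cl n (Suc k) \<one>\<^bsub>free_group n\<^esub>) w = 0" for w
    using mult[of "\<one>\<^bsub>free_group n\<^esub>" "\<one>\<^bsub>free_group n\<^esub>"] by (simp add: fun_eq_iff)
  have S: "subgroup S (free_group n)"
  proof (rule F.subgroupI)
    show "S \<subseteq> carrier (free_group n)" by (auto simp: S_def F.lower_central_closed)
    show "S \<noteq> {}" using one less.prems(1) by (auto simp: S_def lead_one fun_eq_iff intro!: exI[of _ "\<one>\<^bsub>free_group n\<^esub>"])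
    show "y \<otimes>\<^bsub>free_group n\<^esub> z \<in> S" if "y \<in> S" "z \<in> S" for y z
      using that less.prems(1) by (auto simp: S_def mult lead_mult)
    show "inv\<^bsub>free_group n\<^esub> y \<in> S" if y: "y \<in> S" for y
    proof -
      have "(\<lambda>w. \<iota> k (cl n (Suc k) y) w + \<iota> k (cl n (Suc k) (inv\<^bsub>free_group n\<^esub> y)) w) = (\<lambda>w. 0)"
        using y one mult[of y "inv\<^bsub>free_group n\<^esub> y"] F.lower_central_closed[of y n k] by (simp add: S_def fun_eq_iff)
      then show ?thesis using y less.prems(1) by (auto simp: S_def lead_inv fun_eq_iff add_eq_0_iff)
    qed
  qed
  have gens: "\<iota> 1 (cl n 2 (gen i)) = lead n 1 (gen i)" if "i < n" for i
    using \<iota> that lead_gen[OF that] by (simp add: is_lie_embedding_def)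
  show ?case
  proof (cases "k = 1")
    case True
    have "carrier (free_group n) \<subseteq> S"
      using gens True by (intro generators_generate S) (auto simp: S_def numeral_2_eq_2)
    then show ?thesis using F.lower_central_closed[OF less.prems(2)] by (auto simp: S_def)
  next
    case False
    then obtain j where k: "k = Suc (Suc j)" using less.prems(1) by (metis One_nat_def Suc_le_D le_0_eq not0_implies_Suc)
    have "commutator (free_group n) y z \<in> S" if yz: "y \<in> \<Gamma> n (Suc j)" "z \<in> carrier (free_group n)" for y z
    proof -
      have "\<iota> (Suc j) (cl n (Suc (Suc j)) y) = lead n (Suc j) y"
        using less.IH[of "Suc j" y] yz k by simp
      moreover have "\<iota> 1 (cl n 2 z) = lead n 1 z"
        using less.IH[of 1 z] yz k by (simp add: numeral_2_eq_2)
      moreover have "let X = \<iota> (Suc j) (cl n (Suc j + 1) y); Y = \<iota> 1 (cl n (1 + 1) z)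
          in \<iota> (Suc j + 1) (cl n (Suc j + 1 + 1) (commutator (free_group n) y z)) =
            (\<lambda>w. tensor_mult (Suc j) X Y w - tensor_mult 1 Y X w)"
      proof -
        have z: "z \<in> \<Gamma> n 1" using yz(2) by simp
        have "\<forall>i\<ge>1. \<forall>j\<ge>1. \<forall>x\<in>\<Gamma> n i. \<forall>y\<in>\<Gamma> n j.
          let X = \<iota> i (cl n (i + 1) x); Y = \<iota> j (cl n (j + 1) y)
          in \<iota> (i + j) (cl n (i + j + 1) (commutator (free_group n) x y)) =
            (\<lambda>w. tensor_mult i X Y w - tensor_mult j Y X w)"
          using \<iota> unfolding is_lie_embedding_def by (elim conjE)
        from this[rule_format, of "Suc j" 1 y z] show ?thesis using yz(1) z by simp
      qed
      ultimately have "\<iota> k (cl n (Suc k) (commutator (free_group n) y z)) = lead n k (commutator (free_group n) y z)"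
        using lead_commutator[of y n "Suc j" z 1] yz k by (simp add: Let_def numeral_2_eq_2)
      then show ?thesis using F.commutator_in_lower_central[OF yz] k by (simp add: S_def)
    qed
    then have "\<Gamma> n k \<subseteq> S"
      unfolding k lower_central.simps by (intro F.generate_subgroup_incl S) auto
    then show ?thesis using less.prems by (auto simp: S_def)
  qed
qed

lemma lie_embedding_cl:
  assumes "1 \<le> k" "x \<in> \<Gamma> n k"
  shows "lie_embedding n k (cl n (Suc k) x) = lead n k x"
  unfolding lie_embedding_def
  by (rule is_lie_embedding_unique[OF someI_ex[OF exists_lie_embedding] assms])

section \<open>Tensor and exterior powers\<close>

lemma index_words_0: "index_words n 0 = {[]}"
  by (auto simp: index_words_def)

lemma Cons_index_words [simp]: "a # w \<in> index_words n (Suc k) \<longleftrightarrow> a < n \<and> w \<in> index_words n k"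
  by (auto simp: index_words_def)

lemma index_words_SucE:
  assumes "w \<in> index_words n (Suc k)"
  obtains a v where "w = a # v" "a < n" "v \<in> index_words n k"
  using assms by (cases w) (auto simp: index_words_def)

lemma finite_index_words [simp]: "finite (index_words n k)"
  unfolding index_words_def using finite_lists_length_eq[of "{..<n}" k]
  by (simp add: conj_commute)

lemma sum_index_words_Suc:
  "sum f (index_words n (Suc k)) = (\<Sum>a<n. \<Sum>w\<in>index_words n k. f (a # w))"
proof -
  have "sum f (index_words n (Suc k)) = (\<Sum>(a, w)\<in>{..<n} \<times> index_words n k. f (a # w))"
    by (rule sum.reindex_bij_witness[of _ "\<lambda>(a, w). a # w" "\<lambda>w. (hd w, tl w)"])
      (auto elim: index_words_SucE)
  then show ?thesis by (simp add: sum.cartesian_product)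
qed

lemma sum_index_words_Suc':
  "sum f (index_words n (Suc k)) = (\<Sum>w\<in>index_words n k. \<Sum>a<n. f (w @ [a]))"
proof (induction k arbitrary: f)
  case (Suc k)
  have "sum f (index_words n (Suc (Suc k))) = (\<Sum>a<n. \<Sum>w\<in>index_words n (Suc k). f (a # w))"
    by (rule sum_index_words_Suc)
  also have "\<dots> = (\<Sum>a<n. \<Sum>w\<in>index_words n k. \<Sum>b<n. f ((a # w) @ [b]))"
    by (simp only: Suc append_Cons)
  also have "\<dots> = (\<Sum>w\<in>index_words n (Suc k). \<Sum>a<n. f (w @ [a]))"
    by (rule sum_index_words_Suc[symmetric])
  finally show ?case .
qed (simp add: sum_index_words_Suc index_words_0)

lemma comm_group_tensor_power: "comm_group (tensor_power n k :: (nat list \<Rightarrow> 'r::comm_ring_1) monoid)"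
proof (rule comm_groupI)
  fix t :: "nat list \<Rightarrow> 'r" assume "t \<in> carrier (tensor_power n k)"
  then show "\<exists>s\<in>carrier (tensor_power n k). s \<otimes>\<^bsub>tensor_power n k\<^esub> t = \<one>\<^bsub>tensor_power n k\<^esub>"
    by (intro bexI[of _ "\<lambda>w. - t w"]) (auto simp: tensor_power_def)
qed (auto simp: tensor_power_def add.assoc add.commute)

interpretation T: comm_group "tensor_power n k :: (nat list \<Rightarrow> 'r::comm_ring_1) monoid" for n k
  by (rule comm_group_tensor_power)

lemma tensor_power_mult: "s \<otimes>\<^bsub>tensor_power n k\<^esub> t = (\<lambda>w. s w + t w)"
  by (simp add: tensor_power_def)

lemma tensor_power_one: "\<one>\<^bsub>tensor_power n k\<^esub> = (\<lambda>w. 0)"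
  by (simp add: tensor_power_def)

lemma tensor_power_carrier: "t \<in> carrier (tensor_power n k) \<longleftrightarrow> (\<forall>w. w \<notin> index_words n k \<longrightarrow> t w = 0)"
  by (simp add: tensor_power_def)

lemma alt_relation_closed: "(\<lambda>w. c * pure_tensor n k v w) \<in> carrier (tensor_power n k)"
  by (simp add: tensor_power_carrier pure_tensor_def)

lemma alt_relationI:
  "\<lbrakk>i < j; j < k; v i = v j\<rbrakk> \<Longrightarrow> (\<lambda>w. c * pure_tensor n k v w) \<in> alt_relations n k"
  unfolding alt_relations_def by (rule generate.incl) blast

lemma subgroup_alt_relations:
  "subgroup (alt_relations n k) (tensor_power n k :: (nat list \<Rightarrow> 'r::comm_ring_1) monoid)"
  unfolding alt_relations_def by (rule T.generate_is_subgroup) (auto simp: alt_relation_closed)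

interpretation A: normal "alt_relations n k" "tensor_power n k :: (nat list \<Rightarrow> 'r::comm_ring_1) monoid" for n k
  by (rule T.subgroup_imp_normal) (rule subgroup_alt_relations)

lemma comm_group_ext_power: "comm_group (ext_power n k :: (nat list \<Rightarrow> 'r::comm_ring_1) set monoid)"
  unfolding ext_power_def by (rule T.abelian_FactGroup) (rule subgroup_alt_relations)

lemma ext_power_carrier: "carrier (ext_power n k) = ext_proj n k ` carrier (tensor_power n k)"
  by (simp add: ext_power_def carrier_FactGroup ext_proj_def)

lemma ext_power_one: "\<one>\<^bsub>ext_power n k\<^esub> = alt_relations n k"
  by (simp add: ext_power_def)

lemma ext_proj_mult:
  "\<lbrakk>s \<in> carrier (tensor_power n k); t \<in> carrier (tensor_power n k)\<rbrakk> \<Longrightarrow>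
    ext_proj n k s \<otimes>\<^bsub>ext_power n k\<^esub> ext_proj n k t = ext_proj n k (\<lambda>w. s w + t w)"
  by (simp add: ext_power_def ext_proj_def A.rcos_sum tensor_power_mult)

lemma ext_proj_eq_one_iff:
  "t \<in> carrier (tensor_power n k) \<Longrightarrow> ext_proj n k t = \<one>\<^bsub>ext_power n k\<^esub> \<longleftrightarrow> t \<in> alt_relations n k"
  unfolding ext_power_one ext_proj_def
  by (meson T.coset_join1 T.coset_join2 A.subgroup_axioms)

text \<open>The tensors sent into the relations form a subgroup, so it suffices to test
  \<open>h\<close> on the spanning relations. Then all representatives of a class have images in one
  class and the union collapses. Both extension of scalars and the action of matrices are handled
  this way.\<close>

lemma Union_ext_proj:
  fixes h :: "(nat list \<Rightarrow> 'r::comm_ring_1) \<Rightarrow> (nat list \<Rightarrow> 's::comm_ring_1)"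
  assumes h: "h \<in> hom (tensor_power n k) (tensor_power n k)"
    and rel: "\<And>c v i j. \<lbrakk>i < j; j < k; v i = v j\<rbrakk> \<Longrightarrow> h (\<lambda>w. c * pure_tensor n k v w) \<in> alt_relations n k"
    and t: "t \<in> carrier (tensor_power n k)"
  shows "(\<Union>s\<in>ext_proj n k t. ext_proj n k (h s)) = ext_proj n k (h t)"
proof -
  interpret h: group_hom "tensor_power n k" "tensor_power n k :: (nat list \<Rightarrow> 's) monoid" h
    by unfold_locales (rule h)
  have rels: "h r \<in> alt_relations n k" if "r \<in> alt_relations n k" for r
  proof -
    have gens: "{(\<lambda>w. c * pure_tensor n k v w) |c v. \<exists>i j. i < j \<and> j < k \<and> v i = v j}
        \<subseteq> {r \<in> carrier (tensor_power n k). h r \<in> alt_relations n k}"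
      using rel by (auto simp: alt_relation_closed)
    have "subgroup {r \<in> carrier (tensor_power n k). h r \<in> alt_relations n k} (tensor_power n k)"
    proof (rule T.subgroupI)
      show "{r \<in> carrier (tensor_power n k). h r \<in> alt_relations n k} \<noteq> {}"
        by (auto intro!: exI[of _ "\<one>\<^bsub>tensor_power n k\<^esub>"])
    qed auto
    from T.generate_subgroup_incl[OF gens this] that show ?thesis
      by (auto simp: alt_relations_def)
  qed
  have "ext_proj n k (h s) = ext_proj n k (h t)" if s: "s \<in> ext_proj n k t" for s
  proof -
    obtain r where r: "r \<in> alt_relations n k" "s = r \<otimes>\<^bsub>tensor_power n k\<^esub> t"
      using s by (auto simp: ext_proj_def r_coset_def)
    then have "h s = h r \<otimes>\<^bsub>tensor_power n k\<^esub> h t" using t by simp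
    then show ?thesis
      using rels[OF r(1)] t unfolding ext_proj_def
      by (simp add: A.rcos_eq_iff T.m_assoc)
  qed
  moreover have "t \<in> ext_proj n k t"
    unfolding ext_proj_def by (rule T.rcos_self[OF t A.subgroup_axioms])
  ultimately show ?thesis by blast
qed

lemma ext_int_to_rat_proj:
  assumes t: "t \<in> carrier (tensor_power n k)"
  shows "ext_int_to_rat n k (ext_proj n k t) = ext_proj n k (\<lambda>w. of_int (t w))"
  unfolding ext_int_to_rat_def
proof (rule Union_ext_proj[where h = "\<lambda>t w. of_int (t w)", OF _ _ t])
  fix c :: int and v :: "nat \<Rightarrow> nat \<Rightarrow> int" and i j :: nat assume ij: "i < j" "j < k" "v i = v j"
  have "(\<lambda>w. of_int (c * pure_tensor n k v w)) =
      (\<lambda>w. of_int c * pure_tensor n k (\<lambda>l a. of_int (v l a)) w :: rat)"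
    by (auto simp: pure_tensor_def of_int_prod)
  moreover have "\<dots> \<in> alt_relations n k"
    using ij by (intro alt_relationI[of i j]) auto
  ultimately show "(\<lambda>w. of_int (c * pure_tensor n k v w) :: rat) \<in> alt_relations n k" by metis
qed (auto simp: hom_def tensor_power_def)

subsection \<open>The action of matrices\<close>

lemma tensor_act_0: "tensor_act n 0 A t = (\<lambda>w. if w = [] then t [] else 0)"
  by (auto simp: tensor_act_def index_words_0)

text \<open>Splits off the first tensor factor. Composition, identity, tensor products and pure
  tensors are all reduced to this formula by induction on the degree.\<close>

lemma tensor_act_Cons:
  assumes "a < n"
  shows "tensor_act n (Suc k) A t (a # w) =
    (\<Sum>b<n. of_int (A a b) * tensor_act n k A (\<lambda>v. t (b # v)) w)"
proof (cases "w \<in> index_words n k")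
  case True
  have "(\<Sum>v\<in>index_words n k. (\<Prod>l<Suc k. of_int (A ((a # w) ! l) ((b # v) ! l))) * t (b # v)) =
     of_int (A a b) * (\<Sum>v\<in>index_words n k. (\<Prod>l<k. of_int (A (w ! l) (v ! l))) * t (b # v))" for b
    by (simp add: prod.lessThan_Suc_shift sum_distrib_left mult.assoc del: prod.lessThan_Suc)
  then show ?thesis using assms True by (simp add: tensor_act_def sum_index_words_Suc)
qed (simp add: tensor_act_def)

lemma tensor_act_closed: "tensor_act n k A t \<in> carrier (tensor_power n k)"
  by (simp add: tensor_power_carrier tensor_act_def)

lemma tensor_act_add:
  "tensor_act n k A (\<lambda>w. s w + t w) = (\<lambda>w. tensor_act n k A s w + tensor_act n k A t w)"
  by (auto simp: tensor_act_def sum.distrib algebra_simps)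

lemma tensor_act_diff:
  "tensor_act n k A (\<lambda>w. s w - t w) = (\<lambda>w. tensor_act n k A s w - tensor_act n k A t w)"
  by (auto simp: tensor_act_def sum_subtractf algebra_simps)

lemma tensor_act_scale: "tensor_act n k A (\<lambda>w. c * t w) = (\<lambda>w. c * tensor_act n k A t w)"
  by (auto simp: tensor_act_def sum_distrib_left mult.left_commute)

lemma tensor_act_zero: "tensor_act n k A (\<lambda>w. 0) = (\<lambda>w. 0)"
  by (auto simp: tensor_act_def)

lemma tensor_act_minus: "tensor_act n k A (\<lambda>w. - t w) = (\<lambda>w. - tensor_act n k A t w)"
  using tensor_act_scale[of n k A "-1" t] by simp

lemma tensor_act_sum:
  "tensor_act n k A (\<lambda>w. \<Sum>b\<in>B. c b * t b w) w = (\<Sum>b\<in>B. c b * tensor_act n k A (t b) w)"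
  by (induction B rule: infinite_finite_induct) (simp_all add: tensor_act_zero tensor_act_add tensor_act_scale)

lemma tensor_act_of_int: "tensor_act n k A (\<lambda>w. of_int (t w)) w = of_int (tensor_act n k A t w)"
  by (simp add: tensor_act_def)

lemma tensor_act_outside: "w \<notin> index_words n k \<Longrightarrow> tensor_act n k A t w = 0"
  by (simp add: tensor_act_def)

lemma tensor_act_compose:
  "tensor_act n k A (tensor_act n k B t) w =
   tensor_act n k (\<lambda>a c. \<Sum>b<n. A a b * B b c) t w"
proof (induction k arbitrary: t w)
  case (Suc k)
  show ?case
  proof (cases "w \<in> index_words n (Suc k)")
    case True
    then obtain a v where w: "w = a # v" "a < n" by (rule index_words_SucE)
    have "tensor_act n (Suc k) A (tensor_act n (Suc k) B t) w =
       (\<Sum>b<n. of_int (A a b) * tensor_act n k A (\<lambda>u. tensor_act n (Suc k) B t (b # u)) v)"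
      by (simp add: w tensor_act_Cons)
    also have "\<dots> = (\<Sum>b<n. of_int (A a b) *
        tensor_act n k A (\<lambda>u. \<Sum>c<n. of_int (B b c) * tensor_act n k B (\<lambda>x. t (c # x)) u) v)"
      by (intro sum.cong) (simp_all add: tensor_act_Cons)
    also have "\<dots> = (\<Sum>b<n. \<Sum>c<n. of_int (A a b * B b c) *
        tensor_act n k (\<lambda>a c. \<Sum>b<n. A a b * B b c) (\<lambda>x. t (c # x)) v)"
      by (simp add: tensor_act_sum Suc sum_distrib_left mult.assoc)
    also have "\<dots> = (\<Sum>c<n. of_int (\<Sum>b<n. A a b * B b c) *
        tensor_act n k (\<lambda>a c. \<Sum>b<n. A a b * B b c) (\<lambda>x. t (c # x)) v)"
      by (subst sum.swap) (simp add: sum_distrib_right)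
    finally show ?thesis by (simp add: w tensor_act_Cons)
  qed (simp add: tensor_act_outside)
qed (simp add: tensor_act_0)

lemma tensor_act_identity:
  assumes "\<And>a b. \<lbrakk>a < n; b < n\<rbrakk> \<Longrightarrow> A a b = of_bool (a = b)" "w \<in> index_words n k"
  shows "tensor_act n k A t w = t w"
  using assms(2)
proof (induction k arbitrary: t w)
  case (Suc k)
  then obtain a v where w: "w = a # v" "a < n" "v \<in> index_words n k" by (elim index_words_SucE)
  have "tensor_act n (Suc k) A t w = (\<Sum>b<n. if b = a then t (a # v) else 0)"
    unfolding w tensor_act_Cons[OF w(2)] using w(2) Suc.IH[OF w(3)] assms(1)
    by (intro sum.cong) auto
  then show ?case using w by simp
qed (simp add: tensor_act_0 index_words_0)

lemma tensor_act_cong: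
  assumes "\<And>a b. \<lbrakk>a < n; b < n\<rbrakk> \<Longrightarrow> A a b = B a b"
  shows "tensor_act n k A t = tensor_act n k B t"
proof
  fix w
  show "tensor_act n k A t w = tensor_act n k B t w"
    unfolding tensor_act_def using assms nth_mem
    by (auto intro!: sum.cong prod.cong arg_cong2[of _ _ _ _ "(*)"] arg_cong[of _ _ of_int]
        simp: index_words_def subset_iff)
qed

lemma tensor_mult_Cons: "tensor_mult (Suc i) s t (a # w) = tensor_mult i (\<lambda>v. s (a # v)) t w"
  by (simp add: tensor_mult_def)

lemma tensor_act_tensor_mult:
  "tensor_act n (i + j) A (tensor_mult i s t) w =
   tensor_mult i (tensor_act n i A s) (tensor_act n j A t) w"
proof (induction i arbitrary: s w)
  case 0
  have "tensor_mult 0 s t = (\<lambda>w. s [] * t w)" by (simp add: tensor_mult_def fun_eq_iff)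
  then show ?case by (simp add: tensor_act_scale) (simp add: tensor_mult_def tensor_act_0)
next
  case (Suc i)
  show ?case
  proof (cases "w \<in> index_words n (Suc i + j)")
    case True
    then obtain a v where w: "w = a # v" "a < n" by (auto elim: index_words_SucE)
    have "tensor_act n (Suc i + j) A (tensor_mult (Suc i) s t) w =
        (\<Sum>b<n. of_int (A a b) * tensor_mult i (tensor_act n i A (\<lambda>v. s (b # v))) (tensor_act n j A t) v)"
      by (simp add: w tensor_act_Cons tensor_mult_Cons Suc)
    also have "\<dots> = tensor_mult (Suc i) (tensor_act n (Suc i) A s) (tensor_act n j A t) w"
      by (simp add: w tensor_mult_def tensor_act_Cons sum_distrib_right mult.assoc)
    finally show ?thesis .
  next
    case False
    then have "take (Suc i) w \<notin> index_words n (Suc i) \<or> drop (Suc i) w \<notin> index_words n j"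
      unfolding index_words_append_iff by blast
    then have "tensor_mult (Suc i) (tensor_act n (Suc i) A s) (tensor_act n j A t) w = 0"
      unfolding tensor_mult_def using tensor_act_outside by (metis mult_zero_left mult_zero_right)
    then show ?thesis by (simp only: tensor_act_outside[OF False])
  qed
qed

lemma tensor_act_pure_tensor:
  fixes v :: "nat \<Rightarrow> nat \<Rightarrow> 'r::comm_ring_1"
  shows "tensor_act n k A (pure_tensor n k v) = pure_tensor n k (\<lambda>l a. \<Sum>b<n. of_int (A a b) * v l b)"
proof
  fix w
  show "tensor_act n k A (pure_tensor n k v) w =
    pure_tensor n k (\<lambda>l a. \<Sum>b<n. of_int (A a b) * v l b) w"
  proof (induction k arbitrary: v w)
    case 0
    then show ?case by (simp add: tensor_act_0 pure_tensor_def index_words_0)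
  next
    case (Suc k)
    have shift: "pure_tensor n (Suc k) v (a # u) = v 0 a * pure_tensor n k (\<lambda>l. v (Suc l)) u"
      if "a < n" for v :: "nat \<Rightarrow> nat \<Rightarrow> 'r" and a u
      using that by (simp add: pure_tensor_def prod.lessThan_Suc_shift del: prod.lessThan_Suc)
    show ?case
    proof (cases "w \<in> index_words n (Suc k)")
      case True
      then obtain a u where w: "w = a # u" "a < n" by (rule index_words_SucE)
      have "tensor_act n (Suc k) A (pure_tensor n (Suc k) v) w =
          (\<Sum>b<n. of_int (A a b) * tensor_act n k A (\<lambda>x. v 0 b * pure_tensor n k (\<lambda>l. v (Suc l)) x) u)"
        unfolding w tensor_act_Cons[OF w(2)] by (intro sum.cong) (simp_all add: shift)
      also have "\<dots> = (\<Sum>b<n. of_int (A a b) * v 0 b) *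
          pure_tensor n k (\<lambda>l a. \<Sum>b<n. of_int (A a b) * v (Suc l) b) u"
        by (simp add: tensor_act_scale Suc sum_distrib_right mult.assoc)
      finally show ?thesis using w by (simp add: shift)
    qed (simp add: tensor_act_outside pure_tensor_def)
  qed
qed

text \<open>The operation underlying \<open>ext_act\<close>, for an arbitrary integer matrix;
  functoriality is then a statement about matrix products only.\<close>

definition ext_map :: "nat \<Rightarrow> nat \<Rightarrow> (nat \<Rightarrow> nat \<Rightarrow> int) \<Rightarrow> (nat list \<Rightarrow> rat) set \<Rightarrow> (nat list \<Rightarrow> rat) set" where
  "ext_map n k A C = (\<Union>t\<in>C. ext_proj n k (tensor_act n k A t))"

lemma ext_map_proj:
  assumes t: "t \<in> carrier (tensor_power n k)"
  shows "ext_map n k A (ext_proj n k t) = ext_proj n k (tensor_act n k A t)"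
  unfolding ext_map_def
proof (rule Union_ext_proj[OF _ _ t])
  show "tensor_act n k A \<in> hom (tensor_power n k) (tensor_power n k)"
    by (auto simp: hom_def tensor_act_closed tensor_power_mult tensor_act_add)
next
  fix c :: rat and v :: "nat \<Rightarrow> nat \<Rightarrow> rat" and i j :: nat assume ij: "i < j" "j < k" "v i = v j"
  show "tensor_act n k A (\<lambda>w. c * pure_tensor n k v w) \<in> alt_relations n k"
    unfolding tensor_act_scale tensor_act_pure_tensor using ij by (intro alt_relationI[of i j]) auto
qed

lemma ext_map_hom: "ext_map n k A \<in> hom (ext_power n k) (ext_power n k)"
proof (rule homI)
  fix C D assume "C \<in> carrier (ext_power_rat n k)" "D \<in> carrier (ext_power_rat n k)"
  then obtain s t where st: "C = ext_proj n k s" "s \<in> carrier (tensor_power n k)"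
    "D = ext_proj n k t" "t \<in> carrier (tensor_power n k)"
    by (auto simp: ext_power_carrier)
  then have "(\<lambda>w. s w + t w) \<in> carrier (tensor_power n k)" by (simp add: tensor_power_carrier)
  with st show "ext_map n k A (C \<otimes>\<^bsub>ext_power n k\<^esub> D) = ext_map n k A C \<otimes>\<^bsub>ext_power n k\<^esub> ext_map n k A D"
    by (simp add: ext_proj_mult ext_map_proj tensor_act_add tensor_act_closed)
qed (auto simp: ext_power_carrier ext_map_proj tensor_act_closed)

lemma ext_map_compose:
  assumes "C \<in> carrier (ext_power n k)"
  shows "ext_map n k A (ext_map n k B C) = ext_map n k (\<lambda>a c. \<Sum>b<n. A a b * B b c) C"
  using assms
  by (auto simp: ext_power_carrier ext_map_proj tensor_act_closed tensor_act_compose[abs_def])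

lemma ext_map_identity:
  assumes "\<And>a b. \<lbrakk>a < n; b < n\<rbrakk> \<Longrightarrow> A a b = of_bool (a = b)" "C \<in> carrier (ext_power n k)"
  shows "ext_map n k A C = C"
proof -
  obtain t where t: "C = ext_proj n k t" "t \<in> carrier (tensor_power n k)"
    using assms(2) by (auto simp: ext_power_carrier)
  have "tensor_act n k A t = t"
  proof
    fix w
    have "tensor_act n k A t w = t w" if "w \<in> index_words n k"
      using tensor_act_identity[where n = n and A = A] assms(1) that by blast
    then show "tensor_act n k A t w = t w"
      using t(2) tensor_act_outside[of w n k A t] by (cases "w \<in> index_words n k") (auto simp: tensor_power_carrier)
  qed
  then show ?thesis using t by (simp add: ext_map_proj)
qed

lemma ext_map_cong:
  assumes "\<And>a b. \<lbrakk>a < n; b < n\<rbrakk> \<Longrightarrow> A a b = B a b"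
  shows "ext_map n k A = ext_map n k B"
proof -
  have "tensor_act n k A = (tensor_act n k B :: (nat list \<Rightarrow> rat) \<Rightarrow> _)"
    using tensor_act_cong[where n = n and A = A and B = B] assms by blast
  then show ?thesis by (simp add: ext_map_def[abs_def])
qed

subsection \<open>A determinant form\<close>

text \<open>The sign of the Vandermonde product over all pairs of positions: the sign of the sorting
  permutation if the letters are distinct, and 0 if a letter repeats.\<close>

fun word_sign :: "nat list \<Rightarrow> int" where
  "word_sign [] = 1"
| "word_sign (a # w) = (\<Prod>l<length w. sgn (int (w ! l) - int a)) * word_sign w"

lemma word_sign_append1:
  "word_sign (w @ [b]) = (\<Prod>l<length w. sgn (int b - int (w ! l))) * word_sign w"
proof (induction w)
  case (Cons a w)
  have "(\<Prod>l<length w. sgn (int ((w @ [b]) ! l) - int a)) = (\<Prod>l<length w. sgn (int (w ! l) - int a))"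
    by (intro prod.cong) (auto simp: nth_append)
  then have "(\<Prod>l<length (w @ [b]). sgn (int ((w @ [b]) ! l) - int a)) =
      (\<Prod>l<length w. sgn (int (w ! l) - int a)) * sgn (int b - int a)"
    by simp
  moreover have "(\<Prod>l<length (a # w). sgn (int b - int ((a # w) ! l))) =
      sgn (int b - int a) * (\<Prod>l<length w. sgn (int b - int (w ! l)))"
    unfolding list.size(4) by (simp add: prod.lessThan_Suc_shift del: prod.lessThan_Suc)
  ultimately show ?case
    unfolding append_Cons word_sign.simps Cons by (simp only: mult.commute mult.left_commute)
qed simp

text \<open>Moving each outer letter past \<open>u\<close> costs the sign (-1)^length u, and the two
  costs cancel. The pair formed by the outer letters themselves contributes the minus sign.\<close>

lemma word_sign_antisym: "word_sign (a # u @ [b]) = - word_sign (b # u @ [a])"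
proof -
  have 1: "(\<Prod>l<length u. sgn (int ((u @ [b]) ! l) - int a)) = (\<Prod>l<length u. sgn (int (u ! l) - int a))" for a b
    by (intro prod.cong) (auto simp: nth_append)
  have 2: "(\<Prod>l<length u. sgn (int (u ! l) - int a)) = (- 1) ^ length u * (\<Prod>l<length u. sgn (int a - int (u ! l)))" for a
  proof -
    have "(\<Prod>l<length u. sgn (int (u ! l) - int a)) = (\<Prod>l<length u. (- 1) * sgn (int a - int (u ! l)))"
      by (intro prod.cong) (auto simp: sgn_if)
    then show ?thesis by (simp only: prod.distrib prod_constant card_lessThan)
  qed
  have 3: "sgn (int b - int a) = - sgn (int a - int b)" by (auto simp: sgn_if)
  show ?thesis
    unfolding word_sign.simps word_sign_append1 length_append prod.lessThan_Suc length_Cons list.size(3)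
      add_0_right add_Suc_right 1 2[of a] 2[of b] nth_append_length 3
    by (simp add: mult.commute mult.left_commute)
qed

text \<open>If one of the equal vectors is not at its end of the word, the letter at that end is
  summed last; its signs with the other letters are absorbed into the other vectors, and the two
  equal ones stay equal. This shortens the word until the equal vectors sit in first and last
  position, where exchanging the outer letters negates the sum.\<close>

lemma alternating_sum:
  fixes v :: "nat \<Rightarrow> nat \<Rightarrow> rat"
  assumes "i < j" "j < k" "v i = v j"
  shows "(\<Sum>w\<in>index_words m k. of_int (word_sign w) * (\<Prod>l<k. v l (w ! l))) = 0"
  using assms
proof (induction k arbitrary: v i j)
  case (Suc k)
  consider "i > 0" | "j < k" | k' where "i = 0" "j = k" "k = Suc k'"
  proof -
    have "i > 0 \<or> j < k \<or> (i = 0 \<and> j = k \<and> k = Suc (k - 1))" using Suc.prems by linarith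
    then show ?thesis using that by blast
  qed
  then show ?case
  proof cases
    case 1
    obtain i' j' where ij: "i = Suc i'" "j = Suc j'" using 1 Suc.prems by (metis Suc_lessE gr0_implies_Suc)
    have "(\<Sum>w\<in>index_words m k. of_int (word_sign (a # w)) * (\<Prod>l<Suc k. v l ((a # w) ! l))) =
        v 0 a * (\<Sum>w\<in>index_words m k. of_int (word_sign w) *
          (\<Prod>l<k. of_int (sgn (int (w ! l) - int a)) * v (Suc l) (w ! l)))" for a
      unfolding sum_distrib_left
      by (intro sum.cong) (simp_all add: index_words_def prod.lessThan_Suc_shift of_int_prod
          prod.distrib algebra_simps del: prod.lessThan_Suc)
    moreover have "(\<Sum>w\<in>index_words m k. of_int (word_sign w) *
          (\<Prod>l<k. of_int (sgn (int (w ! l) - int a)) * v (Suc l) (w ! l))) = 0" for a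
      using Suc.IH[of i' j' "\<lambda>l b. of_int (sgn (int b - int a)) * v (Suc l) b"] Suc.prems ij by simp
    ultimately show ?thesis by (simp only: sum_index_words_Suc) simp
  next
    case 2
    have "(\<Sum>w\<in>index_words m k. of_int (word_sign (w @ [a])) * (\<Prod>l<Suc k. v l ((w @ [a]) ! l))) =
        v k a * (\<Sum>w\<in>index_words m k. of_int (word_sign w) *
          (\<Prod>l<k. of_int (sgn (int a - int (w ! l))) * v l (w ! l)))" for a
    proof -
      have "(\<Prod>l<length w. v l ((w @ [a]) ! l)) = (\<Prod>l<length w. v l (w ! l))" for w
        by (intro prod.cong) (auto simp: nth_append)
      then show ?thesis
        unfolding sum_distrib_left
        by (intro sum.cong) (auto simp: index_words_def word_sign_append1 of_int_prod
          prod.distrib algebra_simps)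
    qed
    moreover have "(\<Sum>w\<in>index_words m k. of_int (word_sign w) *
          (\<Prod>l<k. of_int (sgn (int a - int (w ! l))) * v l (w ! l))) = 0" for a
      using Suc.IH[of i j "\<lambda>l b. of_int (sgn (int a - int b)) * v l b"] Suc.prems 2 by simp
    ultimately show ?thesis by (simp only: sum_index_words_Suc' sum.swap[of _ "{..<m}"]) simp
  next
    case 3
    define g where "g a b = (\<Sum>u\<in>index_words m k'. of_int (word_sign (a # u @ [b])) *
      (\<Prod>l<Suc k. v l ((a # u @ [b]) ! l)))" for a b
    have "g a b = - g b a" for a b
    proof -
      have p: "(\<Prod>l<Suc k. v l ((a # u @ [b]) ! l)) = v 0 a * v k b * (\<Prod>l<k'. v (Suc l) (u ! l))"
        if "u \<in> index_words m k'" for a b u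
      proof -
        have "(\<Prod>l<k'. v (Suc l) ((u @ [b]) ! l)) = (\<Prod>l<k'. v (Suc l) (u ! l))"
          using that by (intro prod.cong) (auto simp: nth_append index_words_def)
        moreover have "(u @ [b]) ! k' = b" using that by (auto simp: index_words_def)
        ultimately show ?thesis
          unfolding prod.lessThan_Suc_shift[of _ k] using 3 by simp
      qed
      show ?thesis
        unfolding g_def sum_negf[symmetric]
      proof (rule sum.cong)
        fix u assume u: "u \<in> index_words m k'"
        have "v 0 = v k" using Suc.prems 3 by simp
        then show "of_int (word_sign (a # u @ [b])) * (\<Prod>l<Suc k. v l ((a # u @ [b]) ! l)) =
            - (of_int (word_sign (b # u @ [a])) * (\<Prod>l<Suc k. v l ((b # u @ [a]) ! l)))"
          unfolding p[OF u] word_sign_antisym[of a u b] by simp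
      qed simp
    qed
    then have "(\<Sum>a<m. \<Sum>b<m. g a b) = (\<Sum>a<m. \<Sum>b<m. - g b a)" by (intro sum.cong refl)
    also have "\<dots> = - (\<Sum>a<m. \<Sum>b<m. g a b)" unfolding sum_negf by (subst sum.swap) (rule refl)
    finally have "(\<Sum>a<m. \<Sum>b<m. g a b) = 0" by simp
    moreover have "(\<Sum>w\<in>index_words m (Suc k). of_int (word_sign w) * (\<Prod>l<Suc k. v l (w ! l))) =
        (\<Sum>a<m. \<Sum>b<m. g a b)"
      unfolding 3(3) sum_index_words_Suc[of _ m "Suc k'"] sum_index_words_Suc'[of _ m k'] g_def
      by (intro sum.cong refl) (subst sum.swap, rule refl)
    ultimately show ?thesis by simp
  qed
qed simp

text \<open>For \<open>k\<close> at most \<open>n\<close> this is the coordinate at the wedge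
  product of x_0, ..., x_(k-1): among words in the first \<open>k\<close> letters only the
  permutations have nonzero sign.\<close>

definition det_form :: "nat \<Rightarrow> (nat list \<Rightarrow> rat) \<Rightarrow> rat" where
  "det_form k t = (\<Sum>w\<in>index_words k k. of_int (word_sign w) * t w)"

lemma det_form_alt_relations:
  assumes "k \<le> n" "t \<in> alt_relations n k"
  shows "det_form k t = 0"
proof -
  have sub: "index_words k k \<subseteq> index_words n k" using assms(1) by (auto simp: index_words_def)
  have "det_form k (\<lambda>w. c * pure_tensor n k v w) = 0" if "i < j" "j < k" "v i = v j" for c v i j
  proof -
    have "det_form k (\<lambda>w. c * pure_tensor n k v w) =
        c * (\<Sum>w\<in>index_words k k. of_int (word_sign w) * (\<Prod>l<k. v l (w ! l)))"
      unfolding det_form_def sum_distrib_left using sub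
      by (intro sum.cong) (auto simp: pure_tensor_def)
    then show ?thesis using alternating_sum[OF that] by simp
  qed
  then have gens: "{(\<lambda>w. c * pure_tensor n k v w) |c v. \<exists>i j. i < j \<and> j < k \<and> v i = v j}
      \<subseteq> {t \<in> carrier (tensor_power n k). det_form k t = 0}"
    by (auto simp: alt_relation_closed)
  have "subgroup {t \<in> carrier (tensor_power n k). det_form k t = 0} (tensor_power n k)"
  proof (rule T.subgroupI)
    show "{t \<in> carrier (tensor_power n k). det_form k t = 0} \<noteq> {}"
      by (auto simp: tensor_power_one det_form_def intro!: exI[of _ "\<one>\<^bsub>tensor_power n k\<^esub>"])
  next
    fix t assume t: "t \<in> {t \<in> carrier (tensor_power n k). det_form k t = 0}"
    then have "inv\<^bsub>tensor_power n k\<^esub> t = (\<lambda>w. - t w)"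
      by (intro T.inv_equality) (auto simp: tensor_power_mult tensor_power_one tensor_power_carrier)
    then show "inv\<^bsub>tensor_power n k\<^esub> t \<in> {t \<in> carrier (tensor_power n k). det_form k t = 0}"
      using t by (auto simp: tensor_power_carrier det_form_def sum_negf)
  qed (auto simp: tensor_power_mult det_form_def tensor_power_carrier ring_distribs sum.distrib)
  from T.generate_subgroup_incl[OF gens this] assms(2) show ?thesis
    by (auto simp: alt_relations_def)
qed

section \<open>Automorphisms of free nilpotent groups\<close>

text \<open>Keeps \<open>\<Gamma> n (k + 2)\<close> folded; otherwise simplification would replace
  it by the subgroup generated by commutators.\<close>

declare lower_central.simps(3) [simp del]

lemma nilp_carrier: "carrier (nilp n k) = cl n (Suc k) ` carrier (free_group n)"
  by (simp add: nilp_def carrier_FactGroup)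

lemma nilp_mult: "monoid.mult (nilp n k) = (<#>\<^bsub>free_group n\<^esub>)"
  by (simp add: nilp_def)

lemma group_nilp: "group (nilp n k)"
  by (simp add: nilp_def \<Gamma>.factorgroup_is_group)

interpretation N: group "nilp n k" for n k
  by (rule group_nilp)

lemma cl_self: "x \<in> carrier (free_group n) \<Longrightarrow> x \<in> cl n k x"
  by (rule F.rcos_self) (auto intro: \<Gamma>.subgroup_axioms)

lemma mem_cl_iff:
  "x \<in> carrier (free_group n) \<Longrightarrow> y \<in> cl n k x \<longleftrightarrow> y \<in> carrier (free_group n) \<and> cl n k y = cl n k x"
  by (metis F.is_group F.repr_independence \<Gamma>.elemrcos_carrier \<Gamma>.subgroup_axioms cl_self)

lemma cl_subset_cl: "j \<le> k \<Longrightarrow> cl n k x \<subseteq> cl n j x"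
  using F.lower_central_antimono[of j k n] by (auto simp: r_coset_def)

text \<open>Defined for all endomorphisms, since an automorphism of a nilpotent quotient need not
  come from an automorphism of the free group.\<close>

definition ind :: "nat \<Rightarrow> nat \<Rightarrow> ((nat \<times> bool) list \<Rightarrow> (nat \<times> bool) list) \<Rightarrow>
    (nat \<times> bool) list set \<Rightarrow> (nat \<times> bool) list set" where
  "ind n k \<phi> = (\<lambda>C\<in>carrier (nilp n k). \<Union>x\<in>C. cl n (Suc k) (\<phi> x))"

lemma ind_cl:
  assumes \<phi>: "\<phi> \<in> hom (free_group n) (free_group n)" and x: "x \<in> carrier (free_group n)"
  shows "ind n k \<phi> (cl n (Suc k) x) = cl n (Suc k) (\<phi> x)"
proof -
  have "cl n (Suc k) (\<phi> y) = cl n (Suc k) (\<phi> x)" if "y \<in> cl n (Suc k) x" for y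
    using endo_cl_eq[OF \<phi>, of "Suc k" y x] that x by (simp add: mem_cl_iff)
  then have "(\<Union>y\<in>cl n (Suc k) x. cl n (Suc k) (\<phi> y)) = (\<Union>y\<in>cl n (Suc k) x. cl n (Suc k) (\<phi> x))"
    by (intro SUP_cong refl)
  also have "\<dots> = cl n (Suc k) (\<phi> x)" using cl_self[OF x] by blast
  finally show ?thesis using x by (simp add: ind_def nilp_carrier)
qed

lemma ind_hom:
  assumes \<phi>: "\<phi> \<in> hom (free_group n) (free_group n)"
  shows "ind n k \<phi> \<in> hom (nilp n k) (nilp n k)"
proof (rule homI)
  fix C D assume "C \<in> carrier (nilp n k)" "D \<in> carrier (nilp n k)"
  then obtain x y where "C = cl n (Suc k) x" "x \<in> carrier (free_group n)"
    "D = cl n (Suc k) y" "y \<in> carrier (free_group n)" by (auto simp: nilp_carrier)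
  then show "ind n k \<phi> (C \<otimes>\<^bsub>nilp n k\<^esub> D) = ind n k \<phi> C \<otimes>\<^bsub>nilp n k\<^esub> ind n k \<phi> D"
    using \<phi> by (simp add: nilp_mult cl_mult ind_cl hom_mult[OF \<phi>])
qed (use \<phi> in \<open>auto simp: nilp_carrier ind_cl\<close>)

lemma ind_extensional: "ind n k \<phi> \<in> extensional (carrier (nilp n k))"
  by (simp add: ind_def)

lemma nilp_ext:
  assumes "\<alpha> \<in> extensional (carrier (nilp n k))" "\<beta> \<in> extensional (carrier (nilp n k))"
    and "\<And>x. x \<in> carrier (free_group n) \<Longrightarrow> \<alpha> (cl n (Suc k) x) = \<beta> (cl n (Suc k) x)"
  shows "\<alpha> = \<beta>"
proof (rule extensionalityI[OF assms(1,2)])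
  fix C assume "C \<in> carrier (nilp n k)"
  then show "\<alpha> C = \<beta> C" using assms(3) by (auto simp: nilp_carrier)
qed

lemma endo_compose:
  "\<lbrakk>\<phi> \<in> hom (free_group n) (free_group n); \<psi> \<in> hom (free_group n) (free_group n)\<rbrakk> \<Longrightarrow>
    \<phi> \<circ> \<psi> \<in> hom (free_group n) (free_group n)"
  using hom_compose[of \<psi> "free_group n" "free_group n" \<phi>] by blast

lemma endo_id: "(\<lambda>x. x) \<in> hom (free_group n) (free_group n)"
  by (rule homI) simp_all

lemma ind_compose:
  assumes "\<phi> \<in> hom (free_group n) (free_group n)" "\<psi> \<in> hom (free_group n) (free_group n)"
  shows "compose (carrier (nilp n k)) (ind n k \<phi>) (ind n k \<psi>) = ind n k (\<phi> \<circ> \<psi>)"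
  by (rule nilp_ext[of _ n k])
    (simp_all add: ind_extensional, simp add: compose_eq nilp_carrier ind_cl assms endo_compose)

lemma ind_eqI:
  assumes "\<phi> \<in> hom (free_group n) (free_group n)" "\<psi> \<in> hom (free_group n) (free_group n)"
    and "\<And>x. x \<in> carrier (free_group n) \<Longrightarrow> cl n (Suc k) (\<phi> x) = cl n (Suc k) (\<psi> x)"
  shows "ind n k \<phi> = ind n k \<psi>"
  by (rule nilp_ext[of _ n k]) (simp_all add: ind_cl assms ind_extensional)

lemma cl_comp_hom:
  assumes "\<phi> \<in> hom (free_group n) (free_group n)"
  shows "(\<lambda>x. cl n (Suc k) (\<phi> x)) \<in> hom (free_group n) (nilp n k)"
  by (rule homI) (auto simp: assms nilp_carrier nilp_mult cl_mult hom_mult[OF assms])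

lemma cl_eq_on_generators:
  assumes "\<phi> \<in> hom (free_group n) (free_group n)" "\<psi> \<in> hom (free_group n) (free_group n)"
    and "\<And>i. i < n \<Longrightarrow> cl n (Suc k) (\<phi> (gen i)) = cl n (Suc k) (\<psi> (gen i))" "x \<in> carrier (free_group n)"
  shows "cl n (Suc k) (\<phi> x) = cl n (Suc k) (\<psi> x)"
  using free_group_hom_eq[OF group_nilp cl_comp_hom[OF assms(1)] cl_comp_hom[OF assms(2)] assms(3,4)] .

lemma cl_conj:
  assumes "g \<in> carrier (free_group n)" "x \<in> carrier (free_group n)"
  shows "cl n 2 (g \<otimes>\<^bsub>free_group n\<^esub> x \<otimes>\<^bsub>free_group n\<^esub> inv\<^bsub>free_group n\<^esub> g) = cl n 2 x"
proof -
  have "commutator (free_group n) g x \<in> \<Gamma> n 2"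
    using F.commutator_in_lower_central[of g n 1 x] assms by (simp add: numeral_2_eq_2)
  moreover have "g \<otimes>\<^bsub>free_group n\<^esub> x \<otimes>\<^bsub>free_group n\<^esub> inv\<^bsub>free_group n\<^esub> g = commutator (free_group n) g x \<otimes>\<^bsub>free_group n\<^esub> x"
    using assms by (simp add: commutator_def F.m_assoc)
  ultimately show ?thesis using assms(2) by (simp only: cl_cancel)
qed

text \<open>Representatives of the images of the generators define \<open>\<phi>\<close> by
  freeness, and two homomorphisms from the free group to the quotient that agree on generators are
  equal.\<close>

lemma nilp_hom_lift:
  assumes \<alpha>: "\<alpha> \<in> hom (nilp n k) (nilp n k)" "\<alpha> \<in> extensional (carrier (nilp n k))"
  obtains \<phi> where "\<phi> \<in> hom (free_group n) (free_group n)" "\<alpha> = ind n k \<phi>"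
proof -
  have "\<exists>y\<in>carrier (free_group n). \<alpha> (cl n (Suc k) (gen i)) = cl n (Suc k) y" if "i < n" for i
    using hom_in_carrier[OF \<alpha>(1), of "cl n (Suc k) (gen i)"] that by (auto simp: nilp_carrier)
  then obtain g where g: "\<And>i. i < n \<Longrightarrow> g i \<in> carrier (free_group n)"
    "\<And>i. i < n \<Longrightarrow> \<alpha> (cl n (Suc k) (gen i)) = cl n (Suc k) (g i)" by metis
  obtain \<phi> where \<phi>: "\<phi> \<in> hom (free_group n) (free_group n)" "\<And>i. i < n \<Longrightarrow> \<phi> (gen i) = g i"
    using exists_endo[of n g] g(1) by blast
  have "(\<lambda>x. \<alpha> (cl n (Suc k) x)) \<in> hom (free_group n) (nilp n k)"
    using hom_compose[OF cl_comp_hom[OF endo_id] \<alpha>(1)] by (simp add: comp_def)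
  then have "\<alpha> (cl n (Suc k) x) = cl n (Suc k) (\<phi> x)" if "x \<in> carrier (free_group n)" for x
    by (rule free_group_hom_eq[OF group_nilp _ cl_comp_hom[OF \<phi>(1)] _ that]) (simp add: \<phi>(2) g(2))
  then have "\<alpha> = ind n k \<phi>"
    by (intro nilp_ext[of _ n k]) (simp_all add: \<alpha>(2) ind_extensional ind_cl \<phi>(1))
  then show ?thesis using that \<phi>(1) by blast
qed

section \<open>Automorphisms of nilpotent quotients represented by endomorphisms of the free
  group\<close>

lemma Aut_iff: "\<alpha> \<in> carrier (AutoGroup G) \<longleftrightarrow>
    \<alpha> \<in> hom G G \<and> \<alpha> \<in> extensional (carrier G) \<and> bij_betw \<alpha> (carrier G) (carrier G)"
  by (auto simp: AutoGroup_def auto_def Bij_def)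

lemma Aut_mult: "\<lbrakk>\<alpha> \<in> carrier (AutoGroup G); \<beta> \<in> carrier (AutoGroup G)\<rbrakk> \<Longrightarrow>
    \<alpha> \<otimes>\<^bsub>AutoGroup G\<^esub> \<beta> = compose (carrier G) \<alpha> \<beta>"
  by (simp add: AutoGroup_def auto_def BijGroup_def)

lemma Aut_one: "\<one>\<^bsub>AutoGroup G\<^esub> = (\<lambda>x\<in>carrier G. x)"
  by (simp add: AutoGroup_def BijGroup_def)

text \<open>\<open>\<psi>\<close> inverts \<open>\<phi>\<close> only modulo \<Gamma>(k+1). Carrying
  it along gives invertibility at every smaller class at once and supplies preimages when unions of
  cosets are computed.\<close>

definition lifts :: "nat \<Rightarrow> nat \<Rightarrow> ((nat \<times> bool) list set \<Rightarrow> (nat \<times> bool) list set) \<Rightarrow>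
    ((nat \<times> bool) list \<Rightarrow> (nat \<times> bool) list) \<Rightarrow> ((nat \<times> bool) list \<Rightarrow> (nat \<times> bool) list) \<Rightarrow> bool" where
  "lifts n k \<alpha> \<phi> \<psi> \<longleftrightarrow> \<phi> \<in> hom (free_group n) (free_group n) \<and> \<psi> \<in> hom (free_group n) (free_group n) \<and>
     \<alpha> = ind n k \<phi> \<and>
     (\<forall>x\<in>carrier (free_group n). cl n (Suc k) (\<phi> (\<psi> x)) = cl n (Suc k) x \<and>
                                cl n (Suc k) (\<psi> (\<phi> x)) = cl n (Suc k) x)"

text \<open>The composites are assumed bijective rather than trivial: in \<open>ind_Aut_Suc\<close>
  they are the identity only up to a central factor.\<close>

lemma bij_betw_nilpI:
  assumes \<phi>: "\<phi> \<in> hom (free_group n) (free_group n)" and \<psi>: "\<psi> \<in> hom (free_group n) (free_group n)"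
    and "bij_betw (ind n k (\<phi> \<circ> \<psi>)) (carrier (nilp n k)) (carrier (nilp n k))"
    and "bij_betw (ind n k (\<psi> \<circ> \<phi>)) (carrier (nilp n k)) (carrier (nilp n k))"
  shows "bij_betw (ind n k \<phi>) (carrier (nilp n k)) (carrier (nilp n k))"
proof -
  let ?C = "carrier (nilp n k)"
  have cl: "ind n k \<phi> ` ?C \<subseteq> ?C" "ind n k \<psi> ` ?C \<subseteq> ?C"
    using hom_in_carrier[OF ind_hom[OF \<phi>]] hom_in_carrier[OF ind_hom[OF \<psi>]] by blast+
  have "inj_on (ind n k \<phi>) ?C"
  proof (rule inj_onI)
    fix C D assume CD: "C \<in> ?C" "D \<in> ?C" "ind n k \<phi> C = ind n k \<phi> D"
    then have "ind n k (\<psi> \<circ> \<phi>) C = ind n k (\<psi> \<circ> \<phi>) D"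
      unfolding ind_compose[OF \<psi> \<phi>, symmetric] by (simp add: compose_eq)
    then show "C = D" using assms(4) CD by (auto simp: bij_betw_def inj_on_def)
  qed
  moreover have "?C \<subseteq> ind n k \<phi> ` ?C"
  proof
    fix C assume "C \<in> ?C"
    then obtain D where "D \<in> ?C" "C = ind n k (\<phi> \<circ> \<psi>) D" using assms(3) by (auto simp: bij_betw_def)
    then show "C \<in> ind n k \<phi> ` ?C"
      unfolding ind_compose[OF \<phi> \<psi>, symmetric] using cl(2) by (auto simp: compose_eq)
  qed
  ultimately show ?thesis using cl by (auto simp: bij_betw_def)
qed

lemma ind_identity:
  assumes "\<phi> \<in> hom (free_group n) (free_group n)"
    and "\<And>x. x \<in> carrier (free_group n) \<Longrightarrow> cl n (Suc k) (\<phi> x) = cl n (Suc k) x"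
  shows "ind n k \<phi> = \<one>\<^bsub>AutoGroup (nilp n k)\<^esub>"
  unfolding Aut_one
  by (rule nilp_ext[of _ n k]) (simp_all add: ind_extensional, simp add: ind_cl assms nilp_carrier)

lemma lifts_Aut:
  assumes "lifts n k \<alpha> \<phi> \<psi>"
  shows "\<alpha> \<in> carrier (AutoGroup (nilp n k))"
proof -
  have *: "\<phi> \<in> hom (free_group n) (free_group n)" "\<psi> \<in> hom (free_group n) (free_group n)" "\<alpha> = ind n k \<phi>"
    using assms by (auto simp: lifts_def)
  have "ind n k (\<phi> \<circ> \<psi>) = \<one>\<^bsub>AutoGroup (nilp n k)\<^esub>" "ind n k (\<psi> \<circ> \<phi>) = \<one>\<^bsub>AutoGroup (nilp n k)\<^esub>"
    using assms by (auto intro!: ind_identity simp: endo_compose lifts_def)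
  then have "bij_betw (ind n k \<phi>) (carrier (nilp n k)) (carrier (nilp n k))"
    using N.AutoGroup[of n k] by (intro bij_betw_nilpI[OF *(1,2)]) (auto simp: Aut_one bij_betw_def inj_on_def)
  then show ?thesis using * by (simp add: Aut_iff ind_hom ind_extensional)
qed

lemma Aut_lifts:
  assumes "\<alpha> \<in> carrier (AutoGroup (nilp n k))"
  obtains \<phi> \<psi> where "lifts n k \<alpha> \<phi> \<psi>"
proof -
  interpret A: group "AutoGroup (nilp n k)" by (rule N.AutoGroup)
  let ?\<beta> = "inv\<^bsub>AutoGroup (nilp n k)\<^esub> \<alpha>"
  have \<beta>: "?\<beta> \<in> carrier (AutoGroup (nilp n k))" using assms by simp
  obtain \<phi> where \<phi>: "\<phi> \<in> hom (free_group n) (free_group n)" "\<alpha> = ind n k \<phi>"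
    using nilp_hom_lift assms by (metis Aut_iff)
  obtain \<psi> where \<psi>: "\<psi> \<in> hom (free_group n) (free_group n)" "?\<beta> = ind n k \<psi>"
    using nilp_hom_lift \<beta> by (metis Aut_iff)
  have id: "ind n k (\<phi> \<circ> \<psi>) = \<one>\<^bsub>AutoGroup (nilp n k)\<^esub>" "ind n k (\<psi> \<circ> \<phi>) = \<one>\<^bsub>AutoGroup (nilp n k)\<^esub>"
    using A.r_inv[OF assms] A.l_inv[OF assms] \<phi> \<psi> Aut_mult[OF assms \<beta>] Aut_mult[OF \<beta> assms]
    by (simp_all add: ind_compose)
  have "cl n (Suc k) (\<phi> (\<psi> x)) = cl n (Suc k) x" "cl n (Suc k) (\<psi> (\<phi> x)) = cl n (Suc k) x"
    if "x \<in> carrier (free_group n)" for x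
  proof -
    have "cl n (Suc k) x \<in> carrier (nilp n k)" using that by (simp add: nilp_carrier)
    then have "cl n (Suc k) x = ind n k (\<phi> \<circ> \<psi>) (cl n (Suc k) x)" "cl n (Suc k) x = ind n k (\<psi> \<circ> \<phi>) (cl n (Suc k) x)"
      unfolding id Aut_one by simp_all
    then show "cl n (Suc k) (\<phi> (\<psi> x)) = cl n (Suc k) x" "cl n (Suc k) (\<psi> (\<phi> x)) = cl n (Suc k) x"
      using ind_cl[OF endo_compose[OF \<phi>(1) \<psi>(1)] that, of k] ind_cl[OF endo_compose[OF \<psi>(1) \<phi>(1)] that, of k]
      by (simp_all only: comp_apply)
  qed
  then show ?thesis using \<phi> \<psi> by (intro that[of \<phi> \<psi>]) (simp add: lifts_def)
qed

lemma lifts_mult: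
  assumes l: "lifts n k \<alpha> \<phi> \<psi>" and l': "lifts n k \<beta> \<phi>' \<psi>'"
  shows "lifts n k (\<alpha> \<otimes>\<^bsub>AutoGroup (nilp n k)\<^esub> \<beta>) (\<phi> \<circ> \<phi>') (\<psi>' \<circ> \<psi>)"
proof -
  have h: "\<phi> \<in> hom (free_group n) (free_group n)" "\<psi> \<in> hom (free_group n) (free_group n)"
    "\<phi>' \<in> hom (free_group n) (free_group n)" "\<psi>' \<in> hom (free_group n) (free_group n)"
    and e: "\<alpha> = ind n k \<phi>" "\<beta> = ind n k \<phi>'"
    using l l' by (auto simp: lifts_def)
  have "cl n (Suc k) (\<phi> (\<phi>' (\<psi>' (\<psi> x)))) = cl n (Suc k) x"
    "cl n (Suc k) (\<psi>' (\<psi> (\<phi> (\<phi>' x)))) = cl n (Suc k) x" if x: "x \<in> carrier (free_group n)" for x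
  proof -
    have "cl n (Suc k) (\<phi> (\<phi>' (\<psi>' (\<psi> x)))) = cl n (Suc k) (\<phi> (\<psi> x))"
      using l' x by (intro endo_cl_eq[OF h(1)]) (auto simp: h(1-4) lifts_def)
    then show "cl n (Suc k) (\<phi> (\<phi>' (\<psi>' (\<psi> x)))) = cl n (Suc k) x"
      using l x by (simp add: lifts_def)
    have "cl n (Suc k) (\<psi>' (\<psi> (\<phi> (\<phi>' x)))) = cl n (Suc k) (\<psi>' (\<phi>' x))"
      using l x by (intro endo_cl_eq[OF h(4)]) (auto simp: h(1-4) lifts_def)
    then show "cl n (Suc k) (\<psi>' (\<psi> (\<phi> (\<phi>' x)))) = cl n (Suc k) x"
      using l' x by (simp add: lifts_def)
  qed
  moreover have "\<alpha> \<otimes>\<^bsub>AutoGroup (nilp n k)\<^esub> \<beta> = ind n k (\<phi> \<circ> \<phi>')"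
    using lifts_Aut[OF l] lifts_Aut[OF l'] by (simp add: Aut_mult e ind_compose h)
  ultimately show ?thesis by (simp add: lifts_def endo_compose h)
qed

lemma lifts_descend:
  assumes l: "lifts n k \<alpha> \<phi> \<psi>" and jk: "j \<le> k"
  shows "lifts n j (aut_descend n k j \<alpha>) \<phi> \<psi>"
proof -
  have h: "\<phi> \<in> hom (free_group n) (free_group n)" "\<psi> \<in> hom (free_group n) (free_group n)"
    "\<alpha> = ind n k \<phi>" using l by (auto simp: lifts_def)
  have inv: "cl n (Suc j) (\<phi> (\<psi> x)) = cl n (Suc j) x" "cl n (Suc j) (\<psi> (\<phi> x)) = cl n (Suc j) x"
    if "x \<in> carrier (free_group n)" for x
    using l that jk cl_eq_mono[of n "Suc k" "\<phi> (\<psi> x)" x "Suc j"] cl_eq_mono[of n "Suc k" "\<psi> (\<phi> x)" x "Suc j"]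
    by (auto simp: lifts_def)
  have "aut_descend n k j \<alpha> (cl n (Suc j) x) = cl n (Suc j) (\<phi> x)" if x: "x \<in> carrier (free_group n)" for x
  proof -
    have "(\<Union>D\<in>{D \<in> carrier (nilp n k). D \<subseteq> cl n (Suc j) x}. \<alpha> D) = cl n (Suc j) (\<phi> x)" (is "?U = _")
    proof
      show "?U \<subseteq> cl n (Suc j) (\<phi> x)"
      proof
        fix z assume "z \<in> ?U"
        then obtain y where y: "y \<in> carrier (free_group n)" "cl n (Suc k) y \<subseteq> cl n (Suc j) x"
          "z \<in> cl n (Suc k) (\<phi> y)" by (auto simp: nilp_carrier h ind_cl)
        have "cl n (Suc j) y = cl n (Suc j) x"
          using y(2) cl_self[OF y(1), of "Suc k"] x by (auto simp: mem_cl_iff)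
        then have "cl n (Suc j) (\<phi> y) = cl n (Suc j) (\<phi> x)" using endo_cl_eq[OF h(1)] x y(1) by blast
        then show "z \<in> cl n (Suc j) (\<phi> x)"
          using y(3) cl_subset_cl[of "Suc j" "Suc k" n "\<phi> y"] jk by auto
      qed
      show "cl n (Suc j) (\<phi> x) \<subseteq> ?U"
      proof
        fix z assume "z \<in> cl n (Suc j) (\<phi> x)"
        then have z: "z \<in> carrier (free_group n)" "cl n (Suc j) z = cl n (Suc j) (\<phi> x)"
          using x h by (auto simp: mem_cl_iff)
        \<comment> \<open>The small coset of \<open>\<psi> z\<close> is the one that
          \<open>\<alpha>\<close> sends to the coset of \<open>z\<close>; it lies in the big coset
          of \<open>x\<close> because \<open>\<psi>\<close> inverts \<open>\<phi>\<close>
          there.\<close>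
        have "cl n (Suc j) (\<psi> z) = cl n (Suc j) (\<psi> (\<phi> x))"
          using z x h(1,2) by (intro endo_cl_eq[OF h(2)]) auto
        then have "cl n (Suc j) (\<psi> z) = cl n (Suc j) x" using inv(2)[OF x] by simp
        then have "cl n (Suc k) (\<psi> z) \<subseteq> cl n (Suc j) x"
          using cl_subset_cl[of "Suc j" "Suc k" n "\<psi> z"] jk by simp
        moreover have "z \<in> \<alpha> (cl n (Suc k) (\<psi> z))"
          using l z cl_self[OF z(1), of "Suc k"] by (simp add: h ind_cl lifts_def)
        moreover have "cl n (Suc k) (\<psi> z) \<in> carrier (nilp n k)"
          using z h by (simp add: nilp_carrier)
        ultimately show "z \<in> ?U" by blast
      qed
    qed
    then show ?thesis using x by (simp add: aut_descend_def nilp_carrier)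
  qed
  then have "aut_descend n k j \<alpha> = ind n j \<phi>"
    by (intro nilp_ext[of _ n j]) (auto simp: aut_descend_def ind_extensional ind_cl h)
  then show ?thesis using h inv by (simp add: lifts_def)
qed

lemma aut_descend_hom:
  assumes "j \<le> k"
  shows "aut_descend n k j \<in> hom (AutoGroup (nilp n k)) (AutoGroup (nilp n j))"
proof (rule homI)
  fix \<alpha> assume \<alpha>: "\<alpha> \<in> carrier (AutoGroup (nilp n k))"
  then obtain \<phi> \<psi> where l: "lifts n k \<alpha> \<phi> \<psi>" by (rule Aut_lifts)
  then show "aut_descend n k j \<alpha> \<in> carrier (AutoGroup (nilp n j))"
    using assms by (intro lifts_Aut lifts_descend)
  fix \<beta> assume \<beta>: "\<beta> \<in> carrier (AutoGroup (nilp n k))"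
  then obtain \<phi>' \<psi>' where l': "lifts n k \<beta> \<phi>' \<psi>'" by (rule Aut_lifts)
  show "aut_descend n k j (\<alpha> \<otimes>\<^bsub>AutoGroup (nilp n k)\<^esub> \<beta>) =
      aut_descend n k j \<alpha> \<otimes>\<^bsub>AutoGroup (nilp n j)\<^esub> aut_descend n k j \<beta>"
    using lifts_descend[OF lifts_mult[OF l l'] assms]
      lifts_mult[OF lifts_descend[OF l assms] lifts_descend[OF l' assms]]
    by (simp add: lifts_def)
qed

section \<open>The extension with kernel \<open>Hom(H, L(k+1))\<close>\<close>

lemma hom_group_mult:
  "f \<otimes>\<^bsub>hom_group A B\<^esub> g = (\<lambda>x\<in>carrier A. f x \<otimes>\<^bsub>B\<^esub> g x)"
  by (simp add: hom_group_def)

lemma hom_group_carrier: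
  "f \<in> carrier (hom_group A B) \<longleftrightarrow> f \<in> hom A B \<and> f \<in> extensional (carrier A)"
  by (simp add: hom_group_def)

lemma hom_group_one: "\<one>\<^bsub>hom_group A B\<^esub> = (\<lambda>x\<in>carrier A. \<one>\<^bsub>B\<^esub>)"
  by (simp add: hom_group_def)

lemma group_hom_group:
  assumes "group A" "comm_group B"
  shows "group (hom_group A B)"
proof (rule groupI)
  interpret A: group A by fact
  interpret B: comm_group B by fact
  fix f g h assume f: "f \<in> carrier (hom_group A B)"
  then have fh: "f \<in> hom A B" "f \<in> extensional (carrier A)" by (auto simp: hom_group_carrier)
  have f_closed: "f x \<in> carrier B" if "x \<in> carrier A" for x using hom_in_carrier[OF fh(1) that] .
  show "f \<otimes>\<^bsub>hom_group A B\<^esub> g \<in> carrier (hom_group A B)" if "g \<in> carrier (hom_group A B)"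
    using f that by (auto simp: hom_group_carrier hom_group_mult hom_def Pi_iff B.m_ac)
  show "f \<otimes>\<^bsub>hom_group A B\<^esub> g \<otimes>\<^bsub>hom_group A B\<^esub> h =
      f \<otimes>\<^bsub>hom_group A B\<^esub> (g \<otimes>\<^bsub>hom_group A B\<^esub> h)"
    if "g \<in> carrier (hom_group A B)" "h \<in> carrier (hom_group A B)"
    using f that by (auto simp: hom_group_carrier hom_group_mult hom_def Pi_iff B.m_assoc intro!: restrict_ext)
  show "\<one>\<^bsub>hom_group A B\<^esub> \<otimes>\<^bsub>hom_group A B\<^esub> f = f"
    using fh(2) f_closed
    by (auto simp: hom_group_mult hom_group_one fun_eq_iff extensional_def)
  show "\<exists>g\<in>carrier (hom_group A B). g \<otimes>\<^bsub>hom_group A B\<^esub> f = \<one>\<^bsub>hom_group A B\<^esub>"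
  proof (rule bexI[of _ "\<lambda>x\<in>carrier A. inv\<^bsub>B\<^esub> (f x)"])
    show "(\<lambda>x\<in>carrier A. inv\<^bsub>B\<^esub> f x) \<in> carrier (hom_group A B)"
      using f_closed by (auto simp: hom_group_carrier hom_def hom_mult[OF fh(1)] B.inv_mult)
  qed (auto simp: hom_group_mult hom_group_one f_closed intro!: restrict_ext)
next
  interpret B: comm_group B by fact
  show "\<one>\<^bsub>hom_group A B\<^esub> \<in> carrier (hom_group A B)"
    by (auto simp: hom_group_carrier hom_group_one hom_def)
      (simp_all add: assms(1) group.is_monoid monoid.m_closed)
qed

lemma group_abelianization: "group (abelianization n)"
  by (simp add: abelianization_def \<Gamma>.factorgroup_is_group)

lemma abelianization_carrier: "carrier (abelianization n) = cl n 2 ` carrier (free_group n)"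
  by (simp add: abelianization_def carrier_FactGroup)

lemma abelianization_mult: "monoid.mult (abelianization n) = (<#>\<^bsub>free_group n\<^esub>)"
  by (simp add: abelianization_def)

lemma comm_group_lie:
  assumes "1 \<le> k"
  shows "comm_group (lie n k)"
proof (rule group.group_comm_groupI)
  have "\<Gamma> n (Suc k) \<lhd> (free_group n)\<lparr>carrier := \<Gamma> n k\<rparr>"
    by (intro F.normal_restrict_supergroup \<Gamma>.subgroup_axioms F.lower_central_normal F.lower_central_Suc_subset)
  then show "group (lie n k)" by (simp add: lie_def normal.factorgroup_is_group)
next
  fix C D assume "C \<in> carrier (lie n k)" "D \<in> carrier (lie n k)"
  then show "C \<otimes>\<^bsub>lie n k\<^esub> D = D \<otimes>\<^bsub>lie n k\<^esub> C"
    using assms F.lower_central_closed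
    by (auto simp: lie_carrier lie_mult cl_mult cl_commute)
qed

lemma cl_trans:
  assumes "j \<le> k" "x \<in> carrier (free_group n)"
  shows "\<Gamma> n j <#>\<^bsub>free_group n\<^esub> cl n k x = cl n j x"
proof -
  have sub: "\<Gamma> n k \<subseteq> \<Gamma> n j" using assms(1) by (rule F.lower_central_antimono)
  have "\<Gamma> n j <#>\<^bsub>free_group n\<^esub> \<Gamma> n k = \<Gamma> n j"
  proof
    show "\<Gamma> n j <#>\<^bsub>free_group n\<^esub> \<Gamma> n k \<subseteq> \<Gamma> n j" using sub by (auto simp: set_mult_def)
    have "x \<in> \<Gamma> n j <#>\<^bsub>free_group n\<^esub> \<Gamma> n k" if "x \<in> \<Gamma> n j" for x
    proof -
      have "x \<otimes>\<^bsub>free_group n\<^esub> \<one>\<^bsub>free_group n\<^esub> \<in> \<Gamma> n j <#>\<^bsub>free_group n\<^esub> \<Gamma> n k"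
        unfolding set_mult_def by (rule UN_I[OF that], rule UN_I[of "\<one>\<^bsub>free_group n\<^esub>"]) simp_all
      then show ?thesis using F.lower_central_closed[OF that] by simp
    qed
    then show "\<Gamma> n j \<subseteq> \<Gamma> n j <#>\<^bsub>free_group n\<^esub> \<Gamma> n k" by blast
  qed
  then show ?thesis
    using F.setmult_rcos_assoc[of "\<Gamma> n j" n "\<Gamma> n k" x] assms(2) \<Gamma>.subset by simp
qed

lemma hom_incl_cl:
  assumes "x \<in> carrier (free_group n)"
  shows "hom_incl n k f (cl n (k + 2) x) = f (cl n 2 x) <#>\<^bsub>free_group n\<^esub> cl n (k + 2) x"
  using assms by (auto simp: hom_incl_def nilp_carrier nilp_mult cl_trans)

lemma hom_incl_cl_eq:
  assumes "x \<in> carrier (free_group n)" "f (cl n 2 x) = cl n (k + 2) y" "y \<in> \<Gamma> n (k + 1)"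
  shows "hom_incl n k f (cl n (k + 2) x) = cl n (k + 2) (y \<otimes>\<^bsub>free_group n\<^esub> x)"
  using assms F.lower_central_closed[OF assms(3)] by (simp only: hom_incl_cl cl_mult)

abbreviation johnson_target :: "nat \<Rightarrow> nat \<Rightarrow> ((nat \<times> bool) list set \<Rightarrow> (nat \<times> bool) list set) monoid" where
  "johnson_target n k \<equiv> hom_group (abelianization n) (lie n (k + 1))"

lemma johnson_target_rep:
  assumes f: "f \<in> carrier (johnson_target n k)" and x: "x \<in> carrier (free_group n)"
  obtains y where "y \<in> \<Gamma> n (k + 1)" "f (cl n 2 x) = cl n (k + 2) y"
proof -
  have "f (cl n 2 x) \<in> carrier (lie n (k + 1))"
    using f x by (auto simp: hom_group_carrier hom_def abelianization_carrier)
  then show ?thesis using that by (auto simp: lie_carrier)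
qed

lemma johnson_target_mult:
  assumes f: "f \<in> carrier (johnson_target n k)" and x: "x \<in> carrier (free_group n)" "z \<in> carrier (free_group n)"
  shows "f (cl n 2 (x \<otimes>\<^bsub>free_group n\<^esub> z)) = f (cl n 2 x) <#>\<^bsub>free_group n\<^esub> f (cl n 2 z)"
proof -
  have "f \<in> hom (abelianization n) (lie n (k + 1))" using f by (simp add: hom_group_carrier)
  from hom_mult[OF this, of "cl n 2 x" "cl n 2 z"] show ?thesis
    using x by (simp add: abelianization_carrier abelianization_mult lie_mult cl_mult)
qed

lemma group_johnson_target: "group (johnson_target n k)"
  by (intro group_hom_group group_abelianization comm_group_lie) simp

lemma johnson_target_ext:
  assumes "f \<in> carrier (johnson_target n k)" "g \<in> carrier (johnson_target n k)"
    and "\<And>x. x \<in> carrier (free_group n) \<Longrightarrow> f (cl n 2 x) = g (cl n 2 x)"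
  shows "f = g"
proof (rule extensionalityI)
  show "f \<in> extensional (carrier (abelianization n))" "g \<in> extensional (carrier (abelianization n))"
    using assms(1,2) by (simp_all add: hom_group_carrier)
  fix C assume "C \<in> carrier (abelianization n)"
  then show "f C = g C" using assms(3) by (auto simp: abelianization_carrier)
qed

text \<open>\<Gamma>(k+1)/\<Gamma>(k+2) is central, so \<open>y'\<close> may pass \<open>x\<close>.
  This is what makes the map x \<mapsto> f([x]) x multiplicative.\<close>

lemma central_cl_mult:
  assumes "y \<in> \<Gamma> n (k + 1)" "y' \<in> \<Gamma> n (k + 1)" "x \<in> carrier (free_group n)" "z \<in> carrier (free_group n)"
  shows "cl n (k + 2) ((y \<otimes>\<^bsub>free_group n\<^esub> y') \<otimes>\<^bsub>free_group n\<^esub> (x \<otimes>\<^bsub>free_group n\<^esub> z)) = cl n (k + 2) ((y \<otimes>\<^bsub>free_group n\<^esub> x) \<otimes>\<^bsub>free_group n\<^esub> (y' \<otimes>\<^bsub>free_group n\<^esub> z))"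
proof -
  have car: "y \<in> carrier (free_group n)" "y' \<in> carrier (free_group n)"
    using assms F.lower_central_closed by blast+
  have "cl n (Suc (k + 1)) (y' \<otimes>\<^bsub>free_group n\<^esub> x) = cl n (Suc (k + 1)) (x \<otimes>\<^bsub>free_group n\<^esub> y')"
    using assms by (intro cl_commute) auto
  then have sw: "cl n (k + 2) (y' \<otimes>\<^bsub>free_group n\<^esub> x) = cl n (k + 2) (x \<otimes>\<^bsub>free_group n\<^esub> y')" by simp
  have "cl n (k + 2) ((y \<otimes>\<^bsub>free_group n\<^esub> y') \<otimes>\<^bsub>free_group n\<^esub> (x \<otimes>\<^bsub>free_group n\<^esub> z)) = cl n (k + 2) y <#>\<^bsub>free_group n\<^esub> (cl n (k + 2) (y' \<otimes>\<^bsub>free_group n\<^esub> x) <#>\<^bsub>free_group n\<^esub> cl n (k + 2) z)"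
    using car assms(3,4) by (simp add: cl_mult F.m_assoc)
  also have "\<dots> = cl n (k + 2) ((y \<otimes>\<^bsub>free_group n\<^esub> x) \<otimes>\<^bsub>free_group n\<^esub> (y' \<otimes>\<^bsub>free_group n\<^esub> z))"
    unfolding sw using car assms(3,4) by (simp add: cl_mult F.m_assoc)
  finally show ?thesis .
qed

lemma hom_incl_hom:
  assumes f: "f \<in> carrier (johnson_target n k)"
  shows "hom_incl n k f \<in> hom (nilp n (k + 1)) (nilp n (k + 1))"
proof (rule homI)
  fix C D assume "C \<in> carrier (nilp n (k + 1))" "D \<in> carrier (nilp n (k + 1))"
  then obtain x z where x: "C = cl n (k + 2) x" "x \<in> carrier (free_group n)"
    and z: "D = cl n (k + 2) z" "z \<in> carrier (free_group n)" by (auto simp: nilp_carrier)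
  obtain y where y: "y \<in> \<Gamma> n (k + 1)" "f (cl n 2 x) = cl n (k + 2) y" using johnson_target_rep[OF f x(2)] .
  obtain y' where y': "y' \<in> \<Gamma> n (k + 1)" "f (cl n 2 z) = cl n (k + 2) y'" using johnson_target_rep[OF f z(2)] .
  have car: "y \<in> carrier (free_group n)" "y' \<in> carrier (free_group n)"
    using y y' F.lower_central_closed by blast+
  have "f (cl n 2 (x \<otimes>\<^bsub>free_group n\<^esub> z)) = cl n (k + 2) (y \<otimes>\<^bsub>free_group n\<^esub> y')"
    using johnson_target_mult[OF f x(2) z(2)] car by (simp add: y y' cl_mult)
  then have "hom_incl n k f (cl n (k + 2) (x \<otimes>\<^bsub>free_group n\<^esub> z)) = cl n (k + 2) ((y \<otimes>\<^bsub>free_group n\<^esub> y') \<otimes>\<^bsub>free_group n\<^esub> (x \<otimes>\<^bsub>free_group n\<^esub> z))"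
    using x z y y' by (intro hom_incl_cl_eq) auto
  also have "\<dots> = cl n (k + 2) ((y \<otimes>\<^bsub>free_group n\<^esub> x) \<otimes>\<^bsub>free_group n\<^esub> (y' \<otimes>\<^bsub>free_group n\<^esub> z))"
    using y y' x z by (intro central_cl_mult)
  also have "\<dots> = hom_incl n k f (cl n (k + 2) x) <#>\<^bsub>free_group n\<^esub> hom_incl n k f (cl n (k + 2) z)"
    using car x z hom_incl_cl_eq[where f = f, OF x(2) y(2,1)] hom_incl_cl_eq[where f = f, OF z(2) y'(2,1)] by (simp add: cl_mult)
  finally show "hom_incl n k f (C \<otimes>\<^bsub>nilp n (k + 1)\<^esub> D) =
      hom_incl n k f C \<otimes>\<^bsub>nilp n (k + 1)\<^esub> hom_incl n k f D"
    using x z by (simp only: nilp_mult cl_mult)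
next
  fix C assume "C \<in> carrier (nilp n (k + 1))"
  then obtain x where x: "C = cl n (k + 2) x" "x \<in> carrier (free_group n)" by (auto simp: nilp_carrier)
  obtain y where y: "y \<in> \<Gamma> n (k + 1)" "f (cl n 2 x) = cl n (k + 2) y" using johnson_target_rep[OF f x(2)] .
  show "hom_incl n k f C \<in> carrier (nilp n (k + 1))"
    using x hom_incl_cl_eq[where f = f, OF x(2) y(2,1)] F.lower_central_closed[OF y(1)] by (auto simp: nilp_carrier)
qed

lemma hom_incl_extensional: "hom_incl n k f \<in> extensional (carrier (nilp n (k + 1)))"
  by (simp add: hom_incl_def)

text \<open>The factor contributed by \<open>g\<close> lies in \<Gamma>(k+1), hence in \<Gamma>(2)
  as k is positive. It does not change the class in H at which \<open>f\<close> is evaluated, so the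
  two contributions simply multiply.\<close>

lemma hom_incl_compose:
  assumes k: "1 \<le> k" and f: "f \<in> carrier (johnson_target n k)" and g: "g \<in> carrier (johnson_target n k)"
  shows "hom_incl n k (f \<otimes>\<^bsub>johnson_target n k\<^esub> g) =
    compose (carrier (nilp n (k + 1))) (hom_incl n k f) (hom_incl n k g)"
proof (rule nilp_ext[OF hom_incl_extensional])
  show "compose (carrier (nilp n (k + 1))) (hom_incl n k f) (hom_incl n k g)
      \<in> extensional (carrier (nilp n (k + 1)))" by simp
  fix x assume x: "x \<in> carrier (free_group n)"
  obtain y where y: "y \<in> \<Gamma> n (k + 1)" "f (cl n 2 x) = cl n (k + 2) y" using johnson_target_rep[OF f x] .
  obtain y' where y': "y' \<in> \<Gamma> n (k + 1)" "g (cl n 2 x) = cl n (k + 2) y'" using johnson_target_rep[OF g x] .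
  have car: "y \<in> carrier (free_group n)" "y' \<in> carrier (free_group n)"
    using y y' F.lower_central_closed by blast+
  have "y' \<in> \<Gamma> n 2" using y'(1) F.lower_central_antimono[of 2 "k + 1" n] k by auto
  then have "cl n 2 (y' \<otimes>\<^bsub>free_group n\<^esub> x) = cl n 2 x" using x by (rule cl_cancel)
  then have "hom_incl n k f (cl n (k + 2) (y' \<otimes>\<^bsub>free_group n\<^esub> x)) = cl n (k + 2) (y \<otimes>\<^bsub>free_group n\<^esub> (y' \<otimes>\<^bsub>free_group n\<^esub> x))"
    using x y car by (intro hom_incl_cl_eq) auto
  moreover have "(f \<otimes>\<^bsub>johnson_target n k\<^esub> g) (cl n 2 x) = cl n (k + 2) (y \<otimes>\<^bsub>free_group n\<^esub> y')"
    using x y y' car by (simp add: hom_group_mult abelianization_carrier lie_mult cl_mult)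
  then have "hom_incl n k (f \<otimes>\<^bsub>johnson_target n k\<^esub> g) (cl n (k + 2) x) = cl n (k + 2) ((y \<otimes>\<^bsub>free_group n\<^esub> y') \<otimes>\<^bsub>free_group n\<^esub> x)"
    using x y y' by (intro hom_incl_cl_eq) auto
  moreover have "hom_incl n k g (cl n (k + 2) x) = cl n (k + 2) (y' \<otimes>\<^bsub>free_group n\<^esub> x)"
    using x y' by (intro hom_incl_cl_eq)
  moreover have "cl n (k + 2) x \<in> carrier (nilp n (k + 1))" using x by (simp add: nilp_carrier)
  ultimately have "hom_incl n k (f \<otimes>\<^bsub>johnson_target n k\<^esub> g) (cl n (k + 2) x) =
      compose (carrier (nilp n (k + 1))) (hom_incl n k f) (hom_incl n k g) (cl n (k + 2) x)"
    using x car by (simp add: compose_eq F.m_assoc)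
  then show "hom_incl n k (f \<otimes>\<^bsub>johnson_target n k\<^esub> g) (cl n (Suc (k + 1)) x) =
      compose (carrier (nilp n (k + 1))) (hom_incl n k f) (hom_incl n k g) (cl n (Suc (k + 1)) x)"
    by simp
qed

lemma hom_incl_one: "hom_incl n k \<one>\<^bsub>johnson_target n k\<^esub> = \<one>\<^bsub>AutoGroup (nilp n (k + 1))\<^esub>"
  unfolding Aut_one
proof (rule nilp_ext[OF hom_incl_extensional])
  fix x assume x: "x \<in> carrier (free_group n)"
  have "\<one>\<^bsub>johnson_target n k\<^esub> (cl n 2 x) = cl n (k + 2) \<one>\<^bsub>free_group n\<^esub>"
    using x by (simp add: hom_group_one abelianization_carrier lie_one cl_trivial)
  then have "hom_incl n k \<one>\<^bsub>johnson_target n k\<^esub> (cl n (k + 2) x) = cl n (k + 2) (\<one>\<^bsub>free_group n\<^esub> \<otimes>\<^bsub>free_group n\<^esub> x)"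
    using x by (intro hom_incl_cl_eq) auto
  then show "hom_incl n k \<one>\<^bsub>johnson_target n k\<^esub> (cl n (Suc (k + 1)) x) =
      (\<lambda>C\<in>carrier (nilp n (k + 1)). C) (cl n (Suc (k + 1)) x)"
    using x by (simp add: nilp_carrier)
qed simp

lemma hom_incl_Aut:
  assumes k: "1 \<le> k" and f: "f \<in> carrier (johnson_target n k)"
  shows "hom_incl n k f \<in> carrier (AutoGroup (nilp n (k + 1)))"
proof -
  interpret J: group "johnson_target n k" by (rule group_johnson_target)
  let ?N = "nilp n (k + 1)" and ?g = "inv\<^bsub>johnson_target n k\<^esub> f"
  have g: "?g \<in> carrier (johnson_target n k)" using f by (rule J.inv_closed)
  have "compose (carrier ?N) (hom_incl n k f) (hom_incl n k ?g) = (\<lambda>C\<in>carrier ?N. C)"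
    "compose (carrier ?N) (hom_incl n k ?g) (hom_incl n k f) = (\<lambda>C\<in>carrier ?N. C)"
    unfolding hom_incl_compose[OF k f g, symmetric] hom_incl_compose[OF k g f, symmetric]
      J.r_inv[OF f] J.l_inv[OF f] hom_incl_one Aut_one by (rule refl)+
  then have inv: "hom_incl n k f (hom_incl n k ?g C) = C" "hom_incl n k ?g (hom_incl n k f C) = C"
    if "C \<in> carrier ?N" for C
    using that compose_eq[of C "carrier ?N" "hom_incl n k f" "hom_incl n k ?g"]
      compose_eq[of C "carrier ?N" "hom_incl n k ?g" "hom_incl n k f"]
    by (simp_all only: restrict_apply')
  have "bij_betw (hom_incl n k f) (carrier ?N) (carrier ?N)"
  proof (rule bij_betwI[of _ _ _ "hom_incl n k ?g"])
    show "hom_incl n k f \<in> carrier ?N \<rightarrow> carrier ?N" "hom_incl n k ?g \<in> carrier ?N \<rightarrow> carrier ?N"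
      using hom_incl_hom[OF f] hom_incl_hom[OF g] unfolding hom_def by blast+
  qed (simp_all only: inv)
  then show ?thesis using f by (simp add: Aut_iff hom_incl_hom hom_incl_extensional del: One_nat_def)
qed

lemma hom_incl_in_hom:
  assumes k: "1 \<le> k"
  shows "hom_incl n k \<in> hom (johnson_target n k) (AutoGroup (nilp n (k + 1)))"
  by (rule homI) (simp_all only: hom_incl_Aut[OF k] hom_incl_compose[OF k] Aut_mult)

lemma hom_incl_inj: "inj_on (hom_incl n k) (carrier (johnson_target n k))"
proof (rule inj_onI)
  fix f g assume f: "f \<in> carrier (johnson_target n k)" and g: "g \<in> carrier (johnson_target n k)"
    and eq: "hom_incl n k f = hom_incl n k g"
  show "f = g"
  proof (rule johnson_target_ext[OF f g])
    fix x assume x: "x \<in> carrier (free_group n)"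
    obtain y where y: "y \<in> \<Gamma> n (k + 1)" "f (cl n 2 x) = cl n (k + 2) y" using johnson_target_rep[OF f x] .
    obtain y' where y': "y' \<in> \<Gamma> n (k + 1)" "g (cl n 2 x) = cl n (k + 2) y'" using johnson_target_rep[OF g x] .
    have "cl n (k + 2) (y \<otimes>\<^bsub>free_group n\<^esub> x) = cl n (k + 2) (y' \<otimes>\<^bsub>free_group n\<^esub> x)"
      using hom_incl_cl_eq[where f = f, OF x y(2,1)] hom_incl_cl_eq[where f = g, OF x y'(2,1)] eq by simp
    then have "cl n (k + 2) y = cl n (k + 2) y'"
      using x F.lower_central_closed[OF y(1)] F.lower_central_closed[OF y'(1)]
      by (simp add: \<Gamma>.rcos_eq_iff F.m_assoc F.inv_mult_group)
    then show "f (cl n 2 x) = g (cl n 2 x)" by (simp add: y y')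
  qed
qed

text \<open>An endomorphism that is trivial modulo \<open>\<Gamma>(k+1)\<close> acts on \<open>F/\<Gamma>(k+2)\<close> through the
  homomorphism \<open>[x] \<mapsto> \<phi>(x) x^-1\<close>, which factors over \<open>H\<close> because its target is abelian.\<close>

lemma central_endo:
  assumes \<phi>: "\<phi> \<in> hom (free_group n) (free_group n)"
    and triv: "\<And>x. x \<in> carrier (free_group n) \<Longrightarrow> cl n (k + 1) (\<phi> x) = cl n (k + 1) x"
  obtains f where "f \<in> carrier (johnson_target n k)" "ind n (k + 1) \<phi> = hom_incl n k f"
    "\<And>x. x \<in> carrier (free_group n) \<Longrightarrow> f (cl n 2 x) = cl n (k + 2) (\<phi> x \<otimes>\<^bsub>free_group n\<^esub> inv\<^bsub>free_group n\<^esub> x)"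
proof -
  define h where "h x = cl n (k + 2) (\<phi> x \<otimes>\<^bsub>free_group n\<^esub> inv\<^bsub>free_group n\<^esub> x)" for x
  have mem: "\<phi> x \<otimes>\<^bsub>free_group n\<^esub> inv\<^bsub>free_group n\<^esub> x \<in> \<Gamma> n (k + 1)" if "x \<in> carrier (free_group n)" for x
    using triv[OF that] that \<phi> by (simp only: \<Gamma>.rcos_eq_iff endo_closed)
  interpret L: comm_group "lie n (k + 1)" by (rule comm_group_lie) simp
  have h: "h \<in> hom (free_group n) (lie n (k + 1))"
  proof (rule homI)
    show "h x \<in> carrier (lie n (k + 1))" if "x \<in> carrier (free_group n)" for x
      using mem[OF that] by (simp add: h_def lie_carrier)
    fix x z assume x: "x \<in> carrier (free_group n)" and z: "z \<in> carrier (free_group n)"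
    let ?a = "\<phi> x \<otimes>\<^bsub>free_group n\<^esub> inv\<^bsub>free_group n\<^esub> x" and ?b = "\<phi> z \<otimes>\<^bsub>free_group n\<^esub> inv\<^bsub>free_group n\<^esub> z"
    have car: "\<phi> x \<in> carrier (free_group n)" "\<phi> z \<in> carrier (free_group n)" using x z \<phi> by auto
    have "\<phi> (x \<otimes>\<^bsub>free_group n\<^esub> z) = ?a \<otimes>\<^bsub>free_group n\<^esub> x \<otimes>\<^bsub>free_group n\<^esub> (?b \<otimes>\<^bsub>free_group n\<^esub> z)"
      using x z car by (simp add: hom_mult[OF \<phi>] F.m_assoc)
    then have "cl n (k + 2) (\<phi> (x \<otimes>\<^bsub>free_group n\<^esub> z)) = cl n (k + 2) (?a \<otimes>\<^bsub>free_group n\<^esub> ?b \<otimes>\<^bsub>free_group n\<^esub> (x \<otimes>\<^bsub>free_group n\<^esub> z))"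
      using central_cl_mult[OF mem[OF x] mem[OF z] x z] by simp
    then have "cl n (k + 2) (\<phi> (x \<otimes>\<^bsub>free_group n\<^esub> z)) <#>\<^bsub>free_group n\<^esub> cl n (k + 2) (inv\<^bsub>free_group n\<^esub> (x \<otimes>\<^bsub>free_group n\<^esub> z)) =
        cl n (k + 2) (?a \<otimes>\<^bsub>free_group n\<^esub> ?b \<otimes>\<^bsub>free_group n\<^esub> (x \<otimes>\<^bsub>free_group n\<^esub> z)) <#>\<^bsub>free_group n\<^esub> cl n (k + 2) (inv\<^bsub>free_group n\<^esub> (x \<otimes>\<^bsub>free_group n\<^esub> z))" by simp
    then show "h (x \<otimes>\<^bsub>free_group n\<^esub> z) = h x \<otimes>\<^bsub>lie n (k + 1)\<^esub> h z"
      using x z car \<phi> by (simp add: h_def lie_mult cl_mult F.m_assoc F.inv_mult_group)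
  qed
  have triv2: "h x = \<one>\<^bsub>lie n (k + 1)\<^esub>" if "x \<in> \<Gamma> n 2" for x
  proof -
    have "{commutator (lie n (k + 1)) x y |x y. x \<in> carrier (lie n (k + 1)) \<and> y \<in> carrier (lie n (k + 1))}
        \<subseteq> {\<one>\<^bsub>lie n (k + 1)\<^esub>}"
    proof clarify
      fix x y assume xy: "x \<in> carrier (lie n (k + 1))" "y \<in> carrier (lie n (k + 1))"
      then show "commutator (lie n (k + 1)) x y = \<one>\<^bsub>lie n (k + 1)\<^esub>"
        unfolding commutator_def L.m_comm[OF xy] by (simp add: L.m_assoc del: One_nat_def add_Suc_right)
    qed
    from L.generate_subgroup_incl[OF this L.triv_subgroup]
    have "lower_central (lie n (k + 1)) 2 \<subseteq> {\<one>\<^bsub>lie n (k + 1)\<^esub>}"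
      by (simp add: numeral_2_eq_2 lower_central.simps(3))
    then show ?thesis using hom_lower_central[OF F.is_group L.is_group h that] by blast
  qed
  interpret h: group_hom "free_group n" "lie n (k + 1)" h by unfold_locales (rule h)
  have "\<Gamma> n 2 \<subseteq> kernel (free_group n) (lie n (k + 1)) h"
    using triv2 F.lower_central_closed by (auto simp only: kernel_def subset_iff mem_Collect_eq)
  then obtain g where g: "g \<in> hom (free_group n Mod \<Gamma> n 2) (lie n (k + 1))"
    "\<And>x. x \<in> carrier (free_group n) \<Longrightarrow> g (cl n 2 x) = h x"
    using h.FactGroup_universal_kernel[OF F.lower_central_normal] by metis
  define f where "f = restrict g (carrier (abelianization n))"
  have f: "f \<in> carrier (johnson_target n k)"
  proof -
    interpret Ab: group "abelianization n" by (rule group_abelianization)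
    have "g \<in> hom (abelianization n) (lie n (k + 1))" using g(1) by (simp only: abelianization_def)
    then have "f \<in> hom (abelianization n) (lie n (k + 1))" by (rule Ab.hom_restrict) (simp add: f_def)
    then show ?thesis by (simp add: hom_group_carrier f_def)
  qed
  have f_cl: "f (cl n 2 x) = cl n (k + 2) (\<phi> x \<otimes>\<^bsub>free_group n\<^esub> inv\<^bsub>free_group n\<^esub> x)" if "x \<in> carrier (free_group n)" for x
    using that g(2) by (simp add: f_def abelianization_carrier h_def)
  have "ind n (k + 1) \<phi> = hom_incl n k f"
  proof (rule nilp_ext[OF ind_extensional hom_incl_extensional])
    fix x assume x: "x \<in> carrier (free_group n)"
    have "hom_incl n k f (cl n (k + 2) x) = cl n (k + 2) (\<phi> x \<otimes>\<^bsub>free_group n\<^esub> inv\<^bsub>free_group n\<^esub> x \<otimes>\<^bsub>free_group n\<^esub> x)"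
      using x f_cl mem by (intro hom_incl_cl_eq) auto
    then show "ind n (k + 1) \<phi> (cl n (Suc (k + 1)) x) = hom_incl n k f (cl n (Suc (k + 1)) x)"
      using x \<phi> ind_cl[OF \<phi> x, of "k + 1"] by (simp add: F.m_assoc)
  qed
  then show ?thesis using that f f_cl by blast
qed

lemma lifts_central_iff:
  assumes "lifts n (k + 1) \<alpha> \<phi> \<psi>"
  shows "aut_descend n (k + 1) k \<alpha> = \<one>\<^bsub>AutoGroup (nilp n k)\<^esub> \<longleftrightarrow>
    (\<forall>x\<in>carrier (free_group n). cl n (k + 1) (\<phi> x) = cl n (k + 1) x)"
proof -
  have \<phi>: "\<phi> \<in> hom (free_group n) (free_group n)" using assms by (simp add: lifts_def)
  have eq: "aut_descend n (k + 1) k \<alpha> = ind n k \<phi>"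
    using lifts_descend[OF assms, of k] by (simp add: lifts_def)
  show ?thesis
  proof
    assume "aut_descend n (k + 1) k \<alpha> = \<one>\<^bsub>AutoGroup (nilp n k)\<^esub>"
    then have "ind n k \<phi> = (\<lambda>C\<in>carrier (nilp n k). C)" using eq by (simp add: Aut_one)
    then show "\<forall>x\<in>carrier (free_group n). cl n (k + 1) (\<phi> x) = cl n (k + 1) x"
      using ind_cl[OF \<phi>, of _ k] by (auto simp: nilp_carrier)
  next
    assume "\<forall>x\<in>carrier (free_group n). cl n (k + 1) (\<phi> x) = cl n (k + 1) x"
    then show "aut_descend n (k + 1) k \<alpha> = \<one>\<^bsub>AutoGroup (nilp n k)\<^esub>"
      unfolding eq by (intro ind_identity \<phi>) simp
  qed
qed

lemma hom_incl_exact: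
  assumes k: "1 \<le> k" and \<alpha>: "\<alpha> \<in> carrier (AutoGroup (nilp n (k + 1)))"
  shows "aut_descend n (k + 1) k \<alpha> = \<one>\<^bsub>AutoGroup (nilp n k)\<^esub> \<longleftrightarrow>
    \<alpha> \<in> hom_incl n k ` carrier (johnson_target n k)"
proof -
  obtain \<phi> \<psi> where l: "lifts n (k + 1) \<alpha> \<phi> \<psi>" using Aut_lifts[OF \<alpha>] .
  then have \<phi>: "\<phi> \<in> hom (free_group n) (free_group n)" "\<alpha> = ind n (k + 1) \<phi>" by (auto simp: lifts_def)
  show ?thesis unfolding lifts_central_iff[OF l]
  proof
    assume "\<forall>x\<in>carrier (free_group n). cl n (k + 1) (\<phi> x) = cl n (k + 1) x"
    then show "\<alpha> \<in> hom_incl n k ` carrier (johnson_target n k)"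
      using central_endo[OF \<phi>(1), of k] \<phi>(2) by (metis imageI)
  next
    assume "\<alpha> \<in> hom_incl n k ` carrier (johnson_target n k)"
    then obtain f where f: "f \<in> carrier (johnson_target n k)" "\<alpha> = hom_incl n k f" by blast
    show "\<forall>x\<in>carrier (free_group n). cl n (k + 1) (\<phi> x) = cl n (k + 1) x"
    proof
      fix x assume x: "x \<in> carrier (free_group n)"
      obtain y where y: "y \<in> \<Gamma> n (k + 1)" "f (cl n 2 x) = cl n (k + 2) y" using johnson_target_rep[OF f(1) x] .
      have "cl n (k + 2) (\<phi> x) = cl n (k + 2) (y \<otimes>\<^bsub>free_group n\<^esub> x)"
        using ind_cl[OF \<phi>(1) x, of "k + 1"] hom_incl_cl_eq[where f = f, OF x y(2,1)] f(2) \<phi>(2) by simp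
      then have "cl n (k + 1) (\<phi> x) = cl n (k + 1) (y \<otimes>\<^bsub>free_group n\<^esub> x)"
        using x \<phi> F.lower_central_closed[OF y(1)] by (intro cl_eq_mono[of n "k + 2" _ _ "k + 1"]) auto
      then show "cl n (k + 1) (\<phi> x) = cl n (k + 1) x" using y(1) x by (simp only: cl_cancel)
    qed
  qed
qed

text \<open>Both composites of \<open>\<phi>\<close> and \<open>\<psi>\<close> are trivial modulo
  \<Gamma>(k+1), so by \<open>central_endo\<close> they act on the next quotient as automorphisms
  from \<open>hom_incl\<close>. Hence \<open>\<phi>\<close> itself is bijective there: invertibility
  climbs the central series without changing \<open>\<phi>\<close>.\<close>

lemma ind_Aut_Suc:
  assumes k: "1 \<le> k" and l: "lifts n k \<alpha> \<phi> \<psi>"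
  shows "ind n (k + 1) \<phi> \<in> carrier (AutoGroup (nilp n (k + 1)))"
proof -
  have h: "\<phi> \<in> hom (free_group n) (free_group n)" "\<psi> \<in> hom (free_group n) (free_group n)"
    using l by (auto simp: lifts_def)
  have bij: "bij_betw (ind n (k + 1) \<chi>) (carrier (nilp n (k + 1))) (carrier (nilp n (k + 1)))"
    if "\<chi> \<in> hom (free_group n) (free_group n)"
      "\<And>x. x \<in> carrier (free_group n) \<Longrightarrow> cl n (k + 1) (\<chi> x) = cl n (k + 1) x" for \<chi>
    using central_endo[OF that] hom_incl_Aut[OF k] by (metis Aut_iff)
  have "bij_betw (ind n (k + 1) \<phi>) (carrier (nilp n (k + 1))) (carrier (nilp n (k + 1)))"
    using l by (intro bij_betw_nilpI[OF h] bij endo_compose h) (auto simp: lifts_def)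
  then show ?thesis
    by (simp add: Aut_iff ind_hom[OF h(1)] ind_extensional del: One_nat_def)
qed

lemma aut_descend_surj:
  assumes k: "1 \<le> k"
  shows "aut_descend n (k + 1) k ` carrier (AutoGroup (nilp n (k + 1))) = carrier (AutoGroup (nilp n k))"
proof
  show "aut_descend n (k + 1) k ` carrier (AutoGroup (nilp n (k + 1))) \<subseteq> carrier (AutoGroup (nilp n k))"
    using hom_in_carrier[OF aut_descend_hom[of k "k + 1" n]] by auto
  show "carrier (AutoGroup (nilp n k)) \<subseteq> aut_descend n (k + 1) k ` carrier (AutoGroup (nilp n (k + 1)))"
  proof
    fix \<alpha> assume "\<alpha> \<in> carrier (AutoGroup (nilp n k))"
    then obtain \<phi> \<psi> where l: "lifts n k \<alpha> \<phi> \<psi>" by (rule Aut_lifts)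
    then have h: "\<phi> \<in> hom (free_group n) (free_group n)" "\<psi> \<in> hom (free_group n) (free_group n)"
      "\<alpha> = ind n k \<phi>" by (auto simp: lifts_def)
    have \<beta>: "ind n (k + 1) \<phi> \<in> carrier (AutoGroup (nilp n (k + 1)))" using k l by (rule ind_Aut_Suc)
    \<comment> \<open>\<open>aut_descend\<close> is computed from a lift at class k + 1, and the one
      obtained here may differ from \<open>\<phi>\<close>; both agree modulo \<Gamma>(k+2), hence
      modulo \<Gamma>(k+1).\<close>
    then obtain \<phi>' \<psi>' where l': "lifts n (k + 1) (ind n (k + 1) \<phi>) \<phi>' \<psi>'" by (rule Aut_lifts)
    have "aut_descend n (k + 1) k (ind n (k + 1) \<phi>) = ind n k \<phi>'"
      using lifts_descend[OF l', of k] by (simp add: lifts_def)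
    also have "\<dots> = ind n k \<phi>"
    proof (rule ind_eqI[OF _ h(1)])
      show \<phi>': "\<phi>' \<in> hom (free_group n) (free_group n)" using l' by (simp add: lifts_def)
      fix x assume x: "x \<in> carrier (free_group n)"
      have "ind n (k + 1) \<phi> = ind n (k + 1) \<phi>'" using l' by (simp add: lifts_def)
      then have "cl n (k + 2) (\<phi>' x) = cl n (k + 2) (\<phi> x)"
        using ind_cl[OF h(1) x, of "k + 1"] ind_cl[OF \<phi>' x, of "k + 1"] by simp
      then show "cl n (Suc k) (\<phi>' x) = cl n (Suc k) (\<phi> x)"
        using x \<phi>' h by (intro cl_eq_mono[of n "k + 2" _ _ "Suc k"]) auto
    qed
    finally show "\<alpha> \<in> aut_descend n (k + 1) k ` carrier (AutoGroup (nilp n (k + 1)))"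
      using \<beta> h(3) by (metis imageI)
  qed
qed

section \<open>Equivariance of the trace map\<close>

text \<open>The matrix of \<open>\<phi>\<close> on H, read off from Magnus coefficients of degree
  one; by \<open>H_coord_cl\<close> these are the exponent sums used in
  \<open>H_matrix\<close>.\<close>

definition mat :: "nat \<Rightarrow> ((nat \<times> bool) list \<Rightarrow> (nat \<times> bool) list) \<Rightarrow> nat \<Rightarrow> nat \<Rightarrow> int" where
  "mat n \<phi> j i = lead n 1 (\<phi> (gen i)) [j]"

lemma tensor_act_1:
  "a < n \<Longrightarrow> tensor_act n (Suc 0) A t [a] = (\<Sum>b<n. of_int (A a b) * t [b])"
  by (simp add: tensor_act_Cons tensor_act_0)

text \<open>Naturality of the Lie embedding. Both sides are additive and respect commutators, so the
  claim propagates from the generators through the commutators generating \<Gamma>(k).\<close>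

lemma lead_endo:
  assumes \<phi>: "\<phi> \<in> hom (free_group n) (free_group n)" and "1 \<le> k" "x \<in> \<Gamma> n k"
  shows "lead n k (\<phi> x) = tensor_act n k (mat n \<phi>) (lead n k x)"
  using assms(2,3)
proof (induction k arbitrary: x rule: less_induct)
  case (less k)
  interpret \<phi>: group_hom "free_group n" "free_group n" \<phi> by unfold_locales fact
  note image = hom_lower_central[OF F.is_group F.is_group \<phi>]
  define S where "S = {y \<in> \<Gamma> n k. lead n k (\<phi> y) = tensor_act n k (mat n \<phi>) (lead n k y)}"
  have S: "subgroup S (free_group n)"
  proof (rule F.subgroupI)
    show "S \<subseteq> carrier (free_group n)" by (auto simp: S_def F.lower_central_closed)
    have "\<one>\<^bsub>free_group n\<^esub> \<in> S" using less.prems(1) by (simp add: S_def lead_one tensor_act_zero)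
    then show "S \<noteq> {}" by blast
    show "y \<otimes>\<^bsub>free_group n\<^esub> z \<in> S" if yz: "y \<in> S" "z \<in> S" for y z
      using yz less.prems(1) lead_mult[OF image image, of y k z] F.lower_central_closed[of y n k]
        F.lower_central_closed[of z n k]
      by (simp add: S_def lead_mult tensor_act_add)
    show "inv\<^bsub>free_group n\<^esub> y \<in> S" if "y \<in> S" for y
      using that less.prems(1) lead_inv[OF image, of y k] F.lower_central_closed[of y n k]
      by (simp add: S_def lead_inv tensor_act_minus)
  qed
  show ?case
  proof (cases "k = 1")
    case True
    have "lead n 1 (\<phi> (gen i)) w = tensor_act n 1 (mat n \<phi>) (lead n 1 (gen i)) w" if i: "i < n" for i w
    proof (cases "w \<in> index_words n 1")
      case True
      then obtain a where w: "w = [a]" "a < n"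
        by (auto simp: index_words_def length_Suc_conv)
      have "(\<Sum>b<n. mat n \<phi> a b * of_bool ([b] = [i])) = mat n \<phi> a i"
        using i by (simp add: of_bool_def if_distrib cong: if_cong)
      then show ?thesis
        using w i lead_gen[OF i] by (simp add: tensor_act_1 mat_def)
    qed (simp add: tensor_act_outside lead_def)
    then have "carrier (free_group n) \<subseteq> S"
      using True by (intro generators_generate S) (auto simp: S_def)
    then show ?thesis using F.lower_central_closed[OF less.prems(2)] by (auto simp: S_def)
  next
    case False
    then obtain j where k: "k = Suc (Suc j)" using less.prems(1) by (metis One_nat_def Suc_le_D le_0_eq not0_implies_Suc)
    have "commutator (free_group n) y z \<in> S" if yz: "y \<in> \<Gamma> n (Suc j)" "z \<in> carrier (free_group n)" for y z
    proof -
      have z: "z \<in> \<Gamma> n 1" using yz(2) by simp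
      have IH: "lead n (Suc j) (\<phi> y) = tensor_act n (Suc j) (mat n \<phi>) (lead n (Suc j) y)"
        "lead n 1 (\<phi> z) = tensor_act n 1 (mat n \<phi>) (lead n 1 z)"
        using less.IH[of "Suc j" y] less.IH[of 1 z] yz(1) z k by simp_all
      have "\<phi> (commutator (free_group n) y z) = commutator (free_group n) (\<phi> y) (\<phi> z)"
        using yz F.lower_central_closed by (intro hom_commutator \<phi> F.is_group) auto
      then have "lead n (Suc j + 1) (\<phi> (commutator (free_group n) y z)) =
          (\<lambda>w. tensor_mult (Suc j) (lead n (Suc j) (\<phi> y)) (lead n 1 (\<phi> z)) w -
               tensor_mult 1 (lead n 1 (\<phi> z)) (lead n (Suc j) (\<phi> y)) w)"
        using lead_commutator[OF image[OF yz(1)] image[OF z]] by simp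
      moreover have "tensor_act n (Suc j + 1) (mat n \<phi>) (tensor_mult 1 s t) w =
          tensor_mult 1 (tensor_act n 1 (mat n \<phi>) s) (tensor_act n (Suc j) (mat n \<phi>) t) w"
        for s t :: "nat list \<Rightarrow> int" and w
        using tensor_act_tensor_mult[of n 1 "Suc j"] by (simp only: add.commute)
      ultimately have "lead n (Suc j + 1) (\<phi> (commutator (free_group n) y z)) =
          tensor_act n (Suc j + 1) (mat n \<phi>) (lead n (Suc j + 1) (commutator (free_group n) y z))"
        unfolding lead_commutator[OF yz(1) z le_add1[of 1 j, unfolded plus_1_eq_Suc] order_refl] tensor_act_diff IH
        by (simp only: fun_eq_iff tensor_act_tensor_mult simp_thms)
      then show ?thesis
        using F.commutator_in_lower_central[OF yz] k by (simp add: S_def)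
    qed
    then have "\<Gamma> n k \<subseteq> S"
      unfolding k lower_central.simps by (intro F.generate_subgroup_incl S) auto
    then show ?thesis using less.prems by (auto simp: S_def)
  qed
qed

lemma exponent_sum_magnus: "exponent_sum j w = magnus w [j]"
proof (induction w)
  case (Cons a w)
  have "magnus (a # w) [j] = letter_series a [] * magnus w [j] + letter_series a [j] * magnus w []"
    by (simp add: magnus_def word_eval_def series_monoid_def)
  then show ?case using Cons
    by (cases a, cases "snd a") (auto simp: exponent_sum_def magnus_constant)
qed (simp add: exponent_sum_def magnus_Nil)

lemma H_coord_cl:
  assumes "x \<in> carrier (free_group n)" "j < n"
  shows "H_coord (cl n 2 x) j = lead n 1 x [j]"
proof -
  have "exponent_sum j y = lead n 1 x [j]" if "y \<in> cl n 2 x" for y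
    using that assms lead_cong[of n 1 y x]
    by (auto simp: mem_cl_iff exponent_sum_magnus lead_def index_words_def fun_eq_iff numeral_2_eq_2)
      (metis bot.extremum insert_subset length_Cons lessThan_iff list.set(1) list.simps(15) list.size(3))
  then have "exponent_sum j ` cl n 2 x = (\<lambda>_. lead n 1 x [j]) ` cl n 2 x"
    by (intro image_cong refl)
  also have "\<dots> = {lead n 1 x [j]}" using cl_self[OF assms(1), of 2] by auto
  finally have "exponent_sum j ` cl n 2 x = {lead n 1 x [j]}" .
  then show ?thesis by (simp add: H_coord_def)
qed

lemma lead_one_cong:
  assumes "cl n (Suc m) x = cl n (Suc m) y" "1 \<le> m" "x \<in> carrier (free_group n)" "y \<in> carrier (free_group n)"
  shows "lead n 1 x = lead n 1 y"
  using cl_eq_mono[OF assms(1), of 2] lead_cong[of n 1 x y] assms by (simp add: numeral_2_eq_2)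

lemma mat_compose:
  assumes "\<phi> \<in> hom (free_group n) (free_group n)" "\<psi> \<in> hom (free_group n) (free_group n)" "a < n" "c < n"
  shows "mat n (\<phi> \<circ> \<psi>) a c = (\<Sum>b<n. mat n \<phi> a b * mat n \<psi> b c)"
  using assms lead_endo[OF assms(1), of 1 "\<psi> (gen c)"] by (simp add: mat_def tensor_act_1)

lemma mat_identity:
  assumes "\<phi> \<in> hom (free_group n) (free_group n)" "1 \<le> m"
    and "\<And>x. x \<in> carrier (free_group n) \<Longrightarrow> cl n (Suc m) (\<phi> x) = cl n (Suc m) x" "a < n" "b < n"
  shows "mat n \<phi> a b = of_bool (a = b)"
  using lead_one_cong[of n m "\<phi> (gen b)" "gen b"] assms lead_gen[OF assms(5)] by (simp add: mat_def)

lemma ext_act_lifts: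
  assumes l: "lifts n k \<alpha> \<phi> \<psi>" and k: "1 \<le> k"
  shows "ext_act n k \<alpha> = ext_map n k (mat n \<phi>)"
proof -
  have \<phi>: "\<phi> \<in> hom (free_group n) (free_group n)" using l by (simp add: lifts_def)
  have "aut_descend n k 1 \<alpha> = ind n 1 \<phi>"
    using lifts_descend[OF l k] by (simp add: lifts_def)
  then have "H_matrix n (aut_descend n k 1 \<alpha>) a b = mat n \<phi> a b" if "a < n" "b < n" for a b
    using that ind_cl[OF \<phi>, of "gen b" 1] H_coord_cl[of "\<phi> (gen b)" n a] \<phi>
    by (simp add: H_matrix_def mat_def numeral_2_eq_2)
  then have "ext_map n k (H_matrix n (aut_descend n k 1 \<alpha>)) = ext_map n k (mat n \<phi>)"
    by (rule ext_map_cong)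
  then show ?thesis by (simp add: ext_act_def[abs_def] ext_map_def[abs_def])
qed

definition trace_tensor :: "nat \<Rightarrow> nat \<Rightarrow> (nat \<Rightarrow> nat list \<Rightarrow> int) \<Rightarrow> nat list \<Rightarrow> rat" where
  "trace_tensor n k T = (\<lambda>w. of_int (contraction n k T w))"

lemma trace_tensor_closed: "trace_tensor n k T \<in> carrier (tensor_power n k)"
  by (simp add: trace_tensor_def contraction_def tensor_power_carrier)

lemma trace_alt_eq: "trace_alt n k f = ext_proj n k (trace_tensor n k (dual_lie_embedding n k f))"
  unfolding trace_alt_def trace_tensor_def
  by (rule ext_int_to_rat_proj) (simp add: contraction_def tensor_power_carrier)

lemma trace_alt_closed: "trace_alt n k f \<in> carrier (ext_power n k)"
  unfolding trace_alt_eq ext_power_carrier using trace_tensor_closed by blast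

lemma lie_embedding_hom:
  assumes f: "f \<in> carrier (johnson_target n k)"
    and x: "x \<in> carrier (free_group n)" "z \<in> carrier (free_group n)"
  shows "lie_embedding n (k + 1) (f (cl n 2 (x \<otimes>\<^bsub>free_group n\<^esub> z))) w =
    lie_embedding n (k + 1) (f (cl n 2 x)) w + lie_embedding n (k + 1) (f (cl n 2 z)) w"
proof -
  obtain y where y: "y \<in> \<Gamma> n (k + 1)" "f (cl n 2 x) = cl n (k + 2) y" using johnson_target_rep[OF f x(1)] .
  obtain y' where y': "y' \<in> \<Gamma> n (k + 1)" "f (cl n 2 z) = cl n (k + 2) y'" using johnson_target_rep[OF f x(2)] .
  have "f (cl n 2 (x \<otimes>\<^bsub>free_group n\<^esub> z)) = cl n (k + 2) (y \<otimes>\<^bsub>free_group n\<^esub> y')"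
    using johnson_target_mult[OF f x] y y' F.lower_central_closed by (simp add: cl_mult)
  then show ?thesis
    using y y' lie_embedding_cl[of "k + 1"] lead_mult[OF y(1) y'(1)] \<Gamma>.m_closed[OF y(1) y'(1)] by simp
qed

text \<open>Used at x = \<open>\<psi> (gen i)\<close>, where the coefficients form a column of the
  matrix of \<open>\<psi>\<close>. This is how the contragredient action on the dual of H enters the
  equivariance.\<close>

lemma lie_embedding_expand:
  assumes f: "f \<in> carrier (johnson_target n k)" and x: "x \<in> carrier (free_group n)"
  shows "lie_embedding n (k + 1) (f (cl n 2 x)) w = (\<Sum>j<n. lead n 1 x [j] * dual_lie_embedding n k f j w)"
proof -
  define D where "D x = lie_embedding n (k + 1) (f (cl n 2 x)) w" for x
  have D_mult: "D (x \<otimes>\<^bsub>free_group n\<^esub> z) = D x + D z" if "x \<in> carrier (free_group n)" "z \<in> carrier (free_group n)" for x z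
    using lie_embedding_hom[OF f that] by (simp add: D_def)
  have D_one: "D \<one>\<^bsub>free_group n\<^esub> = 0" using D_mult[of "\<one>\<^bsub>free_group n\<^esub>" "\<one>\<^bsub>free_group n\<^esub>"] by simp
  have D_inv: "D (inv\<^bsub>free_group n\<^esub> x) = - D x" if "x \<in> carrier (free_group n)" for x
    using D_mult[of x "inv\<^bsub>free_group n\<^esub> x"] that D_one by simp
  have lead1: "lead n 1 (x \<otimes>\<^bsub>free_group n\<^esub> z) = (\<lambda>w. lead n 1 x w + lead n 1 z w)"
    "lead n 1 (inv\<^bsub>free_group n\<^esub> x) = (\<lambda>w. - lead n 1 x w)"
    if "x \<in> carrier (free_group n)" "z \<in> carrier (free_group n)" for x z
    using that by (auto intro!: lead_mult lead_inv)
  have gen: "(\<Sum>j<n. lead n 1 (gen i) [j] * D (gen j)) = D (gen i)" if "i < n" for i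
    using that lead_gen[OF that] by (simp add: of_bool_def if_distrib if_distribR cong: if_cong)
  have "D x = (\<Sum>j<n. lead n 1 x [j] * D (gen j))"
    using x
  proof (induction rule: free_group_induct)
    case one
    then show ?case by (simp add: D_one lead_one del: One_nat_def)
  next
    case (gen i x)
    then show ?case using \<open>\<And>i. i < n \<Longrightarrow> _ = D (gen i)\<close>[of i]
      by (simp add: D_mult lead1 algebra_simps sum.distrib del: One_nat_def)
  next
    case (inv_gen i x)
    then show ?case using \<open>\<And>i. i < n \<Longrightarrow> _ = D (gen i)\<close>[of i]
      by (simp add: D_mult D_inv lead1 algebra_simps sum.distrib sum_negf sum_subtractf del: One_nat_def)
  qed
  then show ?thesis by (simp add: D_def dual_lie_embedding_def mult.commute)
qed

lemma trace_alt_hom: "trace_alt n k \<in> hom (johnson_target n k) (ext_power_rat n k)"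
proof (rule homI)
  fix f g assume f: "f \<in> carrier (johnson_target n k)" and g: "g \<in> carrier (johnson_target n k)"
  have "dual_lie_embedding n k (f \<otimes>\<^bsub>johnson_target n k\<^esub> g) i =
      (\<lambda>w. dual_lie_embedding n k f i w + dual_lie_embedding n k g i w)" if i: "i < n" for i
  proof -
    obtain y where y: "y \<in> \<Gamma> n (k + 1)" "f (cl n 2 (gen i)) = cl n (k + 2) y"
      using johnson_target_rep[OF f gen_closed[OF i]] .
    obtain y' where y': "y' \<in> \<Gamma> n (k + 1)" "g (cl n 2 (gen i)) = cl n (k + 2) y'"
      using johnson_target_rep[OF g gen_closed[OF i]] .
    have "(f \<otimes>\<^bsub>johnson_target n k\<^esub> g) (cl n 2 (gen i)) = cl n (k + 2) (y \<otimes>\<^bsub>free_group n\<^esub> y')"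
      using i y y' F.lower_central_closed
      by (simp add: hom_group_mult abelianization_carrier lie_mult cl_mult)
    then show ?thesis
      using y y' lie_embedding_cl[of "k + 1"] lead_mult[OF y(1) y'(1)] \<Gamma>.m_closed[OF y(1) y'(1)]
      by (simp add: dual_lie_embedding_def)
  qed
  then have "trace_tensor n k (dual_lie_embedding n k (f \<otimes>\<^bsub>johnson_target n k\<^esub> g)) =
    (\<lambda>w. trace_tensor n k (dual_lie_embedding n k f) w + trace_tensor n k (dual_lie_embedding n k g) w)"
    by (auto simp: trace_tensor_def contraction_def sum.distrib)
  then show "trace_alt n k (f \<otimes>\<^bsub>johnson_target n k\<^esub> g) =
      trace_alt n k f \<otimes>\<^bsub>ext_power n k\<^esub> trace_alt n k g"
    by (simp add: trace_alt_eq ext_proj_mult trace_tensor_closed)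
qed (rule trace_alt_closed)

text \<open>Invariance of the pairing of H with its dual: \<open>A\<close> acts on the tensor
  factors and its inverse \<open>B\<close> on the dual index, so on the contracted pair of indices
  they cancel.\<close>

lemma contraction_equivariant:
  fixes T :: "nat \<Rightarrow> nat list \<Rightarrow> int"
  assumes BA: "\<And>j b. \<lbrakk>j < n; b < n\<rbrakk> \<Longrightarrow> (\<Sum>i<n. B j i * A i b) = of_bool (j = b)"
  shows "contraction n k (\<lambda>i. tensor_act n (Suc k) A (\<lambda>v. \<Sum>j<n. B j i * T j v)) =
    tensor_act n k A (contraction n k T)"
proof
  fix w
  show "contraction n k (\<lambda>i. tensor_act n (Suc k) A (\<lambda>v. \<Sum>j<n. B j i * T j v)) w =
    tensor_act n k A (contraction n k T) w"
  proof (cases "w \<in> index_words n k")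
    case True
    let ?t = "\<lambda>j b. tensor_act n k A (\<lambda>v. T j (b # v)) w"
    have "contraction n k (\<lambda>i. tensor_act n (Suc k) A (\<lambda>v. \<Sum>j<n. B j i * T j v)) w =
        (\<Sum>i<n. \<Sum>j<n. \<Sum>b<n. (B j i * A i b) * ?t j b)"
      using True by (simp add: contraction_def tensor_act_Cons tensor_act_sum sum_distrib_left mult.assoc)
    also have "\<dots> = (\<Sum>j<n. \<Sum>b<n. \<Sum>i<n. (B j i * A i b) * ?t j b)"
      by (subst sum.swap) (intro sum.cong refl sum.swap)
    also have "\<dots> = (\<Sum>j<n. \<Sum>b<n. of_bool (j = b) * ?t j b)"
      by (intro sum.cong refl) (simp add: BA flip: sum_distrib_right)
    also have "\<dots> = (\<Sum>b<n. ?t b b)"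
      by (intro sum.cong refl) (simp add: of_bool_def if_distrib if_distribR cong: if_cong)
    also have "\<dots> = tensor_act n k A (\<lambda>v. \<Sum>b<n. T b (b # v)) w"
      using tensor_act_sum[of n k A "\<lambda>_. 1" "\<lambda>b v. T b (b # v)" "{..<n}" w] by simp
    also have "\<dots> = tensor_act n k A (contraction n k T) w"
      by (auto simp: tensor_act_def contraction_def intro!: sum.cong)
    finally show ?thesis .
  qed (simp add: contraction_def tensor_act_outside)
qed

text \<open>The relation says that \<open>g\<close> is the conjugate of \<open>f\<close> by
  \<open>\<alpha>\<close>, written without inverses. Evaluated at the class of
  \<open>\<psi> (gen i)\<close> it becomes g(x_i) = \<phi>(f(\<psi>(x_i))), the usual action on
  homomorphisms.\<close>

lemma trace_alt_equivariant:
  assumes k: "1 \<le> k" and l: "lifts n (k + 1) \<alpha> \<phi> \<psi>" and f: "f \<in> carrier (johnson_target n k)"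
    and g: "g \<in> carrier (johnson_target n k)"
    and conj: "hom_incl n k g \<otimes>\<^bsub>AutoGroup (nilp n (k + 1))\<^esub> \<alpha> = \<alpha> \<otimes>\<^bsub>AutoGroup (nilp n (k + 1))\<^esub> hom_incl n k f"
  shows "trace_alt n k g = ext_map n k (mat n \<phi>) (trace_alt n k f)"
proof -
  have h: "\<phi> \<in> hom (free_group n) (free_group n)" "\<psi> \<in> hom (free_group n) (free_group n)"
    "\<alpha> = ind n (k + 1) \<phi>"
    and inv: "\<And>x. x \<in> carrier (free_group n) \<Longrightarrow> cl n (k + 2) (\<phi> (\<psi> x)) = cl n (k + 2) x"
     "\<And>x. x \<in> carrier (free_group n) \<Longrightarrow> cl n (k + 2) (\<psi> (\<phi> x)) = cl n (k + 2) x"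
    using l by (auto simp: lifts_def)
  have \<alpha>: "\<alpha> (cl n (k + 2) x) = cl n (k + 2) (\<phi> x)" if "x \<in> carrier (free_group n)" for x
    using ind_cl[OF h(1) that, of "k + 1"] h(3) by simp
  have "dual_lie_embedding n k g i =
      tensor_act n (Suc k) (mat n \<phi>) (\<lambda>v. \<Sum>j<n. mat n \<psi> j i * dual_lie_embedding n k f j v)"
    if i: "i < n" for i
  proof -
    have x: "\<psi> (gen i) \<in> carrier (free_group n)" "gen i \<in> carrier (free_group n)" using i h by auto
    obtain y where y: "y \<in> \<Gamma> n (k + 1)" "f (cl n 2 (\<psi> (gen i))) = cl n (k + 2) y"
      using johnson_target_rep[OF f x(1)] .
    obtain y' where y': "y' \<in> \<Gamma> n (k + 1)" "g (cl n 2 (gen i)) = cl n (k + 2) y'"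
      using johnson_target_rep[OF g x(2)] .
    have car: "y \<in> carrier (free_group n)" "y' \<in> carrier (free_group n)" using y y' F.lower_central_closed by auto
    have \<phi>y: "\<phi> y \<in> \<Gamma> n (k + 1)" using y(1) by (rule hom_lower_central[OF F.is_group F.is_group h(1)])
    have C: "cl n (k + 2) (\<psi> (gen i)) \<in> carrier (nilp n (k + 1))" using x by (auto simp: nilp_carrier)
    have "compose (carrier (nilp n (k + 1))) (hom_incl n k g) \<alpha> = compose (carrier (nilp n (k + 1))) \<alpha> (hom_incl n k f)"
      using conj hom_incl_Aut[OF k f] hom_incl_Aut[OF k g] lifts_Aut[OF l] by (simp only: Aut_mult)
    then have "hom_incl n k g (\<alpha> (cl n (k + 2) (\<psi> (gen i)))) = \<alpha> (hom_incl n k f (cl n (k + 2) (\<psi> (gen i))))"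
      using C by (metis compose_eq)
    also have "\<dots> = cl n (k + 2) (\<phi> (y \<otimes>\<^bsub>free_group n\<^esub> \<psi> (gen i)))"
      unfolding hom_incl_cl_eq[where f = f, OF x(1) y(2,1)] using car x by (intro \<alpha>) simp
    also have "\<dots> = cl n (k + 2) (\<phi> y) <#>\<^bsub>free_group n\<^esub> cl n (k + 2) (gen i)"
      using car x h i inv(1) hom_mult[OF h(1)] by (simp add: flip: cl_mult)
    also have "\<dots> = cl n (k + 2) (\<phi> y \<otimes>\<^bsub>free_group n\<^esub> gen i)"
      using car x h by (intro cl_mult) auto
    finally have "cl n (k + 2) (y' \<otimes>\<^bsub>free_group n\<^esub> gen i) = cl n (k + 2) (\<phi> y \<otimes>\<^bsub>free_group n\<^esub> gen i)"
      using x inv(1)[OF x(2)] hom_incl_cl_eq[where f = g, OF x(2) y'(2,1)] by (simp only: \<alpha>)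
    then have eq: "cl n (k + 2) y' = cl n (k + 2) (\<phi> y)"
      using x car h by (simp add: \<Gamma>.rcos_eq_iff F.m_assoc F.inv_mult_group)
    have "dual_lie_embedding n k g i = lead n (k + 1) y'"
      using y' lie_embedding_cl[OF _ y'(1)] by (simp add: dual_lie_embedding_def)
    also have "\<dots> = lead n (k + 1) (\<phi> y)"
      using lead_cong[of n "k + 1" y' "\<phi> y"] eq car h by simp
    also have "\<dots> = tensor_act n (k + 1) (mat n \<phi>) (lead n (k + 1) y)"
      using y by (intro lead_endo h) auto
    also have "lead n (k + 1) y = (\<lambda>w. \<Sum>j<n. mat n \<psi> j i * dual_lie_embedding n k f j w)"
      using lie_embedding_expand[OF f x(1)] y lie_embedding_cl[OF _ y(1)] by (simp add: mat_def fun_eq_iff)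
    finally show ?thesis by simp
  qed
  then have "contraction n k (dual_lie_embedding n k g) = contraction n k (\<lambda>i.
      tensor_act n (Suc k) (mat n \<phi>) (\<lambda>v. \<Sum>j<n. mat n \<psi> j i * dual_lie_embedding n k f j v))"
    by (auto simp: contraction_def)
  also have "\<dots> = tensor_act n k (mat n \<phi>) (contraction n k (dual_lie_embedding n k f))"
  proof (rule contraction_equivariant)
    fix j b assume "j < n" "b < n"
    then show "(\<Sum>i<n. mat n \<psi> j i * mat n \<phi> i b) = of_bool (j = b)"
      using mat_compose[OF h(2,1), of j b] mat_identity[of "\<psi> \<circ> \<phi>" n "k + 1" j b] inv(2)
      by (simp add: endo_compose h)
  qed
  finally have "trace_tensor n k (dual_lie_embedding n k g) =
      tensor_act n k (mat n \<phi>) (trace_tensor n k (dual_lie_embedding n k f))"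
    by (simp add: trace_tensor_def tensor_act_of_int[abs_def])
  then show ?thesis by (simp add: trace_alt_eq ext_map_proj trace_tensor_closed)
qed

lemma ext_act_properties:
  assumes k: "1 \<le> k" and \<alpha>: "\<alpha> \<in> carrier (AutoGroup (nilp n k))"
  shows "ext_act n k \<alpha> \<in> hom (ext_power n k) (ext_power n k)"
    and "\<beta> \<in> carrier (AutoGroup (nilp n k)) \<Longrightarrow> C \<in> carrier (ext_power n k) \<Longrightarrow>
      ext_act n k (\<alpha> \<otimes>\<^bsub>AutoGroup (nilp n k)\<^esub> \<beta>) C = ext_act n k \<alpha> (ext_act n k \<beta> C)"
proof -
  obtain \<phi> \<psi> where l: "lifts n k \<alpha> \<phi> \<psi>" using Aut_lifts[OF \<alpha>] .
  show "ext_act n k \<alpha> \<in> hom (ext_power n k) (ext_power n k)"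
    unfolding ext_act_lifts[OF l k] by (rule ext_map_hom)
  assume \<beta>: "\<beta> \<in> carrier (AutoGroup (nilp n k))" and C: "C \<in> carrier (ext_power n k)"
  obtain \<phi>' \<psi>' where l': "lifts n k \<beta> \<phi>' \<psi>'" using Aut_lifts[OF \<beta>] .
  have "ext_map n k (mat n (\<phi> \<circ> \<phi>')) = ext_map n k (\<lambda>a c. \<Sum>b<n. mat n \<phi> a b * mat n \<phi>' b c)"
    using l l' by (intro ext_map_cong mat_compose) (auto simp: lifts_def)
  then show "ext_act n k (\<alpha> \<otimes>\<^bsub>AutoGroup (nilp n k)\<^esub> \<beta>) C = ext_act n k \<alpha> (ext_act n k \<beta> C)"
    unfolding ext_act_lifts[OF l k] ext_act_lifts[OF l' k] ext_act_lifts[OF lifts_mult[OF l l'] k]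
    using C by (simp add: ext_map_compose)
qed

lemma ext_act_trivial:
  assumes k: "1 \<le> k" and l: "lifts n k \<alpha> \<phi> \<psi>"
    and triv: "\<And>x. x \<in> carrier (free_group n) \<Longrightarrow> cl n 2 (\<phi> x) = cl n 2 x"
    and C: "C \<in> carrier (ext_power n k)"
  shows "ext_act n k \<alpha> C = C"
  unfolding ext_act_lifts[OF l k]
  using l triv by (intro ext_map_identity[OF _ C] mat_identity[of \<phi> n 1]) (auto simp: lifts_def numeral_2_eq_2)

lemma ext_act_one:
  assumes k: "1 \<le> k" and C: "C \<in> carrier (ext_power n k)"
  shows "ext_act n k \<one>\<^bsub>AutoGroup (nilp n k)\<^esub> C = C"
proof -
  have "lifts n k \<one>\<^bsub>AutoGroup (nilp n k)\<^esub> (\<lambda>x. x) (\<lambda>x. x)"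
    by (simp add: lifts_def endo_id ind_identity)
  then show ?thesis by (rule ext_act_trivial[OF k _ _ C]) simp
qed

proposition module_extension_nilp:
  assumes k: "1 \<le> k"
  shows "module_extension (johnson_target n k) (AutoGroup (nilp n (k + 1))) (AutoGroup (nilp n k))
    (ext_power_rat n k) (hom_incl n k) (aut_descend n (k + 1) k) (ext_act n k)"
proof (intro module_extension.intro module_extension_axioms.intro)
  show "comm_group (ext_power_rat n k)" by (rule comm_group_ext_power)
qed (simp_all only: group_johnson_target N.AutoGroup hom_incl_in_hom[OF k] hom_incl_inj
  aut_descend_hom[of k "k + 1", simplified] aut_descend_surj[OF k] hom_incl_exact[OF k] ext_act_properties[OF k] ext_act_one[OF k]
  aut_descend_hom le_add1)

proposition trace_alt_invariant:
  assumes k: "1 \<le> k"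
  shows "trace_alt n k \<in> invariant_homs (johnson_target n k) (hom_incl n k) (AutoGroup (nilp n (k + 1)))
    (aut_descend n (k + 1) k) (ext_power_rat n k) (ext_act n k)"
proof -
  interpret E: module_extension "johnson_target n k" "AutoGroup (nilp n (k + 1))" "AutoGroup (nilp n k)"
    "ext_power_rat n k" "hom_incl n k" "aut_descend n (k + 1) k" "ext_act n k"
    by (rule module_extension_nilp[OF k])
  let ?A = "AutoGroup (nilp n (k + 1))"
  have "trace_alt n k (E.unincl (\<alpha> \<otimes>\<^bsub>?A\<^esub> hom_incl n k f \<otimes>\<^bsub>?A\<^esub> inv\<^bsub>?A\<^esub> \<alpha>)) =
      ext_act n k (aut_descend n (k + 1) k \<alpha>) (trace_alt n k f)"
    if \<alpha>: "\<alpha> \<in> carrier ?A" and f: "f \<in> carrier (johnson_target n k)" for \<alpha> f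
  proof -
    obtain \<phi> \<psi> where l: "lifts n (k + 1) \<alpha> \<phi> \<psi>" using Aut_lifts[OF \<alpha>] .
    let ?c = "\<alpha> \<otimes>\<^bsub>?A\<^esub> hom_incl n k f \<otimes>\<^bsub>?A\<^esub> inv\<^bsub>?A\<^esub> \<alpha>"
    have c: "?c \<in> carrier ?A" "aut_descend n (k + 1) k ?c = \<one>\<^bsub>AutoGroup (nilp n k)\<^esub>"
      using \<alpha> E.i_closed[OF f] by (simp_all only: E.G.m_closed E.G.inv_closed E.p_mult E.p_inv E.p_i[OF f]
          E.Q.r_one E.p_closed E.Q.r_inv)
    note g = E.unincl_props[OF c]
    have "hom_incl n k (E.unincl ?c) \<otimes>\<^bsub>?A\<^esub> \<alpha> = \<alpha> \<otimes>\<^bsub>?A\<^esub> hom_incl n k f"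
      unfolding g(2) using \<alpha> E.i_closed[OF f]
      by (simp only: E.G.m_assoc E.G.m_closed E.G.inv_closed E.G.l_inv E.G.r_one)
    then have "trace_alt n k (E.unincl ?c) = ext_map n k (mat n \<phi>) (trace_alt n k f)"
      by (rule trace_alt_equivariant[OF k l f g(1)])
    then show ?thesis using ext_act_lifts[OF lifts_descend[OF l] k] by simp
  qed
  then show ?thesis unfolding invariant_homs_def E.unincl_def using trace_alt_hom by blast
qed

section \<open>Evaluating the trace on left-normed brackets\<close>

text \<open>The argument of \<open>lbr\<close> lists the letters from the outermost to the innermost:
  \<open>lbr [c, b, a]\<close> is \<open>[[x_a, x_b], x_c]\<close> as a tensor. The linear functional with value
  \<open>e w\<close> at the word \<open>w\<close> takes the value \<open>ev e q\<close> at this tensor, and \<open>contr i e\<close> is its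
  composition with the contraction against \<open>x_i^*\<close>.\<close>

fun lbr :: "nat list \<Rightarrow> nat list \<Rightarrow> int" where
  "lbr [] w = 0"
| "lbr [a] w = of_bool (w = [a])"
| "lbr (a # b # p) w =
     tensor_mult (Suc (length p)) (lbr (b # p)) (\<lambda>v. of_bool (v = [a])) w -
     tensor_mult 1 (\<lambda>v. of_bool (v = [a])) (lbr (b # p)) w"

fun ev :: "(nat list \<Rightarrow> int) \<Rightarrow> nat list \<Rightarrow> int" where
  "ev e [] = 0"
| "ev e [a] = e [a]"
| "ev e (a # b # p) = ev (\<lambda>u. e (u @ [a]) - e (a # u)) (b # p)"

fun contr :: "nat \<Rightarrow> (nat list \<Rightarrow> int) \<Rightarrow> nat list \<Rightarrow> int" where
  "contr i e [] = 0"
| "contr i e (j # w) = of_bool (j = i) * e w"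

text \<open>\<open>ev\<close> is the transpose of bracketing: pairing e with P x_a - x_a P is
  pairing P with the functional whose value at u is e(u a) - e(a u).\<close>

lemma sum_lbr:
  assumes "set q \<subseteq> {..<m}" "q \<noteq> []"
  shows "(\<Sum>w\<in>index_words m (length q). e w * lbr q w) = ev e q"
  using assms
proof (induction e q rule: ev.induct)
  case (2 e a)
  have "(\<Sum>x<m. e [x] * of_bool (x = a)) = e [a]"
    using 2 by (simp add: of_bool_def if_distrib cong: if_cong)
  moreover have "(\<Sum>w\<in>index_words m (Suc 0). e w * lbr [a] w) = (\<Sum>x<m. e [x] * of_bool (x = a))"
    unfolding sum_index_words_Suc index_words_0 by (intro sum.cong) auto
  ultimately show ?case by simp
next
  case (3 e a b p)
  let ?q = "b # p" and ?k = "Suc (length p)"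
  have a: "a < m" using 3(2) by simp
  have pick: "(\<Sum>x<m. f x * of_bool (x = a)) = f a" for f :: "nat \<Rightarrow> int"
    using a by (simp add: of_bool_def if_distrib cong: if_cong)
  have "(\<Sum>w\<in>index_words m (Suc ?k). e w * tensor_mult ?k (lbr ?q) (\<lambda>v. of_bool (v = [a])) w) =
      (\<Sum>u\<in>index_words m ?k. \<Sum>x<m. (e (u @ [x]) * lbr ?q u) * of_bool (x = a))"
    unfolding sum_index_words_Suc'
    by (intro sum.cong refl) (auto simp: tensor_mult_def index_words_def)
  also have "\<dots> = (\<Sum>u\<in>index_words m ?k. e (u @ [a]) * lbr ?q u)" by (simp only: pick)
  finally have 1: "(\<Sum>w\<in>index_words m (Suc ?k). e w * tensor_mult ?k (lbr ?q) (\<lambda>v. of_bool (v = [a])) w) =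
      (\<Sum>u\<in>index_words m ?k. e (u @ [a]) * lbr ?q u)" .
  have "(\<Sum>w\<in>index_words m (Suc ?k). e w * tensor_mult 1 (\<lambda>v. of_bool (v = [a])) (lbr ?q) w) =
      (\<Sum>x<m. (\<Sum>u\<in>index_words m ?k. e (x # u) * lbr ?q u) * of_bool (x = a))"
    unfolding sum_index_words_Suc[of _ m ?k] sum_distrib_right
    by (intro sum.cong refl) (auto simp: tensor_mult_def)
  also have "\<dots> = (\<Sum>u\<in>index_words m ?k. e (a # u) * lbr ?q u)" by (simp only: pick)
  finally have 2: "(\<Sum>w\<in>index_words m (Suc ?k). e w * tensor_mult 1 (\<lambda>v. of_bool (v = [a])) (lbr ?q) w) =
      (\<Sum>u\<in>index_words m ?k. e (a # u) * lbr ?q u)" .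
  have "(\<Sum>w\<in>index_words m (Suc ?k). e w * lbr (a # b # p) w) =
      (\<Sum>u\<in>index_words m ?k. e (u @ [a]) * lbr ?q u) - (\<Sum>u\<in>index_words m ?k. e (a # u) * lbr ?q u)"
    unfolding 1[symmetric] 2[symmetric] by (simp add: right_diff_distrib sum_subtractf)
  also have "\<dots> = (\<Sum>u\<in>index_words m ?k. (e (u @ [a]) - e (a # u)) * lbr ?q u)"
    by (simp add: left_diff_distrib sum_subtractf)
  also have "\<dots> = ev e (a # b # p)" using 3 by simp
  finally show ?case by simp
qed simp

lemma sum_lbr_contr:
  assumes "set q \<subseteq> {..<m}" "length q = Suc k" "i < m"
  shows "(\<Sum>w\<in>index_words m k. e w * lbr q (i # w)) = ev (contr i e) q"
proof -
  have "ev (contr i e) q = (\<Sum>v\<in>index_words m (Suc k). contr i e v * lbr q v)"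
    using sum_lbr[OF assms(1), of "contr i e"] assms(2) by (cases q) (simp_all only: list.distinct list.size simp_thms)
  also have "\<dots> = (\<Sum>j<m. (\<Sum>w\<in>index_words m k. e w * lbr q (j # w)) * of_bool (j = i))"
    unfolding sum_index_words_Suc sum_distrib_right by (intro sum.cong refl) simp
  also have "\<dots> = (\<Sum>w\<in>index_words m k. e w * lbr q (i # w))"
    using assms(3) by (simp add: of_bool_def if_distrib cong: if_cong)
  finally show ?thesis by simp
qed

lemma ev_cong:
  "(\<And>u. length u = length q \<Longrightarrow> e u = e' u) \<Longrightarrow> ev e q = ev e' q"
proof (induction e q arbitrary: e' rule: ev.induct)
  case (3 e a b p)
  show ?case unfolding ev.simps by (rule 3(1)) (simp add: 3(2))
qed auto

lemma ev_diff: "ev (\<lambda>u. e u - e' u) q = ev e q - ev e' q"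
proof (induction e q arbitrary: e' rule: ev.induct)
  case (3 e a b p)
  have "ev (\<lambda>u. e u - e' u) (a # b # p) =
      ev (\<lambda>u. (e (u @ [a]) - e (a # u)) - (e' (u @ [a]) - e' (a # u))) (b # p)"
    unfolding ev.simps by (rule ev_cong) simp
  then show ?case using 3 by simp
qed auto

lemma ev_zero: "ev (\<lambda>u. 0) q = 0"
  using ev_diff[of "\<lambda>u. 0" "\<lambda>u. 0" q] by simp

lemma ev_scale: "ev (\<lambda>u. c * e u) q = c * ev e q"
proof (induction e q rule: ev.induct)
  case (3 e a b p)
  have "ev (\<lambda>u. c * e u) (a # b # p) = ev (\<lambda>u. c * (e (u @ [a]) - e (a # u))) (b # p)"
    unfolding ev.simps by (rule ev_cong) (simp add: algebra_simps)
  then show ?case using 3 by simp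
qed auto

text \<open>In P x_a the contraction still meets the first letter of P; in x_a P it removes x_a
  itself, and only if a = i, leaving all of P to be paired with \<open>e\<close>. That P has a first
  letter is the assumption on \<open>p\<close>.\<close>

lemma ev_contr_Cons:
  assumes "p \<noteq> []"
  shows "ev (contr i e) (a # p) = ev (contr i (\<lambda>u. e (u @ [a]))) p - of_bool (a = i) * ev e p"
proof -
  obtain b p' where p: "p = b # p'" using assms by (cases p) auto
  have "ev (contr i e) (a # p) = ev (\<lambda>u. contr i (\<lambda>u. e (u @ [a])) u - of_bool (a = i) * e u) p"
    unfolding p ev.simps
  proof (rule ev_cong)
    fix u :: "nat list" assume "length u = length (b # p')"
    then show "contr i e (u @ [a]) - contr i e (a # u) =
        contr i (\<lambda>u. e (u @ [a])) u - of_bool (a = i) * e u"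
      by (cases u) auto
  qed
  then show ?thesis by (simp only: ev_diff ev_scale)
qed

text \<open>An outer letter different from i contributes nothing on the left, where it would be
  contracted. Hence all letters of \<open>r\<close> end up on the right, the innermost first, which
  is the order of \<open>rev r\<close>.\<close>

lemma ev_contr_append:
  assumes "i \<notin> set r" "p \<noteq> []"
  shows "ev (contr i e) (r @ p) = ev (contr i (\<lambda>u. e (u @ rev r))) p"
  using assms by (induction r arbitrary: e) (auto simp: ev_contr_Cons)

lemma word_sign_rotate: "word_sign (u @ [a]) = (- 1) ^ length u * word_sign (a # u)"
proof -
  have "(\<Prod>l<length u. sgn (int a - int (u ! l))) = (\<Prod>l<length u. (- 1) * sgn (int (u ! l) - int a))"
    by (intro prod.cong) (auto simp: sgn_if)
  also have "\<dots> = (- 1) ^ length u * (\<Prod>l<length u. sgn (int (u ! l) - int a))"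
    by (simp only: prod.distrib prod_constant card_lessThan)
  finally show ?thesis by (simp add: word_sign_append1)
qed

lemma word_sign_strict_sorted: "sorted_wrt (<) w \<Longrightarrow> word_sign w = 1"
proof (induction w)
  case (Cons a w)
  have "(\<Prod>l<length w. sgn (int (w ! l) - int a)) = (\<Prod>l<length w. 1)"
    using Cons.prems by (intro prod.cong) (auto simp: sgn_if)
  then show ?case using Cons by simp
qed simp

text \<open>The image of a bracket of three or more letters in the exterior algebra vanishes, because the
  commutator of an element of even degree with any element is zero there.\<close>

lemma ev_word_sign:
  assumes "3 \<le> length q"
  shows "ev word_sign q = 0"
proof -
  obtain a b p where q: "q = a # b # p" "p \<noteq> []"
    using assms by (auto simp: Suc_le_length_iff numeral_3_eq_3)
  show ?thesis
  proof (cases "even (length (b # p))")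
    case True
    have "ev word_sign q = ev (\<lambda>u. 0) (b # p)"
      unfolding q ev.simps
    proof (rule ev_cong)
      fix u :: "nat list" assume "length u = length (b # p)"
      then show "word_sign (u @ [a]) - word_sign (a # u) = 0"
        using True unfolding word_sign_rotate by (simp del: word_sign.simps)
    qed
    then show ?thesis by (simp add: ev_zero)
  next
    case False
    obtain c p' where p: "p = c # p'" using q by (cases p) auto
    have "ev word_sign q = ev (\<lambda>u. 2 * word_sign (u @ [a])) (b # p)"
      unfolding q ev.simps
    proof (rule ev_cong)
      fix u :: "nat list" assume "length u = length (b # p)"
      then show "word_sign (u @ [a]) - word_sign (a # u) = 2 * word_sign (u @ [a])"
        using False unfolding word_sign_rotate by (simp del: word_sign.simps)
    qed
    \<comment> \<open>Now \<open>p\<close> has even length, so the inner bracket with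
      \<open>b\<close> already vanishes in the exterior algebra, and multiplying by \<open>a\<close>
      on the right keeps it zero.\<close>
    also have "\<dots> = 2 * ev (\<lambda>u. 0) p"
      unfolding ev_scale p ev.simps
    proof (intro arg_cong[of _ _ "(*) 2"] ev_cong)
      fix u :: "nat list" assume u: "length u = length (c # p')"
      then have "even (length u)" using False p by simp
      then have "word_sign (u @ [b]) = word_sign (b # u)"
        unfolding word_sign_rotate by (simp del: word_sign.simps)
      moreover have "(\<Prod>l<length (u @ [b]). sgn (int a - int ((u @ [b]) ! l))) =
          (\<Prod>l<length (b # u). sgn (int a - int ((b # u) ! l)))"
      proof -
        have "(\<Prod>l<length u. sgn (int a - int ((u @ [b]) ! l))) = (\<Prod>l<length u. sgn (int a - int (u ! l)))"
          by (intro prod.cong) (auto simp: nth_append)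
        then have "(\<Prod>l<length (u @ [b]). sgn (int a - int ((u @ [b]) ! l))) =
            sgn (int a - int b) * (\<Prod>l<length u. sgn (int a - int (u ! l)))"
          by simp
        also have "\<dots> = (\<Prod>l<length (b # u). sgn (int a - int ((b # u) ! l)))"
          by (simp add: prod.lessThan_Suc_shift del: prod.lessThan_Suc)
        finally show ?thesis .
      qed
      ultimately show "word_sign ((u @ [b]) @ [a]) - word_sign ((b # u) @ [a]) = 0"
        unfolding word_sign_append1 by simp
    qed
    finally show ?thesis by (simp add: ev_zero)
  qed
qed

section \<open>The values of the determinant form at the two traces\<close>

lemma word_sign_range:
  assumes "2 \<le> k"
  shows "word_sign (0 # 1 # [2..<k]) = 1" "word_sign (1 # 0 # [2..<k]) = - 1"
proof -
  show "word_sign (0 # 1 # [2..<k]) = 1"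
    by (rule word_sign_strict_sorted) auto
  have "(\<Prod>l<length [2..<k]. sgn (int ([2..<k] ! l) - int 1)) = (\<Prod>l<length [2..<k]. 1)"
    by (intro prod.cong) (auto simp: sgn_if)
  moreover have "word_sign (0 # [2..<k]) = 1" by (rule word_sign_strict_sorted) auto
  ultimately show "word_sign (1 # 0 # [2..<k]) = - 1"
    by (simp add: prod.lessThan_Suc_shift del: prod.lessThan_Suc)
qed

text \<open>The bracket contracted against x_0 contains x_0 twice: the inner copy yields -1 and the
  outer one -2. The other bracket yields (-1)^k, so the difference is nonzero for either parity of
  k.\<close>

lemma trace_value_odd:
  assumes "3 \<le> k"
  defines "l \<equiv> 0 # [2..<k]"
  shows "ev (contr 1 word_sign) (1 # rev l @ [1]) - ev (contr 0 word_sign) (rev l @ [1, 0]) = 3 + (- 1) ^ k"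
proof -
  have "ev (contr 0 word_sign) (rev l @ [1, 0]) =
      ev (contr 0 (\<lambda>u. word_sign (u @ [2..<k]))) [0, 1, 0]"
    unfolding l_def using ev_contr_append[of 0 "rev [2..<k]" "[0, 1, 0]" word_sign] by simp
  also have "\<dots> = - 3" using word_sign_range[of k] assms(1) by (simp del: word_sign.simps)
  finally have 1: "ev (contr 0 word_sign) (rev l @ [1, 0]) = - 3" .
  \<comment> \<open>This is the term in which the contraction removes the outermost 1. What remains
    is a bracket of k letters, zero in the exterior algebra because k is at least 3.\<close>
  have "ev word_sign (rev [2..<k] @ [0, 1]) = 0"
    using assms(1) by (intro ev_word_sign) simp
  then have "ev (contr 1 word_sign) (1 # rev l @ [1]) =
      ev (contr 1 (\<lambda>u. word_sign (u @ [1]))) (rev [2..<k] @ [0, 1])"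
    unfolding l_def by (simp add: ev_contr_Cons)
  also have "\<dots> = ev (contr 1 (\<lambda>u. word_sign (u @ [2..<k] @ [1]))) [0, 1]"
    using ev_contr_append[of 1 "rev [2..<k]" "[0, 1]" "\<lambda>u. word_sign (u @ [1])"] by simp
  also have "\<dots> = word_sign ((0 # [2..<k]) @ [1])" by (simp del: word_sign.simps)
  also have "\<dots> = (- 1) ^ k"
    unfolding word_sign_rotate using word_sign_range(2)[of k] assms(1)
    by (simp add: minus_one_power_iff del: word_sign.simps)
  finally show ?thesis using 1 by simp
qed

text \<open>Each bracket contains its contracted letter twice. Contracting the inner copies gives 1
  and -1. Contracting the outermost copies leaves brackets of k letters, which vanish for k > 2 and
  for k = 2 add with the same sign; positivity covers both cases.\<close>

lemma trace_value_even:
  assumes "2 \<le> k" "even k"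
  defines "l \<equiv> [2..<k] @ [0]"
  shows "ev (contr 1 word_sign) (1 # rev l @ [1]) - ev (contr 0 word_sign) (rev l @ [1, 0]) > 0"
proof -
  have small: "ev word_sign q \<in> {0, - 2}" if "q = rev [2..<k] @ [0, 1] \<or> q = 0 # rev [2..<k] @ [1]" for q
  proof (cases "k = 2")
    case True
    then have "q = [0, 1]" using that by auto
    then show ?thesis by (simp add: lessThan_Suc)
  next
    case False
    then have "ev word_sign q = 0" using that assms(1) by (intro ev_word_sign) auto
    then show ?thesis by simp
  qed
  \<comment> \<open>For general k this sign is (-1)^(k-1), and the difference of the two main terms
    is 1 + (-1)^k. This is where evenness enters.\<close>
  have rot: "word_sign (1 # [2..<k] @ [0]) = - 1"
    using word_sign_rotate[of "1 # [2..<k]" 0] word_sign_range(1)[OF assms(1)] assms(1,2)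
    by (simp add: minus_one_power_iff del: word_sign.simps)
  have "ev (contr 0 word_sign) (rev l @ [1, 0]) =
      ev (contr 0 (\<lambda>u. word_sign (u @ [0]))) (rev [2..<k] @ [1, 0]) - ev word_sign (rev [2..<k] @ [1, 0])"
    unfolding l_def by (simp add: ev_contr_Cons)
  also have "ev (contr 0 (\<lambda>u. word_sign (u @ [0]))) (rev [2..<k] @ [1, 0]) =
      ev (contr 0 (\<lambda>u. word_sign (u @ [2..<k] @ [0]))) [1, 0]"
    using ev_contr_append[of 0 "rev [2..<k]" "[1, 0]" "\<lambda>u. word_sign (u @ [0])"] by simp
  also have "\<dots> = - 1" using rot by (simp del: word_sign.simps)
  finally have 0: "ev (contr 0 word_sign) (rev l @ [1, 0]) = - 1 - ev word_sign (rev [2..<k] @ [1, 0])" .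
  have "ev word_sign (rev [2..<k] @ [1, 0]) \<in> {0, 2}"
  proof (cases "k = 2")
    case False
    then have "ev word_sign (rev [2..<k] @ [1, 0]) = 0" using assms(1) by (intro ev_word_sign) auto
    then show ?thesis by simp
  qed (simp add: lessThan_Suc)
  moreover have "ev (contr 1 word_sign) (1 # rev l @ [1]) =
      ev (contr 1 (\<lambda>u. word_sign (u @ [1]))) ((0 # rev [2..<k]) @ [1]) - ev word_sign (0 # rev [2..<k] @ [1])"
    using ev_contr_Cons[of "0 # rev [2..<k] @ [1]" 1 word_sign 1] by (simp add: l_def del: ev.simps)
  moreover have "ev (contr 1 (\<lambda>u. word_sign (u @ [1]))) ((0 # rev [2..<k]) @ [1]) =
      word_sign (([2..<k] @ [0]) @ [1])"
    by (subst ev_contr_append) (auto simp del: word_sign.simps)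
  moreover have "\<dots> = 1"
    unfolding word_sign_rotate[of "[2..<k] @ [0]"] using rot assms(1,2)
    by (simp add: minus_one_power_iff del: word_sign.simps)
  ultimately show ?thesis using 0 small[of "0 # rev [2..<k] @ [1]"] by auto
qed

section \<open>Two commuting classes whose lifts do not commute\<close>

lemma lead_commutator_lbr:
  assumes x: "x \<in> \<Gamma> n (Suc m)" "lead n (Suc m) x = lbr q" "length q = Suc m"
    and y: "y \<in> carrier (free_group n)" "lead n 1 y = (\<lambda>w. of_bool (w = [i]))"
  shows "lead n (Suc (Suc m)) (commutator (free_group n) x y) = lbr (i # q)"
proof -
  obtain b p where q: "q = b # p" "length p = m" using x(3) by (cases q) auto
  have "lead n (Suc m + 1) (commutator (free_group n) x y) = (\<lambda>w.
      tensor_mult (Suc m) (lead n (Suc m) x) (lead n 1 y) w - tensor_mult 1 (lead n 1 y) (lead n (Suc m) x) w)"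
    using x y by (intro lead_commutator) auto
  then show ?thesis unfolding x(2) y(2) by (auto simp: q fun_eq_iff)
qed

fun left_normed :: "nat \<Rightarrow> (nat \<times> bool) list \<Rightarrow> nat list \<Rightarrow> (nat \<times> bool) list" where
  "left_normed n x [] = x"
| "left_normed n x (i # l) = left_normed n (commutator (free_group n) x (gen i)) l"

lemma left_normed_snoc:
  "left_normed n x (l @ [i]) = commutator (free_group n) (left_normed n x l) (gen i)"
  by (induction l arbitrary: x) auto

lemma left_normed_in:
  "\<lbrakk>x \<in> \<Gamma> n (Suc m); set l \<subseteq> {..<n}\<rbrakk> \<Longrightarrow> left_normed n x l \<in> \<Gamma> n (Suc (m + length l))"
proof (induction l arbitrary: x m)
  case (Cons i l)
  then show ?case
    using F.commutator_in_lower_central[of x n "Suc m" "gen i"] Cons.IH[of "commutator (free_group n) x (gen i)" "Suc m"]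
    by simp
qed simp

lemma lead_left_normed:
  "\<lbrakk>x \<in> \<Gamma> n (Suc m); lead n (Suc m) x = lbr q; length q = Suc m; set l \<subseteq> {..<n}\<rbrakk> \<Longrightarrow>
    lead n (Suc (m + length l)) (left_normed n x l) = lbr (rev l @ q)"
proof (induction l arbitrary: x m q)
  case (Cons i l)
  have "lead n (Suc (Suc m)) (commutator (free_group n) x (gen i)) = lbr (i # q)"
    using Cons.prems lead_gen[of i n] by (intro lead_commutator_lbr) auto
  then show ?case
    using Cons.prems F.commutator_in_lower_central[of x n "Suc m" "gen i"]
      Cons.IH[of "commutator (free_group n) x (gen i)" "Suc m" "i # q"]
    by simp
qed simp

lemma endo_fixes_left_normed:
  assumes \<phi>: "\<phi> \<in> hom (free_group n) (free_group n)" and x: "x \<in> carrier (free_group n)" "\<phi> x = x"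
    and "\<And>i. i \<in> set l \<Longrightarrow> i < n \<and> \<phi> (gen i) = gen i"
  shows "\<phi> (left_normed n x l) = left_normed n x l"
  using x assms(4)
proof (induction l arbitrary: x)
  case (Cons i l)
  have "\<phi> (commutator (free_group n) x (gen i)) = commutator (free_group n) x (gen i)"
    using Cons.prems by (simp add: hom_commutator[OF F.is_group F.is_group \<phi>])
  then show ?case using Cons by simp
qed simp

text \<open>If \<open>\<beta>\<close> fixes \<open>g\<close> and \<open>\<beta>(x) = d x\<close>, then \<open>\<beta>[x, g] = [d x, g] = [d, x g x^-1] [x, g]\<close>.
  Hence the error term \<open>d\<close> changes like a left-normed commutator, up to terms of higher degree.\<close>

lemma endo_left_normed:
  assumes \<phi>: "\<phi> \<in> hom (free_group n) (free_group n)"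
  shows "\<lbrakk>x \<in> carrier (free_group n); d \<in> \<Gamma> n (Suc m); lead n (Suc m) d = lbr q; length q = Suc m;
      \<phi> x = d \<otimes>\<^bsub>free_group n\<^esub> x; \<And>i. i \<in> set l \<Longrightarrow> i < n \<and> \<phi> (gen i) = gen i\<rbrakk> \<Longrightarrow>
    \<exists>d'\<in>\<Gamma> n (Suc (m + length l)). \<phi> (left_normed n x l) = d' \<otimes>\<^bsub>free_group n\<^esub> left_normed n x l \<and>
      lead n (Suc (m + length l)) d' = lbr (rev l @ q)"
proof (induction l arbitrary: x d m q)
  case (Cons i l)
  let ?g = "gen i" and ?c = "commutator (free_group n)"
  let ?h = "x \<otimes>\<^bsub>free_group n\<^esub> ?g \<otimes>\<^bsub>free_group n\<^esub> inv\<^bsub>free_group n\<^esub> x"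
  have i: "i < n" "\<phi> ?g = ?g" using Cons.prems(6) by auto
  have d: "d \<in> carrier (free_group n)" using Cons.prems(2) by (rule F.lower_central_closed)
  have g: "?g \<in> \<Gamma> n 1" using i by simp
  have "lead n 1 ?h = (\<lambda>w. of_bool (w = [i]))"
    using lead_conj[OF g Cons.prems(1)] lead_gen[OF i(1)] by simp
  then have lead: "lead n (Suc (Suc m)) (?c d ?h) = lbr (i # q)"
    using Cons.prems i by (intro lead_commutator_lbr) auto
  have mem: "?c d ?h \<in> \<Gamma> n (Suc (Suc m))"
    using Cons.prems(1,2) i by (intro F.commutator_in_lower_central) auto
  have "\<phi> (?c x ?g) = ?c (d \<otimes>\<^bsub>free_group n\<^esub> x) ?g"
    using Cons.prems(1,5) i by (simp add: hom_commutator[OF F.is_group F.is_group \<phi>])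
  also have "\<dots> = ?c d ?h \<otimes>\<^bsub>free_group n\<^esub> ?c x ?g"
    using Cons.prems(1) d i by (simp add: commutator_def F.m_assoc F.inv_mult_group)
  finally have eq: "\<phi> (?c x ?g) = ?c d ?h \<otimes>\<^bsub>free_group n\<^esub> ?c x ?g" .
  show ?case
    using Cons.IH[OF _ mem lead _ eq] Cons.prems i by simp
qed auto

text \<open>The endomorphisms \<open>a\<close> and \<open>b\<close> commute modulo \<open>\<Gamma>(k+1)\<close>. With \<open>c\<close> the given left-normed
  commutator, \<open>a b (b a)^-1\<close> sends \<open>x_0\<close> to \<open>c b(c)^-1 x_0\<close> and \<open>x_1\<close> to
  \<open>[c, x_0 x_1 x_0^-1] x_1\<close> in \<open>F/\<Gamma>(k+2)\<close> and fixes the other generators.\<close>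

proposition commutator_relation:
  assumes k: "2 \<le> k" "k \<le> n" and l: "length l = k - 1" "set l \<subseteq> {..<n}" "1 \<notin> set l"
    and a: "a \<in> hom (free_group n) (free_group n)"
      "a (gen 0) = left_normed n (gen 1) l \<otimes>\<^bsub>free_group n\<^esub> gen 0"
      "\<And>i. \<lbrakk>0 < i; i < n\<rbrakk> \<Longrightarrow> a (gen i) = gen i"
    and b: "b \<in> hom (free_group n) (free_group n)"
      "b (gen 1) = gen 0 \<otimes>\<^bsub>free_group n\<^esub> gen 1 \<otimes>\<^bsub>free_group n\<^esub> inv\<^bsub>free_group n\<^esub> gen 0"
      "\<And>i. \<lbrakk>i \<noteq> 1; i < n\<rbrakk> \<Longrightarrow> b (gen i) = gen i"
  obtains f where "f \<in> carrier (johnson_target n k)"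
    "ind n (k + 1) (a \<circ> b) = compose (carrier (nilp n (k + 1))) (hom_incl n k f) (ind n (k + 1) (b \<circ> a))"
    "dual_lie_embedding n k f 0 = (\<lambda>w. - lbr (rev l @ [1, 0]) w)"
    "dual_lie_embedding n k f 1 = lbr (1 # rev l @ [1])"
    "\<And>i. \<lbrakk>2 \<le> i; i < n\<rbrakk> \<Longrightarrow> dual_lie_embedding n k f i = (\<lambda>w. 0)"
proof -
  define c where "c = left_normed n (gen 1) l"
  define s where "s = gen 0 \<otimes>\<^bsub>free_group n\<^esub> gen 1 \<otimes>\<^bsub>free_group n\<^esub> inv\<^bsub>free_group n\<^esub> gen 0"
  have n: "0 < n" "1 < n" using k by auto
  have g1: "gen 1 \<in> \<Gamma> n (Suc 0)" using n by simp
  have kl: "Suc (length l) = k" using k l by simp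
  have c: "c \<in> \<Gamma> n k" using left_normed_in[OF g1 l(2)] kl by (simp add: c_def)
  have lead_g1: "lead n (Suc 0) (gen 1) = lbr [1]"
    using lead_gen[OF n(2)] by (simp add: fun_eq_iff)
  have lead_c: "lead n k c = lbr (rev l @ [1])"
    using lead_left_normed[OF g1 lead_g1 _ l(2)] kl by (simp add: c_def)
  have car: "c \<in> carrier (free_group n)" "s \<in> carrier (free_group n)" "gen 0 \<in> carrier (free_group n)"
    "gen 1 \<in> carrier (free_group n)" "b c \<in> carrier (free_group n)"
    using c n b(1) F.lower_central_closed by (auto simp: s_def)
  let ?d0 = "commutator (free_group n) (gen 0) (gen 1)"
  have d0: "?d0 \<in> \<Gamma> n (Suc 1)" using car by (intro F.commutator_in_lower_central) auto
  have lead_d0: "lead n (Suc 1) ?d0 = lbr [1, 0]"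
    using lead_commutator_lbr[of "gen 0" n 0 "[0]" "gen 1" 1] n lead_gen[OF n(1)] lead_gen[OF n(2)]
    by (simp add: fun_eq_iff)
  have b1: "b (gen 1) = ?d0 \<otimes>\<^bsub>free_group n\<^esub> gen 1"
    using b(2) car by (simp add: commutator_def F.m_assoc)
  have fixed: "i < n \<and> b (gen i) = gen i" if "i \<in> set l" for i
    using that l(2,3) b(3)[of i] by (cases "i = 1") auto
  obtain d where d: "d \<in> \<Gamma> n (Suc (1 + length l))" "b c = d \<otimes>\<^bsub>free_group n\<^esub> c"
    "lead n (Suc (1 + length l)) d = lbr (rev l @ [1, 0])"
    using endo_left_normed[OF b(1) car(4) d0 lead_d0 _ b1 fixed] by (auto simp: c_def)
  have d': "d \<in> \<Gamma> n (k + 1)" "lead n (k + 1) d = lbr (rev l @ [1, 0])" using d kl by simp_all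
  have d_car: "d \<in> carrier (free_group n)" using d' F.lower_central_closed by blast
  \<comment> \<open>Since b(c) = d c, the factor c b(c)^-1 is the inverse of \<open>d\<close>; this
    is the origin of the minus sign in the coefficient at the dual of x_0.\<close>
  define y where "y i = (if i = 0 then inv\<^bsub>free_group n\<^esub> d else if i = 1 then commutator (free_group n) c s else \<one>\<^bsub>free_group n\<^esub>)" for i :: nat
  have y: "y i \<in> \<Gamma> n (k + 1)" for i
    using d' F.commutator_in_lower_central[OF c car(2)] k by (auto simp: y_def)
  have y_car: "y i \<in> carrier (free_group n)" for i using y F.lower_central_closed by blast
  \<comment> \<open>Prescribing an endomorphism on the generators needs no consistency check;
    \<open>central_endo\<close> then turns it into a well-defined homomorphism on H.\<close>
  obtain \<kappa> where \<kappa>: "\<kappa> \<in> hom (free_group n) (free_group n)" "\<And>i. i < n \<Longrightarrow> \<kappa> (gen i) = y i \<otimes>\<^bsub>free_group n\<^esub> gen i"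
    using exists_endo[of n "\<lambda>i. y i \<otimes>\<^bsub>free_group n\<^esub> gen i"] y_car by auto
  have "cl n (k + 1) (\<kappa> x) = cl n (k + 1) x" if "x \<in> carrier (free_group n)" for x
    using cl_eq_on_generators[OF \<kappa>(1) endo_id _ that, of k] \<kappa>(2) y by (simp add: cl_cancel)
  then obtain f where f: "f \<in> carrier (johnson_target n k)"
    "\<And>x. x \<in> carrier (free_group n) \<Longrightarrow> f (cl n 2 x) = cl n (k + 2) (\<kappa> x \<otimes>\<^bsub>free_group n\<^esub> inv\<^bsub>free_group n\<^esub> x)"
    using central_endo[OF \<kappa>(1)] by metis
  have f_gen: "f (cl n 2 (gen i)) = cl n (k + 2) (y i)" if "i < n" for i
    using f(2)[of "gen i"] \<kappa>(2)[OF that] that y_car[of i] by (simp add: F.m_assoc)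
  have dual: "dual_lie_embedding n k f i = lead n (k + 1) (y i)" if "i < n" for i
    using f_gen[OF that] lie_embedding_cl[OF _ y] by (simp add: dual_lie_embedding_def)
  have lead_s: "lead n 1 s = (\<lambda>w. of_bool (w = [1]))"
    using lead_conj[of "gen 1" n 1 "gen 0"] car lead_gen[OF n(2)] by (simp add: s_def)
  have "lead n (Suc (Suc (length l))) (commutator (free_group n) c s) = lbr (1 # rev l @ [1])"
    using c lead_c kl car lead_s by (intro lead_commutator_lbr) simp_all
  then have lead_y1: "lead n (k + 1) (y 1) = lbr (1 # rev l @ [1])" using kl by (simp add: y_def)
  have lead_y0: "lead n (k + 1) (y 0) = (\<lambda>w. - lbr (rev l @ [1, 0]) w)"
    using lead_inv[OF d'(1)] d'(2) by (simp add: y_def)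
  \<comment> \<open>\<open>hom_incl\<close> evaluates \<open>f\<close> at classes in H, so the
    images of x_0 and x_1 under b a must be shown to have the classes of x_0 and x_1.\<close>
  have "c \<in> \<Gamma> n 2" "b c \<in> \<Gamma> n 2"
    using c hom_lower_central[OF F.is_group F.is_group b(1) c] F.lower_central_antimono[of 2 k n] k by auto
  then have cl2: "cl n 2 (b c \<otimes>\<^bsub>free_group n\<^esub> gen 0) = cl n 2 (gen 0)" using car by (simp add: cl_cancel)
  have cls: "cl n 2 s = cl n 2 (gen 1)" using car by (simp add: s_def cl_conj)
  have ab: "a \<circ> b \<in> hom (free_group n) (free_group n)" "b \<circ> a \<in> hom (free_group n) (free_group n)"
    using endo_compose a(1) b(1) by auto
  interpret a: group_hom "free_group n" "free_group n" a by unfold_locales (rule a(1))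
  interpret b: group_hom "free_group n" "free_group n" b by unfold_locales (rule b(1))
  have gens: "cl n (k + 2) (a (b (gen i))) = hom_incl n k f (cl n (k + 2) (b (a (gen i))))" if i: "i < n" for i
  proof -
    consider "i = 0" | "i = 1" | "2 \<le> i" by linarith
    then show ?thesis
    proof cases
      case 1
      have "b (a (gen 0)) = b c \<otimes>\<^bsub>free_group n\<^esub> gen 0" using a(2) b(3)[of 0] n car by (simp add: c_def)
      moreover have "hom_incl n k f (cl n (k + 2) (b c \<otimes>\<^bsub>free_group n\<^esub> gen 0)) = cl n (k + 2) (y 0 \<otimes>\<^bsub>free_group n\<^esub> (b c \<otimes>\<^bsub>free_group n\<^esub> gen 0))"
        using car y f_gen[OF n(1)] cl2 by (intro hom_incl_cl_eq) auto
      moreover have "y 0 \<otimes>\<^bsub>free_group n\<^esub> (b c \<otimes>\<^bsub>free_group n\<^esub> gen 0) = c \<otimes>\<^bsub>free_group n\<^esub> gen 0"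
        using d(2) d_car car by (simp add: y_def F.m_assoc)
      ultimately show ?thesis using 1 a(2) b(3)[of 0] n by (simp add: c_def)
    next
      case 2
      have "b (a (gen 1)) = s" using a(3)[of 1] b(2) n by (simp add: s_def)
      moreover have "hom_incl n k f (cl n (k + 2) s) = cl n (k + 2) (y 1 \<otimes>\<^bsub>free_group n\<^esub> s)"
        using car y f_gen[OF n(2)] cls by (intro hom_incl_cl_eq) auto
      \<comment> \<open>Since a(x_0) = c x_0, the left side is the conjugate c s c^-1, which equals
        [c, s] s.\<close>
      moreover have "a (b (gen 1)) = y 1 \<otimes>\<^bsub>free_group n\<^esub> s"
      proof -
        have "a (gen 0) = c \<otimes>\<^bsub>free_group n\<^esub> gen 0" "a (gen 1) = gen 1" using a(2) a(3)[of 1] n by (simp_all add: c_def)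
        then have "a (b (gen 1)) = c \<otimes>\<^bsub>free_group n\<^esub> gen 0 \<otimes>\<^bsub>free_group n\<^esub> gen 1 \<otimes>\<^bsub>free_group n\<^esub> inv\<^bsub>free_group n\<^esub> (c \<otimes>\<^bsub>free_group n\<^esub> gen 0)"
          unfolding b(2) using car by simp
        then show ?thesis using car by (simp add: y_def s_def commutator_def F.m_assoc F.inv_mult_group)
      qed
      ultimately show ?thesis using 2 by simp
    next
      case 3
      have "hom_incl n k f (cl n (k + 2) (gen i)) = cl n (k + 2) (\<one>\<^bsub>free_group n\<^esub> \<otimes>\<^bsub>free_group n\<^esub> gen i)"
        using i 3 f_gen[OF i] by (intro hom_incl_cl_eq) (auto simp: y_def)
      then show ?thesis using 3 i a(3)[of i] b(3)[of i] by simp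
    qed
  qed
  have nl: "compose (carrier (nilp n (k + 1))) (hom_incl n k f) (ind n (k + 1) (b \<circ> a)) =
      ind n (k + 1) (a \<circ> b)"
  proof -
    let ?R = "compose (carrier (nilp n (k + 1))) (hom_incl n k f) (ind n (k + 1) (b \<circ> a))"
    have R: "?R \<in> hom (nilp n (k + 1)) (nilp n (k + 1))"
      using N.hom_compose[OF ind_hom[OF ab(2)] hom_incl_hom[OF f(1)]] .
    \<comment> \<open>Lifting the composite back to an endomorphism of the free group allows the
      comparison to be made on generators only.\<close>
    obtain \<rho> where \<rho>: "\<rho> \<in> hom (free_group n) (free_group n)" "?R = ind n (k + 1) \<rho>"
      by (rule nilp_hom_lift[OF R]) simp_all
    have "cl n (Suc (k + 1)) (\<rho> (gen i)) = cl n (Suc (k + 1)) (a (b (gen i)))" if i: "i < n" for i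
    proof -
      have C: "cl n (Suc (k + 1)) (gen i) \<in> carrier (nilp n (k + 1))" using i by (simp add: nilp_carrier)
      have "cl n (Suc (k + 1)) (\<rho> (gen i)) = ?R (cl n (Suc (k + 1)) (gen i))"
        using ind_cl[OF \<rho>(1), of "gen i"] i \<rho>(2) by simp
      also have "\<dots> = hom_incl n k f (cl n (Suc (k + 1)) (b (a (gen i))))"
        using C ind_cl[OF ab(2), of "gen i" "k + 1"] i by (simp only: compose_eq comp_apply gen_closed)
      finally show ?thesis using gens[OF i] by simp
    qed
    then have "cl n (Suc (k + 1)) (\<rho> x) = cl n (Suc (k + 1)) ((a \<circ> b) x)" if "x \<in> carrier (free_group n)" for x
      using cl_eq_on_generators[OF \<rho>(1) ab(1) _ that, of "k + 1"] by simp
    then show ?thesis unfolding \<rho>(2) by (intro ind_eqI \<rho>(1) ab(1))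
  qed
  show ?thesis
  proof (rule that[OF f(1) nl[symmetric]])
    show "dual_lie_embedding n k f 0 = (\<lambda>w. - lbr (rev l @ [1, 0]) w)" using dual[OF n(1)] lead_y0 by simp
    show "dual_lie_embedding n k f 1 = lbr (1 # rev l @ [1])" using dual[OF n(2)] lead_y1 by simp
    show "dual_lie_embedding n k f i = (\<lambda>w. 0)" if "2 \<le> i" "i < n" for i
      using dual[OF that(2)] that lead_one[of "k + 1" n] by (simp add: y_def)
  qed
qed

text \<open>The letters are required to be below \<open>k\<close>, not merely below
  \<open>n\<close>, because the determinant form sees only words in the first \<open>k\<close>
  letters.\<close>

lemma trace_alt_nontrivial:
  assumes k: "2 \<le> k" "k \<le> n" and l: "length l = k - 1" "set l \<subseteq> {..<k}"
    and f: "dual_lie_embedding n k f 0 = (\<lambda>w. - lbr (rev l @ [1, 0]) w)"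
      "dual_lie_embedding n k f 1 = lbr (1 # rev l @ [1])"
      "\<And>i. \<lbrakk>2 \<le> i; i < n\<rbrakk> \<Longrightarrow> dual_lie_embedding n k f i = (\<lambda>w. 0)"
    and nz: "ev (contr 1 word_sign) (1 # rev l @ [1]) - ev (contr 0 word_sign) (rev l @ [1, 0]) \<noteq> 0"
  shows "trace_alt n k f \<noteq> \<one>\<^bsub>ext_power_rat n k\<^esub>"
proof
  assume "trace_alt n k f = \<one>\<^bsub>ext_power_rat n k\<^esub>"
  then have "trace_tensor n k (dual_lie_embedding n k f) \<in> alt_relations n k"
    unfolding trace_alt_eq by (simp add: ext_proj_eq_one_iff trace_tensor_closed)
  then have zero: "det_form k (trace_tensor n k (dual_lie_embedding n k f)) = 0"
    by (rule det_form_alt_relations[OF k(2)])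
  let ?D = "dual_lie_embedding n k f"
  have "contraction n k ?D w = lbr (1 # rev l @ [1]) (1 # w) - lbr (rev l @ [1, 0]) (0 # w)"
    if w: "w \<in> index_words k k" for w
  proof -
    have "{..<n} = {0, 1} \<union> {2..<n}" using k by auto
    then have "(\<Sum>i<n. ?D i (i # w)) = ?D 0 (0 # w) + ?D 1 (1 # w) + (\<Sum>i\<in>{2..<n}. ?D i (i # w))"
      by (simp add: sum.union_disjoint)
    moreover have "(\<Sum>i\<in>{2..<n}. ?D i (i # w)) = 0"
      by (rule sum.neutral) (simp add: f(3))
    moreover have "w \<in> index_words n k" using w k(2) by (auto simp: index_words_def)
    ultimately show ?thesis by (simp add: contraction_def f(1) f(2)[unfolded One_nat_def])
  qed
  then have "det_form k (trace_tensor n k ?D) = of_int (\<Sum>w\<in>index_words k k.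
      word_sign w * (lbr (1 # rev l @ [1]) (1 # w) - lbr (rev l @ [1, 0]) (0 # w)))"
    by (simp add: det_form_def trace_tensor_def)
  also have "(\<Sum>w\<in>index_words k k. word_sign w * (lbr (1 # rev l @ [1]) (1 # w) - lbr (rev l @ [1, 0]) (0 # w))) =
      ev (contr 1 word_sign) (1 # rev l @ [1]) - ev (contr 0 word_sign) (rev l @ [1, 0])"
    unfolding right_diff_distrib sum_subtractf
    using l k by (intro arg_cong2[of _ _ _ _ "(-)"] sum_lbr_contr) auto
  finally show False using zero nz by simp
qed

section \<open>The extension of the full automorphism groups\<close>

text \<open>Here the endomorphism is prescribed, unlike in \<open>Aut_lifts\<close>. An inverse
  belonging to any other lift also serves for \<open>\<phi>\<close>, since the two lifts agree
  modulo \<Gamma>(k+1).\<close>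

lemma Aut_lift:
  assumes "\<phi> \<in> hom (free_group n) (free_group n)" "ind n k \<phi> \<in> carrier (AutoGroup (nilp n k))"
  obtains \<psi> where "lifts n k (ind n k \<phi>) \<phi> \<psi>"
proof -
  obtain \<phi>' \<psi> where l: "lifts n k (ind n k \<phi>) \<phi>' \<psi>" using Aut_lifts[OF assms(2)] .
  then have h: "\<phi>' \<in> hom (free_group n) (free_group n)" "\<psi> \<in> hom (free_group n) (free_group n)"
    "ind n k \<phi> = ind n k \<phi>'"
    by (auto simp: lifts_def)
  have eq: "cl n (Suc k) (\<phi> x) = cl n (Suc k) (\<phi>' x)" if "x \<in> carrier (free_group n)" for x
    using ind_cl[OF assms(1) that, of k] ind_cl[OF h(1) that, of k] h(3) by simp
  have "cl n (Suc k) (\<psi> (\<phi> x)) = cl n (Suc k) (\<psi> (\<phi>' x))" if "x \<in> carrier (free_group n)" for x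
    using endo_cl_eq[OF h(2) eq[OF that]] that assms(1) h(1) by simp
  then have "lifts n k (ind n k \<phi>) \<phi> \<psi>"
    using l eq h assms(1) by (auto simp: lifts_def)
  then show ?thesis by (rule that)
qed

text \<open>At class 1 the identity is an inverse, and \<open>ind_Aut_Suc\<close> raises the class
  by one. This is why \<open>a\<close> may be prescribed freely for the full automorphism
  groups.\<close>

lemma lifts_identity_on_H:
  assumes "1 \<le> m" and \<phi>: "\<phi> \<in> hom (free_group n) (free_group n)"
    and triv: "\<And>x. x \<in> carrier (free_group n) \<Longrightarrow> cl n 2 (\<phi> x) = cl n 2 x"
  shows "\<exists>\<psi>. lifts n m (ind n m \<phi>) \<phi> \<psi>"
  using assms(1)
proof (induction m rule: dec_induct)
  case base
  have "lifts n 1 (ind n 1 \<phi>) \<phi> (\<lambda>x. x)"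
    using \<phi> triv by (simp add: lifts_def endo_id numeral_2_eq_2)
  then show ?case by blast
next
  case (step m)
  then obtain \<psi> where l: "lifts n m (ind n m \<phi>) \<phi> \<psi>" by blast
  have "ind n (m + 1) \<phi> \<in> carrier (AutoGroup (nilp n (m + 1)))" using step(1) l by (rule ind_Aut_Suc)
  then show ?case using Aut_lift[OF \<phi>, of "m + 1"] by auto
qed

lemma transgression_Hom_nontrivial:
  assumes k: "3 \<le> k" "k \<le> n"
  shows "transgression (johnson_target n k) (hom_incl n k) (AutoGroup (nilp n (k + 1)))
      (aut_descend n (k + 1) k) (AutoGroup (nilp n k)) (ext_power_rat n k) (ext_act n k) (trace_alt n k)
    \<in> carrier (cohomology2 (AutoGroup (nilp n k)) (ext_power_rat n k) (ext_act n k))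
      - {\<one>\<^bsub>cohomology2 (AutoGroup (nilp n k)) (ext_power_rat n k) (ext_act n k)\<^esub>}"
proof -
  have k1: "1 \<le> k" and n: "0 < n" "1 < n" using k by auto
  interpret E: module_extension "johnson_target n k" "AutoGroup (nilp n (k + 1))" "AutoGroup (nilp n k)"
    "ext_power_rat n k" "hom_incl n k" "aut_descend n (k + 1) k" "ext_act n k"
    by (rule module_extension_nilp[OF k1])
  define l where "l = 0 # [2..<k]"
  have l: "length l = k - 1" "set l \<subseteq> {..<n}" "1 \<notin> set l" "set l \<subseteq> {..<k}"
    using k by (auto simp: l_def)
  define c where "c = left_normed n (gen 1) l"
  have c: "c \<in> \<Gamma> n k" using left_normed_in[of "gen 1" n 0 l] n l k by (simp add: c_def)
  have car: "c \<in> carrier (free_group n)" "gen 0 \<in> carrier (free_group n)" "gen 1 \<in> carrier (free_group n)"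
    using c n F.lower_central_closed by auto
  have c2: "c \<in> \<Gamma> n 2" using c F.lower_central_antimono[of 2 k n] k by auto
  obtain a where a: "a \<in> hom (free_group n) (free_group n)"
    "\<And>i. i < n \<Longrightarrow> a (gen i) = (if i = 0 then c \<otimes>\<^bsub>free_group n\<^esub> gen 0 else gen i)"
  proof -
    have "\<exists>\<phi>\<in>hom (free_group n) (free_group n). \<forall>i<n. \<phi> (gen i) = (if i = 0 then c \<otimes>\<^bsub>free_group n\<^esub> gen 0 else gen i)"
      by (rule exists_endo) (use car in auto)
    then show ?thesis using that by blast
  qed
  obtain b where b: "b \<in> hom (free_group n) (free_group n)"
    "\<And>i. i < n \<Longrightarrow> b (gen i) = (if i = 1 then gen 0 \<otimes>\<^bsub>free_group n\<^esub> gen 1 \<otimes>\<^bsub>free_group n\<^esub> inv\<^bsub>free_group n\<^esub> gen 0 else gen i)"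
  proof -
    have "\<exists>\<phi>\<in>hom (free_group n) (free_group n). \<forall>i<n. \<phi> (gen i) = (if i = 1 then gen 0 \<otimes>\<^bsub>free_group n\<^esub> gen 1 \<otimes>\<^bsub>free_group n\<^esub> inv\<^bsub>free_group n\<^esub> gen 0 else gen i)"
      by (rule exists_endo) (use car in auto)
    then show ?thesis using that by blast
  qed
  obtain f where f: "f \<in> carrier (johnson_target n k)"
    "ind n (k + 1) (a \<circ> b) = compose (carrier (nilp n (k + 1))) (hom_incl n k f) (ind n (k + 1) (b \<circ> a))"
    "dual_lie_embedding n k f 0 = (\<lambda>w. - lbr (rev l @ [1, 0]) w)"
    "dual_lie_embedding n k f 1 = lbr (1 # rev l @ [1])"
    "\<And>i. \<lbrakk>2 \<le> i; i < n\<rbrakk> \<Longrightarrow> dual_lie_embedding n k f i = (\<lambda>w. 0)"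
    by (rule commutator_relation[OF _ k(2) l(1-3) a(1) _ _ b(1), unfolded c_def[symmetric]])
      (use k n a(2) b(2) in auto)
  have a2: "cl n 2 (a x) = cl n 2 x" if x: "x \<in> carrier (free_group n)" for x
    using cl_eq_on_generators[OF a(1) endo_id _ x, of 1] a(2) c2 car by (simp add: cl_cancel numeral_2_eq_2)
  have b2: "cl n 2 (b x) = cl n 2 x" if x: "x \<in> carrier (free_group n)" for x
    using cl_eq_on_generators[OF b(1) endo_id _ x, of 1] b(2) cl_conj[OF car(2,3)]
    by (simp add: numeral_2_eq_2)
  obtain \<psi> where la: "lifts n (k + 1) (ind n (k + 1) a) a \<psi>"
    using lifts_identity_on_H[OF _ a(1) a2, of "k + 1"] by auto
  obtain \<psi>' where lb: "lifts n (k + 1) (ind n (k + 1) b) b \<psi>'"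
    using lifts_identity_on_H[OF _ b(1) b2, of "k + 1"] by auto
  show ?thesis
  proof (rule E.transgression_nontrivial[OF trace_alt_invariant[OF k1] lifts_Aut[OF la] lifts_Aut[OF lb] f(1)])
    show "ind n (k + 1) a \<otimes>\<^bsub>AutoGroup (nilp n (k + 1))\<^esub> ind n (k + 1) b =
        hom_incl n k f \<otimes>\<^bsub>AutoGroup (nilp n (k + 1))\<^esub> (ind n (k + 1) b \<otimes>\<^bsub>AutoGroup (nilp n (k + 1))\<^esub> ind n (k + 1) a)"
      using lifts_Aut[OF la] lifts_Aut[OF lb] E.i_closed[OF f(1)] E.G.m_closed[OF lifts_Aut[OF lb] lifts_Aut[OF la]]
      by (simp only: Aut_mult ind_compose[OF a(1) b(1)] ind_compose[OF b(1) a(1)] f(2))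
    show "ext_act n k (aut_descend n (k + 1) k (ind n (k + 1) a)) m = m"
      "ext_act n k (aut_descend n (k + 1) k (ind n (k + 1) b)) m = m" if "m \<in> carrier (ext_power_rat n k)" for m
      using ext_act_trivial[OF k1 lifts_descend[OF la] a2 that] ext_act_trivial[OF k1 lifts_descend[OF lb] b2 that]
      by simp_all
    show "trace_alt n k f \<noteq> \<one>\<^bsub>ext_power_rat n k\<^esub>"
      using trace_value_odd[OF k(1)] k
      by (intro trace_alt_nontrivial[OF _ k(2) l(1,4) f(3-5)]) (auto simp: l_def[symmetric] minus_one_power_iff)
  qed
qed

section \<open>The extension of the tame automorphism groups\<close>

abbreviation Aut_free :: "nat \<Rightarrow> ((nat \<times> bool) list \<Rightarrow> (nat \<times> bool) list) monoid" where
  "Aut_free n \<equiv> AutoGroup (free_group n)"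

interpretation AF: group "Aut_free n" for n
  by (rule F.AutoGroup)

interpretation AN: group "AutoGroup (nilp n k)" for n k
  by (rule N.AutoGroup)

lemma Aut_free_hom: "\<sigma> \<in> carrier (Aut_free n) \<Longrightarrow> \<sigma> \<in> hom (free_group n) (free_group n)"
  by (simp add: Aut_iff)

lemma Aut_free_inverse:
  assumes \<sigma>: "\<sigma> \<in> carrier (Aut_free n)" and x: "x \<in> carrier (free_group n)"
  shows "\<sigma> ((inv\<^bsub>Aut_free n\<^esub> \<sigma>) x) = x" "(inv\<^bsub>Aut_free n\<^esub> \<sigma>) (\<sigma> x) = x"
proof -
  let ?i = "inv\<^bsub>Aut_free n\<^esub> \<sigma>"
  have i: "?i \<in> carrier (Aut_free n)" using \<sigma> by simp
  have "compose (carrier (free_group n)) \<sigma> ?i = (\<lambda>x\<in>carrier (free_group n). x)"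
    "compose (carrier (free_group n)) ?i \<sigma> = (\<lambda>x\<in>carrier (free_group n). x)"
    using AF.r_inv[OF \<sigma>] AF.l_inv[OF \<sigma>] by (simp_all only: Aut_mult[OF \<sigma> i] Aut_mult[OF i \<sigma>] Aut_one)
  then show "\<sigma> (?i x) = x" "?i (\<sigma> x) = x"
    using x by (metis compose_eq restrict_apply')+
qed

lemma lifts_Aut_free:
  assumes \<sigma>: "\<sigma> \<in> carrier (Aut_free n)"
  shows "lifts n k (ind n k \<sigma>) \<sigma> (inv\<^bsub>Aut_free n\<^esub> \<sigma>)"
  using Aut_free_inverse[OF \<sigma>] Aut_free_hom[OF \<sigma>] Aut_free_hom[OF AF.inv_closed[OF \<sigma>]]
  by (simp add: lifts_def)

text \<open>An automorphism of the free group maps a coset onto a whole coset, the inverse supplying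
  preimages. Facts about \<open>ind\<close> thereby transfer to the tame groups.\<close>

lemma aut_reduce_eq:
  assumes \<sigma>: "\<sigma> \<in> carrier (Aut_free n)"
  shows "aut_reduce n k \<sigma> = ind n k \<sigma>"
proof (rule nilp_ext[OF _ ind_extensional])
  show "aut_reduce n k \<sigma> \<in> extensional (carrier (nilp n k))" by (simp add: aut_reduce_def)
  fix x assume x: "x \<in> carrier (free_group n)"
  let ?i = "inv\<^bsub>Aut_free n\<^esub> \<sigma>"
  have h: "\<sigma> \<in> hom (free_group n) (free_group n)" "?i \<in> hom (free_group n) (free_group n)"
    using Aut_free_hom[OF \<sigma>] Aut_free_hom[OF AF.inv_closed[OF \<sigma>]] .
  have "\<sigma> ` cl n (Suc k) x = cl n (Suc k) (\<sigma> x)"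
  proof
    show "\<sigma> ` cl n (Suc k) x \<subseteq> cl n (Suc k) (\<sigma> x)"
    proof
      fix z assume "z \<in> \<sigma> ` cl n (Suc k) x"
      then obtain y where y: "z = \<sigma> y" "y \<in> carrier (free_group n)" "cl n (Suc k) y = cl n (Suc k) x"
        using x by (auto simp: mem_cl_iff)
      then show "z \<in> cl n (Suc k) (\<sigma> x)"
        using endo_cl_eq[OF h(1) y(3,2) x] h(1) x by (simp add: mem_cl_iff)
    qed
    show "cl n (Suc k) (\<sigma> x) \<subseteq> \<sigma> ` cl n (Suc k) x"
    proof
      fix z assume "z \<in> cl n (Suc k) (\<sigma> x)"
      then have z: "z \<in> carrier (free_group n)" "cl n (Suc k) z = cl n (Suc k) (\<sigma> x)"
        using x h(1) by (auto simp: mem_cl_iff)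
      have "cl n (Suc k) (?i z) = cl n (Suc k) x"
        using endo_cl_eq[OF h(2) z(2,1)] x h(1) Aut_free_inverse(2)[OF \<sigma> x] by simp
      then have "?i z \<in> cl n (Suc k) x" using x z(1) h(2) by (simp add: mem_cl_iff)
      then show "z \<in> \<sigma> ` cl n (Suc k) x" using Aut_free_inverse(1)[OF \<sigma> z(1)] by (metis imageI)
    qed
  qed
  then show "aut_reduce n k \<sigma> (cl n (Suc k) x) = ind n k \<sigma> (cl n (Suc k) x)"
    using x h(1) by (simp add: aut_reduce_def nilp_carrier ind_cl)
qed

lemma aut_reduce_hom: "aut_reduce n k \<in> hom (Aut_free n) (AutoGroup (nilp n k))"
proof (rule homI)
  fix \<sigma> assume \<sigma>: "\<sigma> \<in> carrier (Aut_free n)"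
  show \<sigma>A: "aut_reduce n k \<sigma> \<in> carrier (AutoGroup (nilp n k))"
    unfolding aut_reduce_eq[OF \<sigma>] by (rule lifts_Aut[OF lifts_Aut_free[OF \<sigma>]])
  fix \<tau> assume \<tau>: "\<tau> \<in> carrier (Aut_free n)"
  have \<sigma>\<tau>: "\<sigma> \<otimes>\<^bsub>Aut_free n\<^esub> \<tau> \<in> carrier (Aut_free n)" using \<sigma> \<tau> by simp
  have "ind n k (\<sigma> \<otimes>\<^bsub>Aut_free n\<^esub> \<tau>) = ind n k (\<sigma> \<circ> \<tau>)"
    using Aut_free_hom[OF \<sigma>\<tau>] Aut_free_hom[OF \<sigma>] Aut_free_hom[OF \<tau>]
    by (intro ind_eqI endo_compose) (simp_all add: Aut_mult[OF \<sigma> \<tau>] compose_eq)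
  also have "\<dots> = ind n k \<sigma> \<otimes>\<^bsub>AutoGroup (nilp n k)\<^esub> ind n k \<tau>"
    using lifts_Aut[OF lifts_Aut_free[OF \<sigma>]] lifts_Aut[OF lifts_Aut_free[OF \<tau>]] Aut_free_hom[OF \<sigma>] Aut_free_hom[OF \<tau>]
    by (simp add: Aut_mult ind_compose)
  finally show "aut_reduce n k (\<sigma> \<otimes>\<^bsub>Aut_free n\<^esub> \<tau>) =
      aut_reduce n k \<sigma> \<otimes>\<^bsub>AutoGroup (nilp n k)\<^esub> aut_reduce n k \<tau>"
    by (simp only: aut_reduce_eq[OF \<sigma>] aut_reduce_eq[OF \<tau>] aut_reduce_eq[OF \<sigma>\<tau>])
qed

interpretation red: group_hom "Aut_free n" "AutoGroup (nilp n k)" "aut_reduce n k" for n k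
  by unfold_locales (rule aut_reduce_hom)

lemma aut_descend_reduce:
  assumes "\<sigma> \<in> carrier (Aut_free n)" "j \<le> k"
  shows "aut_descend n k j (aut_reduce n k \<sigma>) = aut_reduce n j \<sigma>"
  using lifts_descend[OF lifts_Aut_free[OF assms(1)] assms(2)]
  by (simp add: aut_reduce_eq[OF assms(1)] lifts_def)

lemma subgroup_tame: "subgroup (carrier (tame n k)) (AutoGroup (nilp n k))"
  using red.img_is_subgroup by (simp add: tame_def)

lemma tame_mult [simp]: "monoid.mult (tame n k) = monoid.mult (AutoGroup (nilp n k))"
  by (simp add: tame_def)

lemma tame_one [simp]: "\<one>\<^bsub>tame n k\<^esub> = \<one>\<^bsub>AutoGroup (nilp n k)\<^esub>"
  by (simp add: tame_def)

lemma tame_carrier: "carrier (tame n k) = aut_reduce n k ` carrier (Aut_free n)"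
  by (simp add: tame_def)

lemma tame_closed: "\<alpha> \<in> carrier (tame n k) \<Longrightarrow> \<alpha> \<in> carrier (AutoGroup (nilp n k))"
  using subgroup_tame by (rule subgroup.mem_carrier)

lemma group_tame: "group (tame n k)"
  using subgroup.subgroup_is_group[OF subgroup_tame N.AutoGroup, of n k] by (simp add: tame_def)

section \<open>The graded quotients of the Johnson filtration and their extension\<close>

lemma johnson_filtration_iff:
  "\<sigma> \<in> johnson_filtration n k \<longleftrightarrow> \<sigma> \<in> carrier (Aut_free n) \<and> aut_reduce n k \<sigma> = \<one>\<^bsub>AutoGroup (nilp n k)\<^esub>"
  by (simp add: johnson_filtration_def kernel_def)

lemma johnson_filtration_Suc: "johnson_filtration n (k + 1) \<subseteq> johnson_filtration n k"
proof
  fix \<sigma> assume "\<sigma> \<in> johnson_filtration n (k + 1)"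
  then have \<sigma>: "\<sigma> \<in> carrier (Aut_free n)" "aut_reduce n (k + 1) \<sigma> = \<one>\<^bsub>AutoGroup (nilp n (k + 1))\<^esub>"
    by (simp_all only: johnson_filtration_iff)
  have "aut_reduce n k \<sigma> = aut_descend n (k + 1) k \<one>\<^bsub>AutoGroup (nilp n (k + 1))\<^esub>"
    using aut_descend_reduce[OF \<sigma>(1), of k "k + 1"] \<sigma>(2) by simp
  also have "\<dots> = \<one>\<^bsub>AutoGroup (nilp n k)\<^esub>"
    by (rule hom_one[OF aut_descend_hom AN.is_group AN.is_group]) simp
  finally show "\<sigma> \<in> johnson_filtration n k" using \<sigma>(1) by (simp add: johnson_filtration_iff)
qed

interpretation JF: normal "johnson_filtration n k" "Aut_free n" for n k
  unfolding johnson_filtration_def by (rule red.normal_kernel)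

abbreviation jcl :: "nat \<Rightarrow> nat \<Rightarrow> ((nat \<times> bool) list \<Rightarrow> (nat \<times> bool) list) \<Rightarrow>
    ((nat \<times> bool) list \<Rightarrow> (nat \<times> bool) list) set" where
  "jcl n k \<sigma> \<equiv> johnson_filtration n (k + 1) #>\<^bsub>Aut_free n\<^esub> \<sigma>"

lemma gr_johnson_carrier: "carrier (gr_johnson n k) = jcl n k ` johnson_filtration n k"
  by (simp add: gr_johnson_def carrier_FactGroup)

lemma gr_johnson_mult:
  "\<lbrakk>\<sigma> \<in> carrier (Aut_free n); \<tau> \<in> carrier (Aut_free n)\<rbrakk> \<Longrightarrow>
    jcl n k \<sigma> \<otimes>\<^bsub>gr_johnson n k\<^esub> jcl n k \<tau> = jcl n k (\<sigma> \<otimes>\<^bsub>Aut_free n\<^esub> \<tau>)"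
  using JF.rcos_sum[of \<sigma> n \<tau> "k + 1"] by (simp add: gr_johnson_def set_mult_def)

lemma group_gr_johnson: "group (gr_johnson n k)"
proof -
  have "johnson_filtration n (k + 1) \<lhd> (Aut_free n)\<lparr>carrier := johnson_filtration n k\<rparr>"
    by (intro AF.normal_restrict_supergroup JF.subgroup_axioms JF.normal_axioms johnson_filtration_Suc)
  then show ?thesis by (simp add: gr_johnson_def normal.factorgroup_is_group)
qed

lemma aut_reduce_jcl:
  assumes \<sigma>: "\<sigma> \<in> carrier (Aut_free n)" and \<tau>: "\<tau> \<in> jcl n k \<sigma>"
  shows "\<tau> \<in> carrier (Aut_free n)" "aut_reduce n (k + 1) \<tau> = aut_reduce n (k + 1) \<sigma>"
proof -
  obtain \<rho> where \<rho>: "\<rho> \<in> johnson_filtration n (k + 1)" "\<tau> = \<rho> \<otimes>\<^bsub>Aut_free n\<^esub> \<sigma>"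
    using \<tau> by (auto simp: r_coset_def)
  then have "\<rho> \<in> carrier (Aut_free n)" "aut_reduce n (k + 1) \<rho> = \<one>\<^bsub>AutoGroup (nilp n (k + 1))\<^esub>"
    by (simp_all only: johnson_filtration_iff)
  then show "\<tau> \<in> carrier (Aut_free n)" "aut_reduce n (k + 1) \<tau> = aut_reduce n (k + 1) \<sigma>"
    using \<sigma> \<rho>(2) red.hom_closed[OF \<sigma>, of "k + 1"] by (simp_all add: red.hom_mult del: One_nat_def add_Suc_right)
qed

lemma gr_incl_jcl:
  assumes \<sigma>: "\<sigma> \<in> carrier (Aut_free n)"
  shows "gr_incl n k (jcl n k \<sigma>) = aut_reduce n (k + 1) \<sigma>"
proof -
  have "\<sigma> \<in> jcl n k \<sigma>" using \<sigma> by (rule AF.rcos_self[OF _ JF.subgroup_axioms])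
  then have "aut_reduce n (k + 1) ` jcl n k \<sigma> = {aut_reduce n (k + 1) \<sigma>}"
    using aut_reduce_jcl(2)[OF \<sigma>] by blast
  then show ?thesis by (simp add: gr_incl_def)
qed

lemma gr_incl_hom: "gr_incl n k \<in> hom (gr_johnson n k) (tame n (k + 1))"
proof (rule homI)
  fix S T assume "S \<in> carrier (gr_johnson n k)" "T \<in> carrier (gr_johnson n k)"
  then obtain \<sigma> \<tau> where "S = jcl n k \<sigma>" "\<sigma> \<in> carrier (Aut_free n)" "T = jcl n k \<tau>" "\<tau> \<in> carrier (Aut_free n)"
    by (auto simp: gr_johnson_carrier johnson_filtration_iff)
  then show "gr_incl n k (S \<otimes>\<^bsub>gr_johnson n k\<^esub> T) = gr_incl n k S \<otimes>\<^bsub>tame n (k + 1)\<^esub> gr_incl n k T"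
    by (simp only: gr_johnson_mult gr_incl_jcl AF.m_closed red.hom_mult tame_mult)
next
  fix S assume "S \<in> carrier (gr_johnson n k)"
  then show "gr_incl n k S \<in> carrier (tame n (k + 1))"
    by (auto simp: gr_johnson_carrier johnson_filtration_iff gr_incl_jcl[unfolded Suc_eq_plus1[symmetric]] tame_carrier)
qed

lemma gr_incl_inj: "inj_on (gr_incl n k) (carrier (gr_johnson n k))"
proof (rule inj_onI)
  fix S T assume "S \<in> carrier (gr_johnson n k)" "T \<in> carrier (gr_johnson n k)"
    and eq: "gr_incl n k S = gr_incl n k T"
  then obtain \<sigma> \<tau> where st: "S = jcl n k \<sigma>" "\<sigma> \<in> carrier (Aut_free n)" "T = jcl n k \<tau>" "\<tau> \<in> carrier (Aut_free n)"
    by (auto simp: gr_johnson_carrier johnson_filtration_iff)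
  have "aut_reduce n (k + 1) (\<sigma> \<otimes>\<^bsub>Aut_free n\<^esub> inv\<^bsub>Aut_free n\<^esub> \<tau>) = \<one>\<^bsub>AutoGroup (nilp n (k + 1))\<^esub>"
    using eq st gr_incl_jcl[of \<sigma> n k] gr_incl_jcl[of \<tau> n k] red.hom_closed[OF st(4), of "k + 1"]
    by (simp only: red.hom_mult AF.inv_closed red.hom_inv AN.r_inv)
  then have "\<sigma> \<otimes>\<^bsub>Aut_free n\<^esub> inv\<^bsub>Aut_free n\<^esub> \<tau> \<in> johnson_filtration n (k + 1)"
    using st by (simp only: johnson_filtration_iff AF.m_closed AF.inv_closed simp_thms)
  then show "S = T" using st by (simp only: JF.rcos_eq_iff)
qed

lemma gr_incl_exact:
  assumes "g \<in> carrier (tame n (k + 1))"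
  shows "aut_descend n (k + 1) k g = \<one>\<^bsub>AutoGroup (nilp n k)\<^esub> \<longleftrightarrow> g \<in> gr_incl n k ` carrier (gr_johnson n k)"
proof -
  have *: "aut_descend n (k + 1) k (aut_reduce n (k + 1) \<sigma>) = aut_reduce n k \<sigma>" if "\<sigma> \<in> carrier (Aut_free n)" for \<sigma>
    using that by (rule aut_descend_reduce) simp
  show ?thesis
  proof
    assume one: "aut_descend n (k + 1) k g = \<one>\<^bsub>AutoGroup (nilp n k)\<^esub>"
    obtain \<sigma> where \<sigma>: "\<sigma> \<in> carrier (Aut_free n)" "g = aut_reduce n (k + 1) \<sigma>"
      using assms by (auto simp only: tame_carrier)
    then have "jcl n k \<sigma> \<in> carrier (gr_johnson n k)"
      using one *[OF \<sigma>(1)] by (auto simp only: gr_johnson_carrier johnson_filtration_iff)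
    then show "g \<in> gr_incl n k ` carrier (gr_johnson n k)"
      using gr_incl_jcl[OF \<sigma>(1), of k] \<sigma>(2) by (metis imageI)
  next
    assume "g \<in> gr_incl n k ` carrier (gr_johnson n k)"
    then obtain \<sigma> where "\<sigma> \<in> carrier (Aut_free n)" "g = aut_reduce n (k + 1) \<sigma>"
      "aut_reduce n k \<sigma> = \<one>\<^bsub>AutoGroup (nilp n k)\<^esub>"
      using gr_incl_jcl by (fastforce simp only: gr_johnson_carrier johnson_filtration_iff image_iff)
    then show "aut_descend n (k + 1) k g = \<one>\<^bsub>AutoGroup (nilp n k)\<^esub>" using * by simp
  qed
qed

lemma module_extension_tame:
  assumes k: "1 \<le> k"
  shows "module_extension (gr_johnson n k) (tame n (k + 1)) (tame n k) (ext_power_rat n k)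
    (gr_incl n k) (aut_descend n (k + 1) k) (ext_act n k)"
proof (intro module_extension.intro module_extension_axioms.intro)
  show surj: "aut_descend n (k + 1) k ` carrier (tame n (k + 1)) = carrier (tame n k)"
    using aut_descend_reduce[of _ n k "k + 1"] by (simp add: tame_carrier image_image)
  show "aut_descend n (k + 1) k \<in> hom (tame n (k + 1)) (tame n k)"
  proof (rule homI)
    show "aut_descend n (k + 1) k \<alpha> \<in> carrier (tame n k)" if "\<alpha> \<in> carrier (tame n (k + 1))" for \<alpha>
      using surj that by blast
  qed (simp only: tame_mult hom_mult[OF aut_descend_hom[of k "k + 1" n]] le_add1 tame_closed)
qed (simp_all only: group_gr_johnson group_tame comm_group_ext_power gr_incl_hom gr_incl_inj gr_incl_exact
  tame_one tame_mult ext_act_properties[OF k tame_closed] tame_closed ext_act_one[OF k])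

text \<open>The Johnson homomorphism uses the left quotient x^-1 \<sigma>(x), whereas
  \<open>hom_incl\<close> multiplies by f([x]) on the left; the two agree because
  \<Gamma>(k+1)/\<Gamma>(k+2) is central. Thus the tame extension sits inside the full one, and
  results for the latter can be restricted.\<close>

lemma hom_incl_johnson_hom:
  assumes k: "1 \<le> k" and S: "S \<in> carrier (gr_johnson n k)"
  shows "johnson_hom n k S \<in> carrier (johnson_target n k)"
    and "hom_incl n k (johnson_hom n k S) = gr_incl n k S"
proof -
  obtain \<sigma> where \<sigma>: "S = jcl n k \<sigma>" "\<sigma> \<in> johnson_filtration n k"
    using S by (auto simp: gr_johnson_carrier)
  then have \<sigma>A: "\<sigma> \<in> carrier (Aut_free n)" by (simp add: johnson_filtration_iff)
  have "gr_incl n k S \<in> carrier (tame n (k + 1))" using hom_in_carrier[OF gr_incl_hom S] .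
  moreover have "aut_descend n (k + 1) k (gr_incl n k S) = \<one>\<^bsub>AutoGroup (nilp n k)\<^esub>"
    using calculation S gr_incl_exact by blast
  ultimately obtain f where f: "f \<in> carrier (johnson_target n k)" "gr_incl n k S = hom_incl n k f"
    using hom_incl_exact[OF k tame_closed] by blast
  have rep: "cl n (k + 2) (inv\<^bsub>free_group n\<^esub> z \<otimes>\<^bsub>free_group n\<^esub> \<tau> z) = f (cl n 2 x)"
    if x: "x \<in> carrier (free_group n)" and \<tau>: "\<tau> \<in> S" and z: "z \<in> cl n 2 x" for x \<tau> z
  proof -
    have \<tau>A: "\<tau> \<in> carrier (Aut_free n)" "ind n (k + 1) \<tau> = hom_incl n k f"
      using aut_reduce_jcl[OF \<sigma>A] \<tau> \<sigma>(1) gr_incl_jcl[OF \<sigma>A] f(2) aut_reduce_eq by metis+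
    have zc: "z \<in> carrier (free_group n)" "cl n 2 z = cl n 2 x" using z x by (auto simp: mem_cl_iff)
    have h: "\<tau> \<in> hom (free_group n) (free_group n)" by (rule Aut_free_hom[OF \<tau>A(1)])
    obtain y where y: "y \<in> \<Gamma> n (k + 1)" "f (cl n 2 z) = cl n (k + 2) y" using johnson_target_rep[OF f(1) zc(1)] .
    have yc: "y \<in> carrier (free_group n)" using y(1) by (rule F.lower_central_closed)
    have "cl n (k + 2) (\<tau> z) = cl n (k + 2) (y \<otimes>\<^bsub>free_group n\<^esub> z)"
      using ind_cl[OF h zc(1), of "k + 1"] hom_incl_cl_eq[where f = f, OF zc(1) y(2,1)] \<tau>A(2) by simp
    also have "\<dots> = cl n (k + 2) (z \<otimes>\<^bsub>free_group n\<^esub> y)"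
      using cl_commute[OF y(1) zc(1)] by simp
    finally have "cl n (k + 2) (inv\<^bsub>free_group n\<^esub> z) <#>\<^bsub>free_group n\<^esub> cl n (k + 2) (\<tau> z) = cl n (k + 2) (inv\<^bsub>free_group n\<^esub> z) <#>\<^bsub>free_group n\<^esub> cl n (k + 2) (z \<otimes>\<^bsub>free_group n\<^esub> y)"
      by simp
    then show ?thesis using zc h yc y(2) by (simp add: cl_mult)
  qed
  have "\<sigma> \<in> S" unfolding \<sigma>(1) using \<sigma>A by (rule AF.rcos_self[OF _ JF.subgroup_axioms])
  then have "johnson_hom n k S = f"
  proof (intro extensionalityI[of _ "carrier (abelianization n)"])
    show "johnson_hom n k S \<in> extensional (carrier (abelianization n))" by (simp add: johnson_hom_def)
    show "f \<in> extensional (carrier (abelianization n))" using f(1) by (simp add: hom_group_carrier)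
    fix C assume "C \<in> carrier (abelianization n)"
    then obtain x where x: "C = cl n 2 x" "x \<in> carrier (free_group n)" by (auto simp: abelianization_carrier)
    have "(\<Union>\<tau>\<in>S. \<Union>z\<in>cl n 2 x. cl n (k + 2) (inv\<^bsub>free_group n\<^esub> z \<otimes>\<^bsub>free_group n\<^esub> \<tau> z)) = (\<Union>\<tau>\<in>S. \<Union>z\<in>cl n 2 x. f (cl n 2 x))"
      using rep[OF x(2)] by (intro SUP_cong refl)
    also have "\<dots> = f (cl n 2 x)" using \<open>\<sigma> \<in> S\<close> cl_self[OF x(2), of 2] by blast
    finally show "johnson_hom n k S C = f C" using x by (simp add: johnson_hom_def abelianization_carrier)
  qed
  then show "johnson_hom n k S \<in> carrier (johnson_target n k)"
    "hom_incl n k (johnson_hom n k S) = gr_incl n k S" using f by simp_all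
qed

text \<open>Additivity is inherited from the two inclusions: \<open>hom_incl\<close> is injective,
  and composed with \<open>johnson_hom\<close> it is the homomorphism
  \<open>gr_incl\<close>.\<close>

lemma johnson_hom_hom:
  assumes k: "1 \<le> k"
  shows "johnson_hom n k \<in> hom (gr_johnson n k) (johnson_target n k)"
proof (rule homI)
  interpret K: group "gr_johnson n k" by (rule group_gr_johnson)
  interpret J: group "johnson_target n k" by (rule group_johnson_target)
  fix S T assume ST: "S \<in> carrier (gr_johnson n k)" "T \<in> carrier (gr_johnson n k)"
  note jS = hom_incl_johnson_hom[OF k ST(1)] and jT = hom_incl_johnson_hom[OF k ST(2)]
    and jST = hom_incl_johnson_hom[OF k K.m_closed[OF ST]]
  show "johnson_hom n k (S \<otimes>\<^bsub>gr_johnson n k\<^esub> T) =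
      johnson_hom n k S \<otimes>\<^bsub>johnson_target n k\<^esub> johnson_hom n k T"
  proof (rule inj_onD[OF hom_incl_inj _ jST(1) J.m_closed[OF jS(1) jT(1)]])
    show "hom_incl n k (johnson_hom n k (S \<otimes>\<^bsub>gr_johnson n k\<^esub> T)) =
        hom_incl n k (johnson_hom n k S \<otimes>\<^bsub>johnson_target n k\<^esub> johnson_hom n k T)"
      unfolding hom_mult[OF hom_incl_in_hom[OF k] jS(1) jT(1)] jS(2) jT(2) jST(2)
      using hom_mult[OF gr_incl_hom ST] by (simp only: tame_mult)
  qed
qed (rule hom_incl_johnson_hom(1)[OF k])

lemma trace_johnson_invariant:
  assumes k: "1 \<le> k"
  shows "trace_alt n k \<circ> johnson_hom n k \<in> invariant_homs (gr_johnson n k) (gr_incl n k) (tame n (k + 1))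
    (aut_descend n (k + 1) k) (ext_power_rat n k) (ext_act n k)"
proof -
  interpret E: module_extension "gr_johnson n k" "tame n (k + 1)" "tame n k"
    "ext_power_rat n k" "gr_incl n k" "aut_descend n (k + 1) k" "ext_act n k"
    by (rule module_extension_tame[OF k])
  let ?A = "tame n (k + 1)"
  have "trace_alt n k (johnson_hom n k (E.unincl (\<alpha> \<otimes>\<^bsub>?A\<^esub> gr_incl n k S \<otimes>\<^bsub>?A\<^esub> inv\<^bsub>?A\<^esub> \<alpha>))) =
      ext_act n k (aut_descend n (k + 1) k \<alpha>) (trace_alt n k (johnson_hom n k S))"
    if \<alpha>: "\<alpha> \<in> carrier ?A" and S: "S \<in> carrier (gr_johnson n k)" for \<alpha> S
  proof -
    obtain \<phi> \<psi> where l: "lifts n (k + 1) \<alpha> \<phi> \<psi>" using Aut_lifts[OF tame_closed[OF \<alpha>]] .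
    let ?c = "\<alpha> \<otimes>\<^bsub>?A\<^esub> gr_incl n k S \<otimes>\<^bsub>?A\<^esub> inv\<^bsub>?A\<^esub> \<alpha>"
    have c: "?c \<in> carrier ?A" "aut_descend n (k + 1) k ?c = \<one>\<^bsub>tame n k\<^esub>"
      using \<alpha> E.i_closed[OF S] by (simp_all only: E.G.m_closed E.G.inv_closed E.p_mult E.p_inv E.p_i[OF S]
          E.Q.r_one E.p_closed E.Q.r_inv)
    note g = E.unincl_props[OF c]
    have "gr_incl n k (E.unincl ?c) \<otimes>\<^bsub>?A\<^esub> \<alpha> = \<alpha> \<otimes>\<^bsub>?A\<^esub> gr_incl n k S"
      unfolding g(2) using \<alpha> E.i_closed[OF S]
      by (simp only: E.G.m_assoc E.G.m_closed E.G.inv_closed E.G.l_inv E.G.r_one)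
    then have "trace_alt n k (johnson_hom n k (E.unincl ?c)) =
        ext_map n k (mat n \<phi>) (trace_alt n k (johnson_hom n k S))"
      using hom_incl_johnson_hom[OF k S] hom_incl_johnson_hom[OF k g(1)]
      by (intro trace_alt_equivariant[OF k l]) (simp_all only: tame_mult)
    then show ?thesis using ext_act_lifts[OF lifts_descend[OF l] k] by simp
  qed
  moreover have "trace_alt n k \<circ> johnson_hom n k \<in> hom (gr_johnson n k) (ext_power_rat n k)"
    by (rule hom_compose[OF johnson_hom_hom[OF k] trace_alt_hom])
  ultimately show ?thesis unfolding invariant_homs_def E.unincl_def by simp
qed

text \<open>Elements of \<open>AutoGroup\<close> are extensional functions, hence the restriction;
  it induces the same maps on the quotients as \<open>\<phi>\<close>.\<close>

lemma Aut_freeI: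
  assumes \<phi>: "\<phi> \<in> hom (free_group n) (free_group n)" and \<psi>: "\<psi> \<in> hom (free_group n) (free_group n)"
    and inv: "\<And>i. i < n \<Longrightarrow> \<phi> (\<psi> (gen i)) = gen i" "\<And>i. i < n \<Longrightarrow> \<psi> (\<phi> (gen i)) = gen i"
  shows "restrict \<phi> (carrier (free_group n)) \<in> carrier (Aut_free n)"
    and "aut_reduce n k (restrict \<phi> (carrier (free_group n))) = ind n k \<phi>"
proof -
  let ?\<sigma> = "restrict \<phi> (carrier (free_group n))"
  have 1: "\<phi> (\<psi> x) = x" "\<psi> (\<phi> x) = x" if "x \<in> carrier (free_group n)" for x
    using free_group_hom_eq[OF F.is_group endo_compose[OF \<phi> \<psi>] endo_id _ that]
      free_group_hom_eq[OF F.is_group endo_compose[OF \<psi> \<phi>] endo_id _ that] inv by auto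
  have \<sigma>: "?\<sigma> \<in> hom (free_group n) (free_group n)" by (rule F.hom_restrict[OF \<phi>]) simp
  have "bij_betw ?\<sigma> (carrier (free_group n)) (carrier (free_group n))"
    by (rule bij_betwI[of _ _ _ \<psi>]) (use 1 \<phi> \<psi> in auto)
  then show A: "?\<sigma> \<in> carrier (Aut_free n)" using \<sigma> by (simp add: Aut_iff)
  show "aut_reduce n k ?\<sigma> = ind n k \<phi>"
    unfolding aut_reduce_eq[OF A] by (rule ind_eqI[OF \<sigma> \<phi>]) simp
qed

lemma transgression_johnson_nontrivial:
  assumes k: "even k" "2 \<le> k" "k \<le> n"
  shows "transgression (gr_johnson n k) (gr_incl n k) (tame n (k + 1)) (aut_descend n (k + 1) k)
      (tame n k) (ext_power_rat n k) (ext_act n k) (trace_alt n k \<circ> johnson_hom n k)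
    \<in> carrier (cohomology2 (tame n k) (ext_power_rat n k) (ext_act n k))
      - {\<one>\<^bsub>cohomology2 (tame n k) (ext_power_rat n k) (ext_act n k)\<^esub>}"
proof -
  have k1: "1 \<le> k" and n: "0 < n" "1 < n" using k by auto
  interpret E: module_extension "gr_johnson n k" "tame n (k + 1)" "tame n k"
    "ext_power_rat n k" "gr_incl n k" "aut_descend n (k + 1) k" "ext_act n k"
    by (rule module_extension_tame[OF k1])
  define l where "l = [2..<k] @ [0]"
  have l: "length l = k - 1" "set l \<subseteq> {..<n}" "1 \<notin> set l" "set l \<subseteq> {..<k}"
    using k by (auto simp: l_def)
  define u where "u = left_normed n (gen 1) [2..<k]"
  have car: "gen 0 \<in> carrier (free_group n)" "gen 1 \<in> carrier (free_group n)" using n by auto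
  have u: "u \<in> carrier (free_group n)"
    unfolding u_def
    by (rule F.lower_central_closed[OF left_normed_in[of _ n 0]]) (use n k in auto)
  have c: "left_normed n (gen 1) l \<otimes>\<^bsub>free_group n\<^esub> gen 0 = u \<otimes>\<^bsub>free_group n\<^esub> gen 0 \<otimes>\<^bsub>free_group n\<^esub> inv\<^bsub>free_group n\<^esub> u"
    using u car unfolding l_def left_normed_snoc u_def[symmetric] by (simp add: commutator_def F.m_assoc)
  have endo: "\<exists>\<phi>\<in>hom (free_group n) (free_group n). \<forall>i<n. \<phi> (gen i) =
      (if i = j then x \<otimes>\<^bsub>free_group n\<^esub> gen j \<otimes>\<^bsub>free_group n\<^esub> inv\<^bsub>free_group n\<^esub> x else gen i)"
    if "x \<in> carrier (free_group n)" "j < n" for j x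
    by (rule exists_endo) (use that in auto)
  obtain a where a: "a \<in> hom (free_group n) (free_group n)"
    "\<And>i. i < n \<Longrightarrow> a (gen i) = (if i = 0 then u \<otimes>\<^bsub>free_group n\<^esub> gen 0 \<otimes>\<^bsub>free_group n\<^esub> inv\<^bsub>free_group n\<^esub> u else gen i)"
    using endo[OF u n(1)] by blast
  obtain a' where a': "a' \<in> hom (free_group n) (free_group n)"
    "\<And>i. i < n \<Longrightarrow> a' (gen i) = (if i = 0 then inv\<^bsub>free_group n\<^esub> u \<otimes>\<^bsub>free_group n\<^esub> gen 0 \<otimes>\<^bsub>free_group n\<^esub> inv\<^bsub>free_group n\<^esub> (inv\<^bsub>free_group n\<^esub> u) else gen i)"
    using endo[OF F.inv_closed[OF u] n(1)] by blast
  obtain b where b: "b \<in> hom (free_group n) (free_group n)"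
    "\<And>i. i < n \<Longrightarrow> b (gen i) = (if i = 1 then gen 0 \<otimes>\<^bsub>free_group n\<^esub> gen 1 \<otimes>\<^bsub>free_group n\<^esub> inv\<^bsub>free_group n\<^esub> gen 0 else gen i)"
    using endo[OF car(1) n(2)] by blast
  obtain b' where b': "b' \<in> hom (free_group n) (free_group n)"
    "\<And>i. i < n \<Longrightarrow> b' (gen i) = (if i = 1 then inv\<^bsub>free_group n\<^esub> gen 0 \<otimes>\<^bsub>free_group n\<^esub> gen 1 \<otimes>\<^bsub>free_group n\<^esub> inv\<^bsub>free_group n\<^esub> (inv\<^bsub>free_group n\<^esub> gen 0) else gen i)"
    using endo[OF F.inv_closed[OF car(1)] n(2)] by blast
  interpret a: group_hom "free_group n" "free_group n" a by unfold_locales (rule a(1))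
  interpret a': group_hom "free_group n" "free_group n" a' by unfold_locales (rule a'(1))
  interpret b: group_hom "free_group n" "free_group n" b by unfold_locales (rule b(1))
  interpret b': group_hom "free_group n" "free_group n" b' by unfold_locales (rule b'(1))
  \<comment> \<open>\<open>u\<close> involves only x_1, ..., x_(k-1), which neither \<open>a\<close>
    nor \<open>a'\<close> moves. Hence conjugating x_0 by u^-1 undoes conjugating it by u.\<close>
  have fix_u: "a u = u" "a' u = u"
    unfolding u_def using a a' n k by (auto intro!: endo_fixes_left_normed)
  let ?a = "restrict a (carrier (free_group n))" and ?b = "restrict b (carrier (free_group n))"
  have aa': "a (a' (gen i)) = gen i" "a' (a (gen i)) = gen i" if "i < n" for i
    using that u car n by (simp_all add: a(2) a'(2) fix_u F.m_assoc)
  have bb': "b (b' (gen i)) = gen i" "b' (b (gen i)) = gen i" if "i < n" for i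
    using that car n by (simp_all add: b(2) b'(2) F.m_assoc)
  have tame: "ind n (k + 1) a \<in> carrier (tame n (k + 1))" "ind n (k + 1) b \<in> carrier (tame n (k + 1))"
    using Aut_freeI(1)[OF a(1) a'(1) aa'] Aut_freeI(2)[OF a(1) a'(1) aa', of "k + 1"]
      Aut_freeI(1)[OF b(1) b'(1) bb'] Aut_freeI(2)[OF b(1) b'(1) bb', of "k + 1"]
    unfolding tame_carrier by (metis imageI)+
  obtain f where f: "f \<in> carrier (johnson_target n k)"
    "ind n (k + 1) (a \<circ> b) = compose (carrier (nilp n (k + 1))) (hom_incl n k f) (ind n (k + 1) (b \<circ> a))"
    "dual_lie_embedding n k f 0 = (\<lambda>w. - lbr (rev l @ [1, 0]) w)"
    "dual_lie_embedding n k f 1 = lbr (1 # rev l @ [1])"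
    "\<And>i. \<lbrakk>2 \<le> i; i < n\<rbrakk> \<Longrightarrow> dual_lie_embedding n k f i = (\<lambda>w. 0)"
    by (rule commutator_relation[OF k(2,3) l(1-3) a(1) _ _ b(1)])
      (use n a(2) b(2) c in auto)
  let ?A = "AutoGroup (nilp n (k + 1))"
  have fA: "hom_incl n k f \<in> carrier ?A" by (rule hom_incl_Aut[OF k1 f(1)])
  have rel: "ind n (k + 1) a \<otimes>\<^bsub>?A\<^esub> ind n (k + 1) b =
      hom_incl n k f \<otimes>\<^bsub>?A\<^esub> (ind n (k + 1) b \<otimes>\<^bsub>?A\<^esub> ind n (k + 1) a)"
    using tame_closed[OF tame(1)] tame_closed[OF tame(2)] fA
      AN.m_closed[OF tame_closed[OF tame(2)] tame_closed[OF tame(1)]]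
    by (simp only: Aut_mult ind_compose[OF a(1) b(1)] ind_compose[OF b(1) a(1)] f(2))
  \<comment> \<open>So far \<open>f\<close> only gives an element of the full automorphism group. As
    a quotient of tame elements it is tame, and exactness of the tame extension yields a class
    \<open>S\<close> whose Johnson image is \<open>f\<close>.\<close>
  have "hom_incl n k f = (ind n (k + 1) a \<otimes>\<^bsub>?A\<^esub> ind n (k + 1) b) \<otimes>\<^bsub>?A\<^esub>
      inv\<^bsub>?A\<^esub> (ind n (k + 1) b \<otimes>\<^bsub>?A\<^esub> ind n (k + 1) a)"
    unfolding rel using tame_closed[OF tame(1)] tame_closed[OF tame(2)] fA
    by (simp only: AN.m_assoc AN.m_closed AN.inv_closed AN.r_inv AN.r_one)
  also have "\<dots> \<in> carrier (tame n (k + 1))"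
    using tame subgroup_tame[of n "k + 1"] by (intro subgroup.m_closed subgroup.m_inv_closed)
  finally have "hom_incl n k f \<in> carrier (tame n (k + 1))" .
  moreover have "aut_descend n (k + 1) k (hom_incl n k f) = \<one>\<^bsub>AutoGroup (nilp n k)\<^esub>"
    using hom_incl_exact[OF k1 fA] f(1) by blast
  ultimately obtain S where S: "S \<in> carrier (gr_johnson n k)" "gr_incl n k S = hom_incl n k f"
    using gr_incl_exact[of "hom_incl n k f" n k] by (metis imageE)
  have jS: "johnson_hom n k S = f"
    using hom_incl_johnson_hom[OF k1 S(1)] S(2) f(1) hom_incl_inj by (metis inj_onD)
  have a2: "cl n 2 (a x) = cl n 2 x" if x: "x \<in> carrier (free_group n)" for x
    using cl_eq_on_generators[OF a(1) endo_id _ x, of 1] a(2) cl_conj[OF u car(1)]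
    by (simp add: numeral_2_eq_2)
  have b2: "cl n 2 (b x) = cl n 2 x" if x: "x \<in> carrier (free_group n)" for x
    using cl_eq_on_generators[OF b(1) endo_id _ x, of 1] b(2) cl_conj[OF car]
    by (simp add: numeral_2_eq_2)
  show ?thesis
  proof (rule E.transgression_nontrivial[OF trace_johnson_invariant[OF k1] tame S(1)])
    show "ind n (k + 1) a \<otimes>\<^bsub>tame n (k + 1)\<^esub> ind n (k + 1) b =
        gr_incl n k S \<otimes>\<^bsub>tame n (k + 1)\<^esub> (ind n (k + 1) b \<otimes>\<^bsub>tame n (k + 1)\<^esub> ind n (k + 1) a)"
      unfolding S(2) tame_mult by (rule rel)
    obtain \<psi> where la: "lifts n (k + 1) (ind n (k + 1) a) a \<psi>" using Aut_lift[OF a(1) tame_closed[OF tame(1)]] .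
    obtain \<psi>' where lb: "lifts n (k + 1) (ind n (k + 1) b) b \<psi>'" using Aut_lift[OF b(1) tame_closed[OF tame(2)]] .
    show "ext_act n k (aut_descend n (k + 1) k (ind n (k + 1) a)) m = m"
      "ext_act n k (aut_descend n (k + 1) k (ind n (k + 1) b)) m = m" if "m \<in> carrier (ext_power_rat n k)" for m
      using ext_act_trivial[OF k1 lifts_descend[OF la] a2 that] ext_act_trivial[OF k1 lifts_descend[OF lb] b2 that]
      by simp_all
    show "(trace_alt n k \<circ> johnson_hom n k) S \<noteq> \<one>\<^bsub>ext_power_rat n k\<^esub>"
      using trace_value_even[OF k(2,1)] trace_alt_nontrivial[OF k(2,3) l(1,4) f(3-5)]
      by (simp add: jS l_def[symmetric])
  qed
qed

theorem theorem4:
  fixes n k :: nat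
  shows
    "(even k \<and> 2 \<le> k \<and> k \<le> n \<longrightarrow>
        transgression (gr_johnson n k) (gr_incl n k) (tame n (k + 1)) (aut_descend n (k + 1) k)
            (tame n k) (ext_power_rat n k) (ext_act n k) (trace_alt n k \<circ> johnson_hom n k)
          \<in> carrier (cohomology2 (tame n k) (ext_power_rat n k) (ext_act n k))
            - {\<one>\<^bsub>cohomology2 (tame n k) (ext_power_rat n k) (ext_act n k)\<^esub>})
     \<and> (3 \<le> k \<and> k \<le> n \<longrightarrow>
        transgression (hom_group (abelianization n) (lie n (k + 1))) (hom_incl n k)
            (AutoGroup (nilp n (k + 1))) (aut_descend n (k + 1) k)
            (AutoGroup (nilp n k)) (ext_power_rat n k) (ext_act n k) (trace_alt n k)
          \<in> carrier (cohomology2 (AutoGroup (nilp n k)) (ext_power_rat n k) (ext_act n k))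
            - {\<one>\<^bsub>cohomology2 (AutoGroup (nilp n k)) (ext_power_rat n k) (ext_act n k)\<^esub>})"
  using transgression_johnson_nontrivial[of k n] transgression_Hom_nontrivial[of k n] by blast

end
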